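(* There is an algorithm that, given a caterpillar $T$, determines the unit acquisition number $a_u(T)$ in time $O(|V(T)|)$.
   Context: Graphs are finite, simple and undirected. The vertices of a graph carry nonnegative integer weights. A unit acquisition move transfers one unit of weight from a vertex $u$ of positive weight to a neighbor $v$ of $u$, under the condition that before the move the weight of $v$ is at least the weight of $u$. The unit acquisition number $a_u(G)$ of a graph $G$ is the minimum size to which the set of vertices with positive weight can be reduced via successive unit acquisition moves, starting from the configuration in which every vertex has weight $1$. A caterpillar is a tree in which all non-leaf vertices lie on one path. *)

theory Defs
  imports
    Complex_Main
    "HOL-Library.Landau_Symbols"
    "Graph_Theory.Graph_Theory"
begin

section \<open>Caterpillars\<close>

text \<open>
  A finite simple undirected graph is a \<^locale>\<open>pair_graph\<close>: finite, loop-free, with a symmetric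
  set of arcs; the edge \<open>{u, v}\<close> is the pair of arcs \<open>(u, v)\<close>, \<open>(v, u)\<close>. The constants
  \<open>forest\<close> and \<open>tree\<close> of \<^theory>\<open>Graph_Theory.Digraph_Component\<close> are unusable here, since they
  are about directed cycles, and in a symmetric digraph every edge gives the cycle \<open>u, v, u\<close>.
  Undirected acyclicity is therefore defined through cycles on at least three vertices.
\<close>

definition undirected_cycle :: "'a pair_pre_digraph \<Rightarrow> 'a list \<Rightarrow> bool" where
  "undirected_cycle G p \<longleftrightarrow> vpath p (with_proj G) \<and> 3 \<le> length p \<and> (last p, hd p) \<in> parcs G"

definition undirected_tree :: "'a pair_pre_digraph \<Rightarrow> bool" where
  "undirected_tree G \<longleftrightarrow>
     pair_graph G \<and> Digraph_Component.connected (with_proj G) \<and> (\<nexists>p. undirected_cycle G p)"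

definition leaf :: "'a pair_pre_digraph \<Rightarrow> 'a \<Rightarrow> bool" where
  "leaf G v \<longleftrightarrow> v \<in> pverts G \<and> out_degree (with_proj G) v = 1"

definition caterpillar :: "'a pair_pre_digraph \<Rightarrow> bool" where
  "caterpillar G \<longleftrightarrow>
     undirected_tree G \<and>
     (\<exists>p. vpath p (with_proj G) \<and> (\<forall>v \<in> pverts G. \<not> leaf G v \<longrightarrow> v \<in> set p))"


section \<open>Unit acquisition\<close>

definition unit_move :: "'a pair_pre_digraph \<Rightarrow> ('a \<Rightarrow> nat) \<Rightarrow> ('a \<Rightarrow> nat) \<Rightarrow> bool" where
  "unit_move G f g \<longleftrightarrow>
     (\<exists>u v. (u, v) \<in> parcs G \<and> 0 < f u \<and> f u \<le> f v \<and> g = f(u := f u - 1, v := f v + 1))"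

definition unit_acquisition_number :: "'a pair_pre_digraph \<Rightarrow> nat" where
  "unit_acquisition_number G =
     (LEAST k. \<exists>f. (unit_move G)\<^sup>*\<^sup>* (\<lambda>_. 1) f \<and> k = card {v \<in> pverts G. 0 < f v})"


section \<open>Random access machines\<close>

text \<open>
  Algorithms are structured programs for a word RAM with addition and (truncated) subtraction as
  its only arithmetic. A state consists of the registers and of one memory of cells indexed by
  natural numbers. A program mentions only finitely many registers, so unbounded data has to be
  kept in the memory. Every elementary instruction and every evaluation of a test costs one unit
  of time.
\<close>

type_synonym state = "(nat \<Rightarrow> nat) \<times> (nat \<Rightarrow> nat)"

datatype instr =
    Const nat nat
  | Move nat nat
  | Add nat nat nat
  | Sub nat nat nat
  | Load nat nat
  | Store nat nat

text \<open>
  The first operand is the target register, except that \<open>Store a r\<close> writes the content of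
  register \<open>r\<close> to the cell addressed by register \<open>a\<close>.
\<close>

fun step :: "instr \<Rightarrow> state \<Rightarrow> state" where
  "step (Const r k) (R, M) = (R(r := k), M)"
| "step (Move r s) (R, M) = (R(r := R s), M)"
| "step (Add r s t) (R, M) = (R(r := R s + R t), M)"
| "step (Sub r s t) (R, M) = (R(r := R s - R t), M)"
| "step (Load r a) (R, M) = (R(r := M (R a)), M)"
| "step (Store a r) (R, M) = (R, M(R a := R r))"

datatype test =
    Less nat nat
  | Leq nat nat
  | Equal nat nat
  | Noteq nat nat

fun holds :: "test \<Rightarrow> state \<Rightarrow> bool" where
  "holds (Less r s) (R, M) \<longleftrightarrow> R r < R s"
| "holds (Leq r s) (R, M) \<longleftrightarrow> R r \<le> R s"
| "holds (Equal r s) (R, M) \<longleftrightarrow> R r = R s"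
| "holds (Noteq r s) (R, M) \<longleftrightarrow> R r \<noteq> R s"

datatype program =
    Instr instr
  | Seq program program
  | Cond test program program
  | Loop test program

text \<open>All registers and memory cells contain \<open>w\<close>-bit words.\<close>

definition fits :: "nat \<Rightarrow> state \<Rightarrow> bool" where
  "fits w s \<longleftrightarrow> (\<forall>r. fst s r < 2 ^ w) \<and> (\<forall>a. snd s a < 2 ^ w)"

text \<open>
  \<open>exec w P s t s'\<close>: with word length \<open>w\<close>, program \<open>P\<close> started in \<open>s\<close> halts in \<open>s'\<close> after exactly
  \<open>t\<close> units of time. Execution is deterministic. An instruction whose result does not fit into a
  word has no successor state, so a program that overflows has no execution at all.
\<close>

inductive exec :: "nat \<Rightarrow> program \<Rightarrow> state \<Rightarrow> nat \<Rightarrow> state \<Rightarrow> bool" for w :: nat where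
  Instr: "fits w (step i s) \<Longrightarrow> exec w (Instr i) s 1 (step i s)"
| Seq: "exec w P s t s' \<Longrightarrow> exec w Q s' t' s'' \<Longrightarrow> exec w (Seq P Q) s (t + t') s''"
| CondTrue: "holds b s \<Longrightarrow> exec w P s t s' \<Longrightarrow> exec w (Cond b P Q) s (1 + t) s'"
| CondFalse: "\<not> holds b s \<Longrightarrow> exec w Q s t s' \<Longrightarrow> exec w (Cond b P Q) s (1 + t) s'"
| LoopTrue: "holds b s \<Longrightarrow> exec w P s t s' \<Longrightarrow> exec w (Loop b P) s' t' s'' \<Longrightarrow>
    exec w (Loop b P) s (1 + t + t') s''"
| LoopFalse: "\<not> holds b s \<Longrightarrow> exec w (Loop b P) s 1 s"


section \<open>Graphs as inputs\<close>

text \<open>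
  A graph with vertices \<open>0, \<dots>, n - 1\<close> is given to a program as \<open>n\<close> together with a list of its
  edges, in arbitrary order, each edge occurring once and in an arbitrary orientation.
\<close>

definition represents :: "nat \<Rightarrow> (nat \<times> nat) list \<Rightarrow> nat pair_pre_digraph \<Rightarrow> bool" where
  "represents n es G \<longleftrightarrow>
     pverts G = {..<n} \<and> parcs G = set es \<union> (set es)\<inverse> \<and>
     distinct es \<and> (\<forall>(u, v) \<in> set es. (v, u) \<notin> set es)"

text \<open>
  Initially register \<open>0\<close> contains \<open>n\<close>, register \<open>1\<close> the number of edges, and the endpoints of the
  \<open>i\<close>-th edge are in the cells \<open>2 * i\<close> and \<open>2 * i + 1\<close>; everything else is \<open>0\<close>.
\<close>

definition input_state :: "nat \<Rightarrow> (nat \<times> nat) list \<Rightarrow> state" where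
  "input_state n es =
     ((\<lambda>_. 0)(0 := n, 1 := length es),
      (\<lambda>a. if a < 2 * length es
           then (if even a then fst (es ! (a div 2)) else snd (es ! (a div 2)))
           else 0))"

text \<open>The result is expected in register \<open>0\<close>.\<close>

definition outputs_within ::
  "nat \<Rightarrow> program \<Rightarrow> state \<Rightarrow> nat \<Rightarrow> nat \<Rightarrow> bool" where
  "outputs_within w P s T k \<longleftrightarrow>
     fits w s \<and> (\<exists>t s'. exec w P s t s' \<and> t \<le> T \<and> fst s' 0 = k)"

end

theory Submission
  imports Defs
begin

text \<open>
  Let the spine of a caterpillar be \<open>v 0, \<dots>, v (k - 1)\<close>, and let \<open>c i\<close> be the number of leaves at
  \<open>v i\<close>. A weight is best pictured as a stack of tokens. A move puts the top token of \<open>u\<close> on the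
  stack of a neighbour that is at least as high, so every move raises the height at which the token
  lies: a token that starts in a leaf of \<open>v j\<close> has height at least \<open>\<bar>i - j\<bar> + 2\<close> when it lies in \<open>v i\<close>.

  Suppose that tokens come in from both ends of an interval of \<open>N\<close> consecutive spine vertices, and that
  everything is to end up in one vertex. The tokens from outside enter too high to fill the places
  below the tent \<open>2, 3, \<dots>, 3, 2\<close> over the interval, yet they can climb across a vertex only on top of
  these places. The leaves inside have to fill them, so there are at least as many leaves as the tent
  has places above height \<open>1\<close>, and this number \<open>quota N\<close> is the integer part of \<open>(N + 1)\<^sup>2 / 4\<close>. An
  interval with fewer leaves is called bad. The converse holds as well: a segment of the spine without
  a bad interval in its interior can be gathered in one vertex. By Hall's theorem for intervals its
  leaves can be assigned to the places of the tent over the interior such that no leaf is too far away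
  (\<open>enough\<close>), and the assignment can be chosen such that it is realized by moves
  (\<open>exists_removable_stair\<close>, \<open>build_tent\<close>). Once the tent stands, every remaining token runs uphill
  to the top (\<open>gather\<close>, \<open>collect_piece\<close>).

  So the unit acquisition number is at most the least number of segments, without bad intervals in
  their interiors, into which the spine can be cut, and since subsegments inherit this property, the
  greedy partition from left to right is optimal among these (\<open>greedy\<close>). That moves cannot do better
  than segments follows from the chain of bad intervals that the greedy partition produces. Between
  consecutive intervals of the chain, and at both of its ends, sits a token that lies higher than its
  surroundings require. While such a token travels it cannot get past a bad interval, because the leaves
  there do not suffice to close all gaps of the tent; the gaps between any two consecutive tokens are
  thus never closed, the tokens stay on different vertices, and all these vertices survive
  (\<open>blocked_moves\<close>, \<open>blocked_survivors\<close>). Together these bounds give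
  \<open>unit_acquisition_number_eq_greedy\<close>.

  The program computes the degrees and the leaves of all vertices, walks along the spine and runs the
  greedy partition. For each spine vertex it examines all intervals that end there and begin in the
  current segment. This takes linear time in total, since quotas are quadratic: a segment on which
  \<open>l\<close> rounds are spent has order \<open>l\<^sup>2\<close> leaves, which pay for the order \<open>l\<^sup>2\<close> steps.
\<close>

section \<open>Profiles that the leaves can fill\<close>

text \<open>
  The place \<open>(i, h)\<close> is the one at height \<open>h\<close> in column \<open>i\<close>. A token from a leaf of column \<open>j\<close> can be put
  there only if \<open>\<bar>i - j\<bar> \<le> h - 2\<close>; these are the places below the profile \<open>F\<close> that no leaf outside
  \<open>{a..b}\<close> can fill. The columns are integers, so that neither end of the spine needs a special case.
\<close>
definition slots :: "(int \<Rightarrow> int) \<Rightarrow> int \<Rightarrow> int \<Rightarrow> (int \<times> int) set" where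
  "slots F a b = {(i, h). 2 \<le> h \<and> h \<le> F i \<and> a \<le> i - (h - 2) \<and> i + (h - 2) \<le> b}"

text \<open>
  Hall's condition for assigning the leaves to the places below \<open>F\<close>. It is enough to ask for it on
  intervals, since the leaves that can fill a given place form an interval.
\<close>
definition enough :: "(int \<Rightarrow> int) \<Rightarrow> (int \<Rightarrow> nat) \<Rightarrow> bool" where
  "enough F c \<longleftrightarrow> (\<forall>a b. card (slots F a b) \<le> sum c {a..b})"

definition gentle :: "(int \<Rightarrow> int) \<Rightarrow> bool" where
  "gentle F \<longleftrightarrow> (\<forall>i. \<bar>F (i + 1) - F i\<bar> \<le> 1)"

definition stair :: "(int \<Rightarrow> int) \<Rightarrow> int \<Rightarrow> int \<Rightarrow> bool" where
  "stair F i k \<longleftrightarrow> (\<forall>j. min i k \<le> j \<and> j \<le> max i k \<longrightarrow> F j = F i + \<bar>j - i\<bar>)"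

text \<open>
  A leaf of column \<open>i\<close> may be spent on the topmost place of column \<open>k\<close>. The last conjunct says that every
  tight interval that loses the leaf also loses the place, which is what keeps Hall's condition alive.
  The conditions on the neighbours of \<open>k\<close> keep the profile gentle.
\<close>
definition removable :: "(int \<Rightarrow> int) \<Rightarrow> (int \<Rightarrow> nat) \<Rightarrow> int \<Rightarrow> int \<Rightarrow> bool" where
  "removable F c i k \<longleftrightarrow>
     2 \<le> F k \<and> F (k - 1) \<le> F k \<and> F (k + 1) \<le> F k \<and>
     k - (F k - 2) \<le> i \<and> i \<le> k + (F k - 2) \<and> 0 < c i \<and>
     (\<forall>a b. a \<le> i \<and> i \<le> b \<and> card (slots F a b) = sum c {a..b} \<longrightarrow>
        a \<le> k - (F k - 2) \<and> k + (F k - 2) \<le> b)"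

lemma finite_slots [simp]: "finite (slots F a b)"
proof (rule finite_subset)
  show "slots F a b \<subseteq> {a..b} \<times> {2..b - a + 2}"
    by (auto simp: slots_def)
qed auto

lemma gentleD: "gentle F \<Longrightarrow> \<bar>F j - F i\<bar> \<le> \<bar>j - i\<bar>"
proof -
  assume g: "gentle F"
  have *: "\<bar>F (i + int n) - F i\<bar> \<le> int n" for i n
  proof (induction n)
    case (Suc n)
    have "\<bar>F (i + int n + 1) - F (i + int n)\<bar> \<le> 1" using g by (auto simp: gentle_def)
    then show ?case using Suc by (simp add: algebra_simps)
  qed auto
  show ?thesis
  proof (cases "i \<le> j")
    case True then show ?thesis using *[of i "nat (j - i)"] by simp
  next
    case False then show ?thesis using *[of j "nat (i - j)"] by simp
  qed
qed

text \<open>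
  If every leaf within reach of \<open>(k, F k)\<close> lay in a tight interval that misses this place, then these
  intervals could be glued together from left to right: as the number of places is supermodular, the
  union of two overlapping tight intervals is tight again. In the end the glued interval would contain
  all leaves within reach, and all of its leaves would be used up by places other than \<open>(k, F k)\<close>,
  against Hall's condition.
\<close>
lemma exists_source:
  assumes H: "enough F c" and k: "2 \<le> F k"
  defines "L \<equiv> k - (F k - 2)" and "R \<equiv> k + (F k - 2)"
  shows "\<exists>i. L \<le> i \<and> i \<le> R \<and> 0 < c i \<and>
     (\<forall>a b. a \<le> i \<and> i \<le> b \<and> card (slots F a b) = sum c {a..b} \<longrightarrow> a \<le> L \<and> R \<le> b)"
proof (rule ccontr)
  assume neg: "\<not> ?thesis"
  define \<sigma> where "\<sigma> = (k, F k)"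
  have \<sigma>_in: "\<sigma> \<in> slots F a b \<longleftrightarrow> a \<le> L \<and> R \<le> b" for a b
    using k by (auto simp: slots_def \<sigma>_def L_def R_def)
  \<comment> \<open>\<open>{l..y}\<close> is what has been glued so far; it covers the range at least up to \<open>L - 1 + n\<close>.\<close>
  have reach: "\<exists>l y. l \<le> L \<and> L - 1 + int n \<le> y \<and> sum c {l..y} \<le> card (slots F l y - {\<sigma>})"
    if "L - 1 + int n \<le> R" for n
    using that
  proof (induction n)
    case 0
    show ?case by (rule exI[of _ L], rule exI[of _ "L - 1"]) simp
  next
    case (Suc n)
    then obtain l y where ly: "l \<le> L" "L - 1 + int n \<le> y"
      "sum c {l..y} \<le> card (slots F l y - {\<sigma>})" by auto
    show ?case
    proof (cases "L - 1 + int n < y")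
      case True
      then show ?thesis using ly by (intro exI[of _ l] exI[of _ y]) auto
    next
      case False
      then have y: "y = L - 1 + int n" using ly by simp
      show ?thesis
      proof (cases "c (y + 1) = 0")
        case True
        have "{l..y + 1} = insert (y + 1) {l..y}" using ly y by auto
        then have "sum c {l..y + 1} = sum c {l..y}" using True by simp
        also have "\<dots> \<le> card (slots F l y - {\<sigma>})" by fact
        also have "\<dots> \<le> card (slots F l (y + 1) - {\<sigma>})"
          by (intro card_mono finite_Diff finite_slots) (auto simp: slots_def)
        finally show ?thesis using ly y by (intro exI[of _ l] exI[of _ "y + 1"]) auto
      next
        case False
        have "L \<le> y + 1" "y + 1 \<le> R" using y Suc.prems by auto
        then obtain a b where ab: "a \<le> y + 1" "y + 1 \<le> b" "card (slots F a b) = sum c {a..b}"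
          "\<not> (a \<le> L \<and> R \<le> b)" using neg False by blast
        have nin: "\<sigma> \<notin> slots F a b" using ab \<sigma>_in by blast
        have un: "{l..y} \<union> {a..b} = {min l a..b}" and int: "{l..y} \<inter> {a..b} = {max l a..y}"
          using ab ly y by auto
        have "sum c {min l a..b} + sum c {max l a..y} = sum c {l..y} + sum c {a..b}"
          using sum.union_inter[of "{l..y}" "{a..b}" c] unfolding un int by simp
        also have "\<dots> \<le> card (slots F l y - {\<sigma>}) + card (slots F a b)" using ly ab by simp
        also have "\<dots> = card ((slots F l y - {\<sigma>}) \<union> slots F a b)
            + card ((slots F l y - {\<sigma>}) \<inter> slots F a b)"
          by (rule card_Un_Int) auto
        also have "\<dots> \<le> card (slots F (min l a) b - {\<sigma>}) + card (slots F (max l a) y)"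
        proof (intro add_mono card_mono finite_Diff finite_slots)
          have "slots F l y \<subseteq> slots F (min l a) b" "slots F a b \<subseteq> slots F (min l a) b"
            using ab y unfolding slots_def by fastforce+
          then show "slots F l y - {\<sigma>} \<union> slots F a b \<subseteq> slots F (min l a) b - {\<sigma>}" using nin by blast
          show "(slots F l y - {\<sigma>}) \<inter> slots F a b \<subseteq> slots F (max l a) y"
            unfolding slots_def by auto
        qed
        also have "\<dots> \<le> card (slots F (min l a) b - {\<sigma>}) + sum c {max l a..y}"
          using H by (auto simp: enough_def)
        finally have "sum c {min l a..b} \<le> card (slots F (min l a) b - {\<sigma>})" by simp
        then show ?thesis using ly ab y by (intro exI[of _ "min l a"] exI[of _ b]) auto
      qed
    qed
  qed
  have "L - 1 + int (nat (R - L + 1)) = R" using k by (simp add: L_def R_def)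
  then obtain l y where ly: "l \<le> L" "R \<le> y" "sum c {l..y} \<le> card (slots F l y - {\<sigma>})"
    using reach[of "nat (R - L + 1)"] by auto
  have "\<sigma> \<in> slots F l y" using ly \<sigma>_in by simp
  then have "card (slots F l y - {\<sigma>}) < card (slots F l y)" by (intro psubset_card_mono) auto
  also have "\<dots> \<le> sum c {l..y}" using H by (auto simp: enough_def)
  finally show False using ly by simp
qed

lemma climb_right:
  assumes g: "gentle F" and k: "i \<le> k" "F (k + 1) \<le> F k"
  shows "\<exists>k'. i \<le> k' \<and> k' \<le> k \<and> stair F i k' \<and> F (k' + 1) \<le> F k' \<and> (k' = i \<or> F (k' - 1) \<le> F k')"
proof -
  define P where "P n \<longleftrightarrow> F (i + int n + 1) \<le> F (i + int n)" for n
  have "P (nat (k - i))" using k by (simp add: P_def)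
  then have 1: "P (LEAST n. P n)" "(LEAST n. P n) \<le> nat (k - i)" by (auto intro: LeastI Least_le)
  define n where "n = (LEAST n. P n)"
  have up: "F (i + int m + 1) = F (i + int m) + 1" if "m < n" for m
  proof -
    have "\<not> P m" using that not_less_Least n_def by auto
    moreover have "\<bar>F (i + int m + 1) - F (i + int m)\<bar> \<le> 1" using g by (auto simp: gentle_def)
    ultimately show ?thesis by (auto simp: P_def)
  qed
  have st: "F (i + int m) = F i + int m" if "m \<le> n" for m
    using that
  proof (induction m)
    case (Suc m) then show ?case using up[of m] by (simp add: algebra_simps)
  qed simp
  have "stair F i (i + int n)"
  proof (unfold stair_def, intro allI impI)
    fix j assume "min i (i + int n) \<le> j \<and> j \<le> max i (i + int n)"
    then show "F j = F i + \<bar>j - i\<bar>" using st[of "nat (j - i)"] by auto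
  qed
  moreover have "n = 0 \<or> F (i + int n - 1) \<le> F (i + int n)"
    using st[of n] st[of "n - 1"] by (cases n) (auto simp: algebra_simps)
  moreover have "F (i + int n + 1) \<le> F (i + int n)" "i + int n \<le> k"
    using 1 k unfolding n_def[symmetric] by (auto simp: P_def nat_le_iff)
  ultimately show ?thesis by (intro exI[of _ "i + int n"]) auto
qed

lemma stairD: "stair F i k \<Longrightarrow> min i k \<le> j \<Longrightarrow> j \<le> max i k \<Longrightarrow> F j = F i + \<bar>j - i\<bar>"
  unfolding stair_def by blast

lemma stair_mirror: "stair F i k \<longleftrightarrow> stair (\<lambda>j. F (- j)) (- i) (- k)"
proof
  assume *: "stair F i k"
  show "stair (\<lambda>j. F (- j)) (- i) (- k)"
    unfolding stair_def
  proof (intro allI impI)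
    fix j assume "min (- i) (- k) \<le> j \<and> j \<le> max (- i) (- k)"
    then have "min i k \<le> - j" "- j \<le> max i k" by auto
    from stairD[OF * this] show "F (- j) = F (- (- i)) + \<bar>j - - i\<bar>" by simp
  qed
next
  assume *: "stair (\<lambda>j. F (- j)) (- i) (- k)"
  show "stair F i k"
    unfolding stair_def
  proof (intro allI impI)
    fix j assume "min i k \<le> j \<and> j \<le> max i k"
    then have "min (- i) (- k) \<le> - j" "- j \<le> max (- i) (- k)" by auto
    from stairD[OF * this] show "F j = F i + \<bar>j - i\<bar>" by simp
  qed
qed

lemma gentle_mirror: "gentle F \<Longrightarrow> gentle (\<lambda>j. F (- j))"
proof -
  assume g: "gentle F"
  show ?thesis unfolding gentle_def
  proof
    fix i
    have "\<bar>F (- i) - F (- (i + 1))\<bar> \<le> 1" using g[unfolded gentle_def, rule_format, of "- (i + 1)"] by simp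
    then show "\<bar>F (- (i + 1)) - F (- i)\<bar> \<le> 1" by linarith
  qed
qed

lemma climb_left:
  assumes g: "gentle F" and k: "k \<le> i" "F (k - 1) \<le> F k"
  shows "\<exists>k'. k' \<le> i \<and> k \<le> k' \<and> stair F i k' \<and> F (k' - 1) \<le> F k' \<and> (k' = i \<or> F (k' + 1) \<le> F k')"
proof -
  obtain k' where k': "- i \<le> k'" "k' \<le> - k" "stair (\<lambda>j. F (- j)) (- i) k'" "F (- (k' + 1)) \<le> F (- k')"
    "k' = - i \<or> F (- (k' - 1)) \<le> F (- k')"
    using climb_right[OF gentle_mirror[OF g], of "- i" "- k"] k by auto
  have "stair F i (- k')" using k'(3) stair_mirror[of F i "- k'"] by simp
  moreover have "F (- k' - 1) \<le> F (- k')" using k'(4) by (simp only: minus_add_distrib diff_conv_add_uminus)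
  moreover have "- k' = i \<or> F (- k' + 1) \<le> F (- k')"
    using k'(5) by (simp only: minus_diff_eq) (auto simp: algebra_simps)
  moreover have "- k' \<le> i" "k \<le> - k'" using k'(1,2) by simp_all
  ultimately show ?thesis by blast
qed

text \<open>
  A leaf can be brought to a place by moves only along a stair, whereas Hall's condition may point to
  a leaf \<open>i\<close> from which the way to \<open>k\<close> is not a stair. Then some other local maximum \<open>k'\<close> is at the top of
  a stair from \<open>i\<close>. If the leaf cannot be spent on \<open>k'\<close> either, a tight interval around \<open>i\<close> misses part
  of the range of \<open>k'\<close>. As it contains the range of \<open>k\<close>, and as \<open>F\<close> is gentle, it misses the left part,
  so the leaves that may be spent on \<open>k'\<close> lie further left than \<open>i\<close>, and the search goes on from there.
\<close>
lemma removable_stair_left: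
  assumes H: "enough F c" and g: "gentle F" and low: "\<And>j. j < m \<Longrightarrow> F j \<le> 1"
  shows "removable F c i k \<Longrightarrow> i \<le> k \<Longrightarrow> \<exists>i k. removable F c i k \<and> stair F i k"
proof (induction "nat (i - m)" arbitrary: i k rule: less_induct)
  case less
  note r = less.prems(1)[unfolded removable_def]
  have Fi: "2 \<le> F i" using gentleD[OF g, of k i] r less.prems(2) by auto
  then have im: "m \<le> i" using low[of i] by linarith
  obtain k' where k': "stair F i k'" "k' \<le> k" "F (k' - 1) \<le> F k'" "F (k' + 1) \<le> F k'"
  proof -
    obtain k1 where k1: "i \<le> k1" "k1 \<le> k" "stair F i k1" "F (k1 + 1) \<le> F k1"
      "k1 = i \<or> F (k1 - 1) \<le> F k1"
      using climb_right[OF g less.prems(2)] r by blast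
    show ?thesis
    proof (cases "k1 = i")
      case False then show ?thesis using k1 that by blast
    next
      case True
      have "\<exists>k0\<le>i. F (k0 - 1) \<le> F k0"
      proof (rule ccontr)
        assume "\<not> ?thesis"
        then have gr: "F k0 < F (k0 - 1)" if "k0 \<le> i" for k0 using that not_le by blast
        have "2 \<le> F (i - int n)" for n
        proof (induction n)
          case (Suc n)
          then show ?case using gr[of "i - int n"] by (simp add: algebra_simps)
        qed (use Fi in simp)
        from this[of "nat (i - m + 1)"] low[of "m - 1"] im show False by simp
      qed
      then obtain k0 where "k0 \<le> i" "F (k0 - 1) \<le> F k0" by blast
      from climb_left[OF g this] obtain k2 where k2: "k2 \<le> i" "stair F i k2" "F (k2 - 1) \<le> F k2"
        "k2 = i \<or> F (k2 + 1) \<le> F k2" by blast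
      have "F (k2 + 1) \<le> F k2" using k2(4) k1(4) True by blast
      moreover have "k2 \<le> k" using k2(1) less.prems(2) by simp
      ultimately show ?thesis using k2 that by blast
    qed
  qed
  have sF: "F k' = F i + \<bar>k' - i\<bar>" using stairD[OF k'(1), of k'] by simp
  then have Fk': "2 \<le> F k'" using Fi by simp
  show ?case
  proof (cases "removable F c i k'")
    case True then show ?thesis using k' by blast
  next
    case False
    have "k' - (F k' - 2) \<le> i" "i \<le> k' + (F k' - 2)" using sF Fi by auto
    then obtain a b where ab: "a \<le> i" "i \<le> b" "card (slots F a b) = sum c {a..b}"
      "\<not> (a \<le> k' - (F k' - 2) \<and> k' + (F k' - 2) \<le> b)"
      using False k' Fk' r unfolding removable_def by blast
    have abk: "a \<le> k - (F k - 2)" "k + (F k - 2) \<le> b" using r ab by blast+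
    have right: "k' + (F k' - 2) \<le> k + (F k - 2)" using gentleD[OF g, of k' k] k' by auto
    obtain i' where i': "k' - (F k' - 2) \<le> i'" "i' \<le> k' + (F k' - 2)" "0 < c i'"
      "\<forall>a b. a \<le> i' \<and> i' \<le> b \<and> card (slots F a b) = sum c {a..b} \<longrightarrow>
        a \<le> k' - (F k' - 2) \<and> k' + (F k' - 2) \<le> b"
      using exists_source[OF H Fk'] by blast
    have r': "removable F c i' k'" using i' k' Fk' unfolding removable_def by blast
    have "\<not> (a \<le> i' \<and> i' \<le> b)" using i' ab by blast
    then have "i' < a" using right abk i' by linarith
    then have lt: "i' < i" using ab by simp
    show ?thesis
    proof (cases "i' \<le> k'")
      case True
      have "2 \<le> F i'" using gentleD[OF g, of k' i'] i' True by auto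
      then have "m \<le> i'" using low[of i'] by linarith
      then have "nat (i' - m) < nat (i - m)" using lt im by linarith
      then show ?thesis using less.hyps r' True by blast
    next
      case False
      have Fi': "F i' = F i + (i - i')" using stairD[OF k'(1), of i'] False lt by simp
      have "stair F i' k'" unfolding stair_def
      proof (intro allI impI)
        fix j assume "min i' k' \<le> j \<and> j \<le> max i' k'"
        then show "F j = F i' + \<bar>j - i'\<bar>" using stairD[OF k'(1), of j] False lt Fi' by simp
      qed
      then show ?thesis using r' by blast
    qed
  qed
qed

text \<open>
  The search starts at the rightmost local maximum \<open>k\<close>, plateaus included: to the right of it \<open>F\<close> is
  strictly decreasing, so a leaf on that side is joined to \<open>k\<close> by a stair anyway.
\<close>
lemma exists_removable_stair:
  assumes H: "enough F c" and g: "gentle F" and low: "\<And>j. j < m \<Longrightarrow> F j \<le> 1"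
    and high: "\<And>j. M < j \<Longrightarrow> F j \<le> 1" and ex: "2 \<le> F x"
  shows "\<exists>i k. removable F c i k \<and> stair F i k"
proof -
  define K where "K = {j. 2 \<le> F j \<and> F (j - 1) \<le> F j}"
  have "K \<subseteq> {m..M}" unfolding K_def using low high by (force simp: not_less[symmetric])
  then have fin: "finite K" by (rule finite_subset) simp
  have "K \<noteq> {}"
  proof
    assume K: "K = {}"
    have "2 \<le> F (x - int n)" for n
    proof (induction n)
      case (Suc n)
      have "x - int n \<notin> K" using K by simp
      then show ?case using Suc by (auto simp: K_def algebra_simps)
    qed (use ex in simp)
    from this[of "nat (x - m + 1)"] low[of "m - 1"] low[of x] ex show False by (cases "x < m") auto
  qed
  define k where "k = Max K"
  have kK: "2 \<le> F k" "F (k - 1) \<le> F k" using Max_in[OF fin \<open>K \<noteq> {}\<close>] by (auto simp: k_def K_def)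
  have out: "F j < F (j - 1)" if "k < j" "2 \<le> F j" for j
  proof (rule ccontr)
    assume "\<not> ?thesis"
    then have "j \<in> K" using that by (simp add: K_def)
    then have "j \<le> k" using Max_ge[OF fin] by (simp add: k_def)
    then show False using that by simp
  qed
  have k1: "F (k + 1) \<le> F k" using out[of "k + 1"] kK by (cases "F (k + 1) \<le> F k") auto
  obtain i where i: "k - (F k - 2) \<le> i" "i \<le> k + (F k - 2)" "0 < c i"
      "\<forall>a b. a \<le> i \<and> i \<le> b \<and> card (slots F a b) = sum c {a..b} \<longrightarrow>
        a \<le> k - (F k - 2) \<and> k + (F k - 2) \<le> b"
    using exists_source[OF H kK(1)] by blast
  have r: "removable F c i k" using i kK k1 unfolding removable_def by blast
  show ?thesis
  proof (cases "i \<le> k")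
    case True then show ?thesis using removable_stair_left[OF H g low r] by blast
  next
    case False
    have Fi: "2 \<le> F i" using gentleD[OF g, of k i] i False by auto
    have st: "int n \<le> i - k \<Longrightarrow> F (i - int n) = F i + int n" for n
    proof (induction n)
      case (Suc n)
      then have "F (i - int n) < F (i - int n - 1)" using out[of "i - int n"] Fi by simp
      moreover have "\<bar>F (i - int n) - F (i - int n - 1)\<bar> \<le> 1"
        using gentleD[OF g, of "i - int n - 1" "i - int n"] by simp
      ultimately have "F (i - int n - 1) = F (i - int n) + 1" by linarith
      then show ?case using Suc by (simp add: algebra_simps)
    qed simp
    have "stair F i k" unfolding stair_def
    proof (intro allI impI)
      fix j assume "min i k \<le> j \<and> j \<le> max i k"
      then show "F j = F i + \<bar>j - i\<bar>" using st[of "nat (i - j)"] False by auto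
    qed
    then show ?thesis using r by blast
  qed
qed

lemma enough_remove:
  assumes H: "enough F c" and r: "removable F c i k"
  shows "enough (F(k := F k - 1)) (c(i := c i - 1))"
proof (unfold enough_def, intro allI)
  fix a b
  let ?F = "F(k := F k - 1)" and ?c = "c(i := c i - 1)"
  have sub: "slots ?F a b = slots F a b - {(k, F k)}" by (auto simp: slots_def split: if_splits)
  have k2: "2 \<le> F k" and ci: "0 < c i" using r by (auto simp: removable_def)
  have hall: "card (slots F a b) \<le> sum c {a..b}" using H by (auto simp: enough_def)
  show "card (slots ?F a b) \<le> sum ?c {a..b}"
  proof (cases "a \<le> i \<and> i \<le> b")
    case False
    then have "sum ?c {a..b} = sum c {a..b}" by (intro sum.cong) auto
    moreover have "card (slots ?F a b) \<le> card (slots F a b)" unfolding sub by (intro card_mono) auto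
    ultimately show ?thesis using hall by simp
  next
    case True
    have "sum c {a..b} = c i + sum c ({a..b} - {i})" using True by (intro sum.remove) auto
    moreover have "sum ?c {a..b} = ?c i + sum ?c ({a..b} - {i})" using True by (intro sum.remove) auto
    moreover have "sum ?c ({a..b} - {i}) = sum c ({a..b} - {i})" by (intro sum.cong) auto
    ultimately have s: "sum c {a..b} = Suc (sum ?c {a..b})" using ci by simp
    show ?thesis
    proof (cases "card (slots F a b) = sum c {a..b}")
      case False
      have "card (slots ?F a b) \<le> card (slots F a b)" unfolding sub by (intro card_mono) auto
      then show ?thesis using False hall s by simp
    next
      case tight: True
      have "(k, F k) \<in> slots F a b"
        using r True tight k2 unfolding removable_def slots_def by auto
      then show ?thesis unfolding sub using tight s by simp
    qed
  qed
qed

lemma gentle_remove: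
  assumes g: "gentle F" and k: "F (k - 1) \<le> F k" "F (k + 1) \<le> F k"
  shows "gentle (F(k := F k - 1))"
  unfolding gentle_def
proof
  fix i
  have "\<bar>F (i + 1) - F i\<bar> \<le> 1" using g by (auto simp: gentle_def)
  then show "\<bar>(F(k := F k - 1)) (i + 1) - (F(k := F k - 1)) i\<bar> \<le> 1"
    using k by auto
qed


section \<open>Tents and their quotas\<close>

text \<open>
  The integer part of \<open>(N + 1)\<^sup>2 / 4\<close>, in a form that can be evaluated with additions only: the
  increments are \<open>1, 1, 2, 2, 3, 3, \<dots>\<close>.
\<close>
fun quota :: "nat \<Rightarrow> nat" where
  "quota 0 = 0"
| "quota (Suc n) = quota n + (n + 2) div 2"

text \<open>
  Two further columns raise the tent by one layer over the old columns and over the two new ones; hence the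
  induction in steps of two.
\<close>
lemma tent_sum: "(\<Sum>j<n. min (Suc j) (n - j)) = quota n"
proof (induction n rule: induct_nat_012)
  case (ge2 n)
  have "(\<Sum>j<Suc (Suc n). min (Suc j) (Suc (Suc n) - j)) =
      2 + (\<Sum>j<n. min (Suc (Suc j)) (Suc n - j))"
    by (subst sum.lessThan_Suc_shift, subst sum.lessThan_Suc) simp
  also have "(\<Sum>j<n. min (Suc (Suc j)) (Suc n - j)) = (\<Sum>j<n. 1 + min (Suc j) (n - j))"
    by (intro sum.cong) auto
  also have "\<dots> = quota n + n" using ge2(1) by (simp only: sum.distrib) simp
  finally show ?case by simp
qed auto

text \<open>
  The leaves at \<open>v p, \<dots>, v s\<close> are too few to fill the tent over this interval.
\<close>
definition bad :: "(nat \<Rightarrow> nat) \<Rightarrow> nat \<Rightarrow> nat \<Rightarrow> bool" where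
  "bad c p s \<longleftrightarrow> p \<le> s \<and> sum c {p..s} < quota (Suc s - p)"

text \<open>
  Column \<open>a + j\<close> contributes at most \<open>min (j + 1) (n - j)\<close> places, where \<open>n\<close> is the length of the interval,
  because the range of any higher place sticks out.
\<close>
lemma card_slots_le: "card (slots F a b) \<le> quota (nat (b - a + 1))"
proof -
  let ?n = "nat (b - a + 1)"
  have "slots F a b \<subseteq> (\<Union>j\<in>{..<?n}. (\<lambda>l. (a + int j, 2 + int l)) ` {..<min (Suc j) (?n - j)})"
  proof (rule subsetI, clarify)
    fix i h assume "(i, h) \<in> slots F a b"
    then have *: "2 \<le> h" "a \<le> i - (h - 2)" "i + (h - 2) \<le> b" by (auto simp: slots_def)
    have "(i, h) = (a + int (nat (i - a)), 2 + int (nat (h - 2)))" using * by simp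
    moreover have "nat (i - a) < ?n" "nat (h - 2) < min (Suc (nat (i - a))) (?n - nat (i - a))"
      using * by auto
    ultimately show "(i, h) \<in> (\<Union>j\<in>{..<?n}. (\<lambda>l. (a + int j, 2 + int l)) ` {..<min (Suc j) (?n - j)})"
      by blast
  qed
  then have "card (slots F a b) \<le> card (\<Union>j\<in>{..<?n}. (\<lambda>l. (a + int j, 2 + int l)) ` {..<min (Suc j) (?n - j)})"
    by (intro card_mono) auto
  also have "\<dots> \<le> (\<Sum>j<?n. card ((\<lambda>l. (a + int j, 2 + int l)) ` {..<min (Suc j) (?n - j)}))"
    by (rule card_UN_le) simp
  also have "\<dots> \<le> (\<Sum>j<?n. min (Suc j) (?n - j))"
    by (intro sum_mono) (metis card_image_le finite_lessThan card_lessThan)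
  finally show ?thesis by (simp add: tent_sum)
qed

section \<open>Moves along paths\<close>

abbreviation moves :: "'a pair_pre_digraph \<Rightarrow> ('a \<Rightarrow> nat) \<Rightarrow> ('a \<Rightarrow> nat) \<Rightarrow> bool" where
  "moves G \<equiv> (unit_move G)\<^sup>*\<^sup>*"

lemma movesI: "(u, w) \<in> parcs G \<Longrightarrow> 0 < f u \<Longrightarrow> f u \<le> f w \<Longrightarrow>
    moves G f (f(u := f u - 1, w := f w + 1))"
  by (rule r_into_rtranclp) (auto simp: unit_move_def)

text \<open>
  How a leaf \<open>y\<close> at the foot of a stair is spent on the top \<open>\<pi> d\<close>, which is one short of the stair. The
  token of \<open>y\<close> could not be carried all the way, because it would arrive higher than \<open>\<pi> d\<close>. Instead every
  vertex hands one of its tokens to the next one, the highest pair first, and \<open>y\<close> refills the foot. The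
  condition \<open>2 \<le> m\<close> keeps the foot alive in the meantime.
\<close>
lemma relay:
  assumes "\<And>j. j < d \<Longrightarrow> (\<pi> j, \<pi> (Suc j)) \<in> parcs G" "inj_on \<pi> {..d}" "y \<notin> \<pi> ` {..d}"
    "(y, \<pi> 0) \<in> parcs G" "g y = 1" "\<And>j. j < d \<Longrightarrow> g (\<pi> j) = m + j" "g (\<pi> d) + 1 = m + d" "2 \<le> m"
  shows "moves G g (g(y := 0, \<pi> d := m + d))"
  using assms
proof (induction d arbitrary: g)
  case 0
  have eq: "g(y := g y - 1, \<pi> 0 := g (\<pi> 0) + 1) = g(y := 0, \<pi> 0 := m + 0)" using 0 by simp
  have "moves G g (g(y := g y - 1, \<pi> 0 := g (\<pi> 0) + 1))" using 0 by (intro movesI) auto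
  then show ?case unfolding eq .
next
  case (Suc d)
  have ne: "\<pi> d \<noteq> \<pi> (Suc d)" using Suc.prems(2) by (auto dest!: inj_onD)
  let ?g = "g(\<pi> d := g (\<pi> d) - 1, \<pi> (Suc d) := g (\<pi> (Suc d)) + 1)"
  have eq: "g (\<pi> d) = m + d" "g (\<pi> (Suc d)) = m + d" using Suc.prems(6)[of d] Suc.prems(7) by auto
  have m1: "moves G g ?g" using Suc.prems(1)[of d] Suc.prems(8) eq by (intro movesI) auto
  have m2: "moves G ?g (?g(y := 0, \<pi> d := m + d))"
  proof (rule Suc.IH)
    show "inj_on \<pi> {..d}" using Suc.prems(2) by (rule inj_on_subset) auto
    show "y \<notin> \<pi> ` {..d}" using Suc.prems(3) by auto
    show "?g y = 1" using Suc.prems(3,5) by auto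
    show "?g (\<pi> j) = m + j" if "j < d" for j
    proof -
      have "\<pi> j \<noteq> \<pi> d" "\<pi> j \<noteq> \<pi> (Suc d)" using Suc.prems(2) that by (auto dest!: inj_onD)
      then show ?thesis using Suc.prems(6) that by simp
    qed
    show "?g (\<pi> d) + 1 = m + d" using eq ne Suc.prems(8) by simp
  qed (use Suc.prems in auto)
  have eq2: "?g(y := 0, \<pi> d := m + d) = g(y := 0, \<pi> (Suc d) := m + Suc d)"
    using eq Suc.prems(3) ne by (auto simp: fun_eq_iff)
  show ?case using rtranclp_trans[OF m1 m2] unfolding eq2 .
qed

text \<open>
  Uphill, in contrast, a single token can be carried: after each step it makes its vertex at most as heavy
  as the next one. Only the first step may go between equal weights.
\<close>
lemma carry:
  assumes "\<And>j. j < Suc d \<Longrightarrow> (\<pi> j, \<pi> (Suc j)) \<in> parcs G" "inj_on \<pi> {..Suc d}"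
    "0 < g (\<pi> 0)" "g (\<pi> 0) \<le> g (\<pi> 1)" "\<And>j. 0 < j \<Longrightarrow> j < Suc d \<Longrightarrow> g (\<pi> j) < g (\<pi> (Suc j))"
  shows "moves G g (g(\<pi> 0 := g (\<pi> 0) - 1, \<pi> (Suc d) := g (\<pi> (Suc d)) + 1))"
  using assms
proof (induction d arbitrary: g \<pi>)
  case 0
  have "moves G g (g(\<pi> 0 := g (\<pi> 0) - 1, \<pi> 1 := g (\<pi> 1) + 1))" using 0 by (intro movesI) auto
  then show ?case unfolding One_nat_def .
next
  case (Suc d)
  let ?g = "g(\<pi> 0 := g (\<pi> 0) - 1, \<pi> 1 := g (\<pi> 1) + 1)"
  have ne: "\<pi> i \<noteq> \<pi> j" if "i \<noteq> j" "i \<le> Suc (Suc d)" "j \<le> Suc (Suc d)" for i j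
    using Suc.prems(2) that by (auto dest!: inj_onD)
  have m1: "moves G g ?g" using Suc.prems(1)[of 0] Suc.prems(3,4) by (intro movesI) auto
  have m2: "moves G ?g (?g((\<pi> \<circ> Suc) 0 := ?g ((\<pi> \<circ> Suc) 0) - 1, (\<pi> \<circ> Suc) (Suc d) := ?g ((\<pi> \<circ> Suc) (Suc d)) + 1))"
  proof (rule Suc.IH)
    show "inj_on (\<pi> \<circ> Suc) {..Suc d}"
      by (rule comp_inj_on) (auto intro: inj_on_subset[OF Suc.prems(2)])
    show "?g ((\<pi> \<circ> Suc) 0) \<le> ?g ((\<pi> \<circ> Suc) 1)"
      using Suc.prems(5)[of 1] ne[of 2 0] ne[of 2 1] by (simp add: numeral_2_eq_2)
    show "?g ((\<pi> \<circ> Suc) j) < ?g ((\<pi> \<circ> Suc) (Suc j))" if "0 < j" "j < Suc d" for j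
      using Suc.prems(5)[of "Suc j"] that ne[of "Suc j" 0] ne[of "Suc j" 1] ne[of "Suc (Suc j)" 0]
        ne[of "Suc (Suc j)" 1] by simp
  qed (use Suc.prems in auto)
  have eq2: "?g((\<pi> \<circ> Suc) 0 := ?g ((\<pi> \<circ> Suc) 0) - 1, (\<pi> \<circ> Suc) (Suc d) := ?g ((\<pi> \<circ> Suc) (Suc d)) + 1)
     = g(\<pi> 0 := g (\<pi> 0) - 1, \<pi> (Suc (Suc d)) := g (\<pi> (Suc (Suc d))) + 1)"
    using ne[of 0 "Suc (Suc d)"] ne[of 1 "Suc (Suc d)"] ne[of 0 1] by (auto simp: fun_eq_iff)
  show ?case using rtranclp_trans[OF m1 m2] unfolding eq2 .
qed

lemma carry_all:
  assumes "\<And>j. j < Suc d \<Longrightarrow> (\<pi> j, \<pi> (Suc j)) \<in> parcs G" "inj_on \<pi> {..Suc d}"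
    "g (\<pi> 0) \<le> g (\<pi> 1)" "\<And>j. 0 < j \<Longrightarrow> j < Suc d \<Longrightarrow> g (\<pi> j) < g (\<pi> (Suc j))"
  shows "moves G g (g(\<pi> 0 := 0, \<pi> (Suc d) := g (\<pi> (Suc d)) + g (\<pi> 0)))"
  using assms
proof (induction "g (\<pi> 0)" arbitrary: g)
  case 0
  then have "g(\<pi> 0 := 0, \<pi> (Suc d) := g (\<pi> (Suc d)) + g (\<pi> 0)) = g" by (auto simp: fun_eq_iff)
  then show ?case by (metis rtranclp.rtrancl_refl)
next
  case (Suc m)
  have ne: "\<pi> i \<noteq> \<pi> j" if "i \<noteq> j" "i \<le> Suc d" "j \<le> Suc d" for i j
    using Suc.prems(2) that by (auto dest!: inj_onD)
  let ?g = "g(\<pi> 0 := g (\<pi> 0) - 1, \<pi> (Suc d) := g (\<pi> (Suc d)) + 1)"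
  have n0: "\<pi> 0 \<noteq> \<pi> (Suc d)" using ne[of 0 "Suc d"] by simp
  have m1: "moves G g ?g" using Suc by (intro carry) auto
  have m2: "moves G ?g (?g(\<pi> 0 := 0, \<pi> (Suc d) := ?g (\<pi> (Suc d)) + ?g (\<pi> 0)))"
  proof (rule Suc.hyps)
    show "m = ?g (\<pi> 0)" using Suc.hyps(2) n0 by simp
    show "?g (\<pi> 0) \<le> ?g (\<pi> 1)" using Suc.prems(3) n0 ne[of 0 1] by auto
    show "?g (\<pi> j) < ?g (\<pi> (Suc j))" if "0 < j" "j < Suc d" for j
      using Suc.prems(4)[of j] that ne[of 0 j] ne[of j "Suc d"] ne[of 0 "Suc j"] by auto
  qed (use Suc.prems in auto)
  have eq2: "?g(\<pi> 0 := 0, \<pi> (Suc d) := ?g (\<pi> (Suc d)) + ?g (\<pi> 0)) = g(\<pi> 0 := 0, \<pi> (Suc d) := g (\<pi> (Suc d)) + g (\<pi> 0))"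
    using Suc.hyps(2) n0 by (auto simp: fun_eq_iff)
  show ?case using rtranclp_trans[OF m1 m2] unfolding eq2 .
qed

text \<open>
  The path is emptied from its lower end, so that what remains keeps its strictly increasing weights.
\<close>
lemma collapse_path:
  assumes "\<And>j. j < d \<Longrightarrow> (\<pi> j, \<pi> (Suc j)) \<in> parcs G" "inj_on \<pi> {..d}"
    "0 < d \<Longrightarrow> g (\<pi> 0) \<le> g (\<pi> 1)" "\<And>j. 0 < j \<Longrightarrow> j < d \<Longrightarrow> g (\<pi> j) < g (\<pi> (Suc j))"
  shows "\<exists>g'. moves G g g' \<and> (\<forall>j<d. g' (\<pi> j) = 0) \<and> (\<forall>x. x \<notin> \<pi> ` {..d} \<longrightarrow> g' x = g x)"
  using assms
proof (induction d arbitrary: g \<pi>)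
  case (Suc d)
  let ?g = "g(\<pi> 0 := 0, \<pi> (Suc d) := g (\<pi> (Suc d)) + g (\<pi> 0))"
  have ne: "\<pi> i \<noteq> \<pi> j" if "i \<noteq> j" "i \<le> Suc d" "j \<le> Suc d" for i j
    using Suc.prems(2) that by (auto dest!: inj_onD)
  have m: "moves G g ?g" using Suc.prems by (intro carry_all) auto
  have "\<exists>g'. moves G ?g g' \<and> (\<forall>j<d. g' ((\<pi> \<circ> Suc) j) = 0) \<and>
      (\<forall>x. x \<notin> (\<pi> \<circ> Suc) ` {..d} \<longrightarrow> g' x = ?g x)"
  proof (rule Suc.IH)
    show "inj_on (\<pi> \<circ> Suc) {..d}"
      by (rule comp_inj_on) (auto intro: inj_on_subset[OF Suc.prems(2)])
    have mono: "?g (\<pi> (Suc j)) < ?g (\<pi> (Suc (Suc j)))" if "j < d" for j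
      using Suc.prems(4)[of "Suc j"] that ne[of 0 "Suc j"] ne[of 0 "Suc (Suc j)"] ne[of "Suc j" "Suc d"]
      by auto
    show "?g ((\<pi> \<circ> Suc) 0) \<le> ?g ((\<pi> \<circ> Suc) 1)" if "0 < d" using mono[of 0] that by simp
    show "?g ((\<pi> \<circ> Suc) j) < ?g ((\<pi> \<circ> Suc) (Suc j))" if "0 < j" "j < d" for j
      using mono[of j] that by simp
  qed (use Suc.prems in auto)
  then obtain g' where g': "moves G ?g g'" "\<And>j. j < d \<Longrightarrow> g' (\<pi> (Suc j)) = 0"
    "\<And>x. x \<notin> (\<pi> \<circ> Suc) ` {..d} \<Longrightarrow> g' x = ?g x" by auto
  have out: "x \<notin> (\<pi> \<circ> Suc) ` {..d}" if "x \<notin> \<pi> ` {..Suc d}" for x using that by auto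
  have 0: "g' (\<pi> 0) = 0"
    using g'(3)[of "\<pi> 0"] ne[of 0 "Suc _"] ne[of 0 "Suc d"] by force
  show ?case
  proof (intro exI[of _ g'] conjI allI impI)
    show "moves G g g'" using m g'(1) by simp
    show "g' (\<pi> j) = 0" if "j < Suc d" for j using 0 g'(2)[of "j - 1"] that by (cases j) auto
    show "g' x = g x" if "x \<notin> \<pi> ` {..Suc d}" for x using g'(3)[OF out[OF that]] that by auto
  qed
qed auto

text \<open>
  Each leaf is carried to the end \<open>\<pi> d\<close> while the inner vertices of the path keep their weights, so the next
  leaf finds the same situation.
\<close>
lemma gather_leaves:
  assumes \<pi>: "\<And>j. j < d \<Longrightarrow> (\<pi> j, \<pi> (Suc j)) \<in> parcs G" "inj_on \<pi> {..d}"
    and Y: "finite Y" "\<And>y. y \<in> Y \<Longrightarrow> e y \<le> d \<and> (y, \<pi> (e y)) \<in> parcs G \<and> y \<notin> \<pi> ` {..d}"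
    and "\<And>y. y \<in> Y \<Longrightarrow> g y \<le> 1" "\<And>j. j \<le> d \<Longrightarrow> 0 < g (\<pi> j)"
    "\<And>y j. y \<in> Y \<Longrightarrow> e y \<le> j \<Longrightarrow> j < d \<Longrightarrow> g (\<pi> j) < g (\<pi> (Suc j))"
  shows "\<exists>r. moves G g (\<lambda>x. if x \<in> Y then 0 else if x = \<pi> d then g x + r else g x)"
  using Y assms(5-)
proof (induction Y arbitrary: g rule: finite_induct)
  case empty
  have "(\<lambda>x. if x \<in> {} then 0 else if x = \<pi> d then g x + 0 else g x) = g" by auto
  then show ?case by (metis rtranclp.rtrancl_refl)
next
  case (insert y Y)
  note y = insert.prems(1)[of y, simplified]
  have "\<exists>r. moves G g (g(y := 0, \<pi> d := g (\<pi> d) + r))"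
  proof (cases "g y = 0")
    case True
    then have "g(y := 0, \<pi> d := g (\<pi> d) + 0) = g" by auto
    then show ?thesis by (metis rtranclp.rtrancl_refl)
  next
    case False
    then have gy: "g y = 1" using insert.prems(2)[of y] by simp
    define \<rho> where "\<rho> j = (case j of 0 \<Rightarrow> y | Suc i \<Rightarrow> \<pi> (e y + i))" for j
    have "moves G g (g(\<rho> 0 := g (\<rho> 0) - 1, \<rho> (Suc (d - e y)) := g (\<rho> (Suc (d - e y))) + 1))"
    proof (rule carry)
      show "(\<rho> j, \<rho> (Suc j)) \<in> parcs G" if "j < Suc (d - e y)" for j
        using that \<pi>(1)[of "e y + (j - 1)"] y by (cases j) (simp_all add: \<rho>_def)
      show "inj_on \<rho> {..Suc (d - e y)}"
      proof (rule inj_onI)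
        fix i j assume ij: "i \<in> {..Suc (d - e y)}" "j \<in> {..Suc (d - e y)}" "\<rho> i = \<rho> j"
        have away: "y \<noteq> \<pi> (e y + l)" if "l \<le> d - e y" for l using y that by auto
        show "i = j"
        proof (cases i; cases j)
          fix i' j' assume *: "i = Suc i'" "j = Suc j'"
          then have "\<pi> (e y + i') = \<pi> (e y + j')" using ij(3) by (simp add: \<rho>_def)
          moreover have "e y + i' \<le> d" "e y + j' \<le> d" using ij * y by auto
          ultimately have "e y + i' = e y + j'" using inj_onD[OF \<pi>(2)] by blast
          then show ?thesis using * by simp
        next
          fix j' assume "i = 0" "j = Suc j'"
          then show ?thesis using ij away[of j'] by (simp add: \<rho>_def)
        next
          fix i' assume "i = Suc i'" "j = 0"
          then show ?thesis using ij away[of i'] by (simp add: \<rho>_def)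
        qed simp
      qed
      show "0 < g (\<rho> 0)" using gy by (simp add: \<rho>_def)
      show "g (\<rho> 0) \<le> g (\<rho> 1)" using gy insert.prems(3)[of "e y"] y by (simp add: \<rho>_def Suc_le_eq)
      show "g (\<rho> j) < g (\<rho> (Suc j))" if "0 < j" "j < Suc (d - e y)" for j
        using that insert.prems(4)[of y "e y + (j - 1)"] by (cases j) (auto simp: \<rho>_def)
    qed
    moreover have "\<rho> 0 = y" "\<rho> (Suc (d - e y)) = \<pi> d" using y by (auto simp: \<rho>_def)
    ultimately have "moves G g (g(y := 0, \<pi> d := g (\<pi> d) + 1))" using gy by simp
    then show ?thesis by blast
  qed
  then obtain r where r: "moves G g (g(y := 0, \<pi> d := g (\<pi> d) + r))" by blast
  let ?g = "g(y := 0, \<pi> d := g (\<pi> d) + r)"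
  have g\<pi>: "?g (\<pi> j) = g (\<pi> j)" if "j < d" for j
    using that y inj_onD[OF \<pi>(2), of j d] by auto
  have gd: "?g (\<pi> d) = g (\<pi> d) + r" by simp
  have "\<exists>r. moves G ?g (\<lambda>x. if x \<in> Y then 0 else if x = \<pi> d then ?g x + r else ?g x)"
  proof (rule insert.IH)
    show "e x \<le> d \<and> (x, \<pi> (e x)) \<in> parcs G \<and> x \<notin> \<pi> ` {..d}" if "x \<in> Y" for x
      using insert.prems(1) that by blast
    show "?g x \<le> 1" if "x \<in> Y" for x using insert.prems(1,2)[of x] that by auto
    show "0 < ?g (\<pi> j)" if "j \<le> d" for j
      using g\<pi>[of j] gd insert.prems(3)[OF that] that by (cases "j = d") auto
    show "?g (\<pi> j) < ?g (\<pi> (Suc j))" if "x \<in> Y" "e x \<le> j" "j < d" for x j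
      using g\<pi>[of j] g\<pi>[of "Suc j"] gd insert.prems(4)[of x j] that by (cases "Suc j = d") auto
  qed
  then obtain r' where r': "moves G ?g (\<lambda>x. if x \<in> Y then 0 else if x = \<pi> d then ?g x + r' else ?g x)"
    by blast
  have "(\<lambda>x. if x \<in> Y then 0 else if x = \<pi> d then ?g x + r' else ?g x)
      = (\<lambda>x. if x \<in> insert y Y then 0 else if x = \<pi> d then g x + (r + r') else g x)"
    using y insert.prems(1) by (auto simp: fun_eq_iff)
  then show ?case using rtranclp_trans[OF r r'] by metis
qed

text \<open>
  The leaves go first, since they travel over the spine vertices. A weak inequality suffices between the
  first two vertices of the path if the first one has no leaf.
\<close>
lemma gather:
  assumes \<pi>: "\<And>j. j < d \<Longrightarrow> (\<pi> j, \<pi> (Suc j)) \<in> parcs G" "inj_on \<pi> {..d}"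
    and Y: "finite Y" "\<And>y. y \<in> Y \<Longrightarrow> e y \<le> d \<and> (y, \<pi> (e y)) \<in> parcs G \<and> y \<notin> \<pi> ` {..d}"
    and g: "\<And>y. y \<in> Y \<Longrightarrow> g y \<le> 1" "\<And>j. j \<le> d \<Longrightarrow> 0 < g (\<pi> j)"
      "0 < d \<Longrightarrow> g (\<pi> 0) \<le> g (\<pi> 1)" "\<And>j. 0 < j \<Longrightarrow> j < d \<Longrightarrow> g (\<pi> j) < g (\<pi> (Suc j))"
      "\<And>y. y \<in> Y \<Longrightarrow> e y = 0 \<Longrightarrow> 0 < d \<Longrightarrow> g (\<pi> 0) < g (\<pi> 1)"
  shows "\<exists>g'. moves G g g' \<and> (\<forall>j<d. g' (\<pi> j) = 0) \<and> (\<forall>y\<in>Y. g' y = 0) \<and>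
     (\<forall>x. x \<notin> \<pi> ` {..d} \<longrightarrow> x \<notin> Y \<longrightarrow> g' x = g x)"
proof -
  have str: "g (\<pi> j) < g (\<pi> (Suc j))" if "y \<in> Y" "e y \<le> j" "j < d" for y j
    using g(4)[of j] g(5)[OF that(1)] that by (cases j) auto
  obtain r where r: "moves G g (\<lambda>x. if x \<in> Y then 0 else if x = \<pi> d then g x + r else g x)"
    using gather_leaves[of d \<pi> G Y e g] \<pi> Y g(1,2) str by blast
  let ?g = "\<lambda>x. if x \<in> Y then 0 else if x = \<pi> d then g x + r else g x"
  have g\<pi>: "?g (\<pi> j) = g (\<pi> j)" if "j < d" for j
  proof -
    have "\<pi> j \<noteq> \<pi> d" using that inj_onD[OF \<pi>(2), of j d] by auto
    moreover have "\<pi> j \<notin> Y" using Y(2)[of "\<pi> j"] that by auto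
    ultimately show ?thesis by simp
  qed
  have gd: "?g (\<pi> d) = g (\<pi> d) + r" using Y(2)[of "\<pi> d"] by auto
  have mono: "?g (\<pi> j) \<le> ?g (\<pi> (Suc j))" if "j < d" "g (\<pi> j) \<le> g (\<pi> (Suc j))" for j
    using g\<pi>[of j] g\<pi>[of "Suc j"] gd that by (cases "Suc j = d") auto
  have mono': "?g (\<pi> j) < ?g (\<pi> (Suc j))" if "j < d" "g (\<pi> j) < g (\<pi> (Suc j))" for j
    using g\<pi>[of j] g\<pi>[of "Suc j"] gd that by (cases "Suc j = d") auto
  have "\<exists>g'. moves G ?g g' \<and> (\<forall>j<d. g' (\<pi> j) = 0) \<and> (\<forall>x. x \<notin> \<pi> ` {..d} \<longrightarrow> g' x = ?g x)"
  proof (rule collapse_path[OF \<pi>])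
    show "?g (\<pi> 0) \<le> ?g (\<pi> 1)" if "0 < d"
      using mono[of 0] g(3) that unfolding One_nat_def by blast
    show "?g (\<pi> j) < ?g (\<pi> (Suc j))" if "0 < j" "j < d" for j
      using mono'[of j] g(4) that by blast
  qed
  then obtain g' where g': "moves G ?g g'" "\<forall>j<d. g' (\<pi> j) = 0" "\<And>x. x \<notin> \<pi> ` {..d} \<Longrightarrow> g' x = ?g x"
    by blast
  show ?thesis
  proof (intro exI[of _ g'] conjI)
    show "moves G g g'" using r g'(1) by simp
    show "\<forall>y\<in>Y. g' y = 0" using g'(3) Y(2) by simp
    show "\<forall>x. x \<notin> \<pi> ` {..d} \<longrightarrow> x \<notin> Y \<longrightarrow> g' x = g x" using g'(3) by auto
  qed (fact g'(2))
qed


lemma merge_pair: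
  assumes "(u, w) \<in> parcs G" "(w, u) \<in> parcs G" "u \<noteq> w"
  shows "\<exists>g' z. moves G g g' \<and> z \<in> {u, w} \<and> (\<forall>x\<in>{u, w} - {z}. g' x = 0) \<and> (\<forall>x. x \<notin> {u, w} \<longrightarrow> g' x = g x)"
proof -
  have one: "moves G g (g(u := 0, w := g w + g u))"
    if "(u, w) \<in> parcs G" "u \<noteq> w" "g u \<le> g w" for u w
    using carry_all[of 0 "\<lambda>j. if j = 0 then u else w" G g] that by (auto simp: inj_on_def)
  show ?thesis
  proof (cases "g u \<le> g w")
    case True
    then show ?thesis using one[OF assms(1,3)] by (intro exI[of _ "g(u := 0, w := g w + g u)"] exI[of _ w]) auto
  next
    case False
    then show ?thesis using one[OF assms(2)] assms(3)
      by (intro exI[of _ "g(w := 0, u := g u + g w)"] exI[of _ u]) auto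
  qed
qed

section \<open>The greedy partition of the spine\<close>

text \<open>
  The first vertex of a segment starting at \<open>w\<close> across which outside tokens have to climb. If \<open>v w\<close> has a leaf,
  that leaf supplies the tokens and \<open>v w\<close> hands them on. If not, \<open>v w\<close> is itself like a leaf of \<open>v (w + 1)\<close>.
\<close>
definition first_inner :: "(nat \<Rightarrow> nat) \<Rightarrow> nat \<Rightarrow> nat" where
  "first_inner c w = (if c w = 0 then w + 2 else w + 1)"

text \<open>
  The start of the next segment when a bad interval ends at \<open>s\<close>. The vertex \<open>v (s + 1)\<close> may still belong to the
  old segment if it has no leaf, since then it is like a leaf of \<open>v s\<close> and \<open>v s\<close> remains an end.
\<close>
definition next_anchor :: "(nat \<Rightarrow> nat) \<Rightarrow> nat \<Rightarrow> nat" where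
  "next_anchor c s = (if c (s + 1) = 0 then s + 2 else s + 1)"

lemma next_anchor_less:
  assumes "0 < c (k - 1) \<or> k = 1" "s + 1 < k"
  shows "next_anchor c s < k"
proof (cases "c (s + 1) = 0")
  case True
  then have "s + 1 \<noteq> k - 1" using assms by (metis add_gr_0 less_one nat_neq_iff not_add_less2)
  then have "s + 2 < k" using assms(2) by linarith
  then show ?thesis using True by (simp add: next_anchor_def)
qed (use assms in \<open>simp add: next_anchor_def\<close>)

text \<open>
  \<open>p\<close> is the first inner vertex of the current segment, and \<open>s\<close> is the vertex that is about to become the next
  inner one; in all calls that occur no bad interval of the segment ends before \<open>s\<close>.
\<close>
function greedy :: "(nat \<Rightarrow> nat) \<Rightarrow> nat \<Rightarrow> nat \<Rightarrow> nat \<Rightarrow> nat" where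
  "greedy c k p s =
     (if s + 1 < k then
        if \<exists>q\<in>{p..s}. bad c q s
        then 1 + greedy c k (first_inner c (next_anchor c s)) (first_inner c (next_anchor c s))
        else greedy c k p (s + 1)
      else 1)"
  by auto
termination
  by (relation "measure (\<lambda>(c, k, p, s). k - s)") (auto simp: first_inner_def next_anchor_def)

declare greedy.simps [simp del]

section \<open>Caterpillars along a spine\<close>

text \<open>
  The vertices off the spine form the set \<open>L\<close>, each adjacent only to its host \<open>v (h x)\<close>, and \<open>c i\<close> is the
  number of these at \<open>v i\<close>. An end of the spine may be a leaf of the graph; in this way a single edge and a
  single vertex are covered, with \<open>k = 1\<close>.
\<close>
locale spine =
  fixes G :: "'a pair_pre_digraph" and v :: "nat \<Rightarrow> 'a" and k :: nat and h :: "'a \<Rightarrow> nat"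
    and L :: "'a set" and c :: "nat \<Rightarrow> nat"
  defines "L \<equiv> pverts G - v ` {..<k}" and "c \<equiv> \<lambda>i. card {x \<in> L. h x = i}"
  assumes finite_verts: "finite (pverts G)" and inj_v: "inj_on v {..<k}"
    and v_verts: "v ` {..<k} \<subseteq> pverts G" and k_pos: "0 < k"
    and host: "x \<in> L \<Longrightarrow> h x < k"
    and arcs: "parcs G = {(v i, v (Suc i)) |i. Suc i < k} \<union> {(v (Suc i), v i) |i. Suc i < k}
       \<union> {(x, v (h x)) |x. x \<in> L} \<union> {(v (h x), x) |x. x \<in> L}"
begin

text \<open>
  The segment from \<open>v a\<close> to \<open>v b\<close> with its leaves.
\<close>
definition piece :: "nat \<Rightarrow> nat \<Rightarrow> 'a set" where
  "piece a b = v ` {a..b} \<union> {x \<in> L. a \<le> h x \<and> h x \<le> b}"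

lemma finite_L: "finite L"
  using finite_verts by (simp add: L_def)

lemma v_eq_iff: "i < k \<Longrightarrow> j < k \<Longrightarrow> v i = v j \<longleftrightarrow> i = j"
  using inj_v by (auto dest: inj_onD)

lemma v_notin_L: "i < k \<Longrightarrow> v i \<notin> L"
  by (simp add: L_def)

lemma finite_piece: "finite (piece a b)"
  using finite_L by (simp add: piece_def)

text \<open>
  Taken in reverse, the induction removes from \<open>F\<close> one topmost place after another, each together with a leaf
  that Hall's condition allows to spend on it; \<open>relay\<close> realizes the assignment by moves. The other leaves are
  left with weight \<open>1\<close>. Only a bound on the number of spent leaves is recorded, since it suffices to find
  an unspent one.
\<close>
lemma build_tent:
  assumes "enough F q" "gentle F" "\<And>i. 1 \<le> F i" "\<And>i. 2 \<le> F i \<Longrightarrow> int a \<le> i \<and> i \<le> int b"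
    "b < k" "\<And>i. q (int i) \<le> c i"
    "\<And>i. a \<le> i \<Longrightarrow> i \<le> b \<Longrightarrow> f (v i) = 1" "\<And>x. x \<in> L \<Longrightarrow> a \<le> h x \<Longrightarrow> h x \<le> b \<Longrightarrow> f x = 1"
  shows "\<exists>g. moves G f g \<and> (\<forall>i. a \<le> i \<and> i \<le> b \<longrightarrow> g (v i) = nat (F (int i))) \<and>
     (\<forall>x\<in>L. a \<le> h x \<and> h x \<le> b \<longrightarrow> g x \<le> 1) \<and>
     (\<forall>i. a \<le> i \<and> i \<le> b \<longrightarrow> card {x \<in> L. h x = i \<and> g x = 0} \<le> q (int i)) \<and>
     (\<forall>x. x \<notin> piece a b \<longrightarrow> g x = f x)"
  using assms
proof (induction "\<Sum>i\<in>{int a..int b}. nat (F i)" arbitrary: F q rule: less_induct)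
  case less
  note Fq = less.prems(1-6)
  show ?case
  proof (cases "\<exists>x. 2 \<le> F x")
    case False
    then have F1: "F i = 1" for i
    proof -
      have "\<not> 2 \<le> F i" using False by blast
      then show ?thesis using Fq(3)[of i] by linarith
    qed
    have "{x \<in> L. h x = i \<and> f x = 0} = {}" if "a \<le> i" "i \<le> b" for i
      using less.prems(8) that by fastforce
    then have "card {x \<in> L. h x = i \<and> f x = 0} \<le> q (int i)" if "a \<le> i" "i \<le> b" for i
      using that by (metis card.empty zero_le)
    then show ?thesis using F1 less.prems(7,8) by (intro exI[of _ f]) auto
  next
    case True
    then obtain x where x: "2 \<le> F x" by blast
    have low: "F j \<le> 1" if "j < int a" for j using Fq(4)[of j] that by linarith
    have high: "F j \<le> 1" if "int b < j" for j using Fq(4)[of j] that by linarith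
    obtain i m where r: "removable F q i m" and st: "stair F i m"
      using exists_removable_stair[OF Fq(1,2) low high x] by blast
    note r' = r[unfolded removable_def]
    let ?F = "F(m := F m - 1)" and ?q = "q(i := q i - 1)"
    have Fi: "2 \<le> F i" using gentleD[OF Fq(2), of m i] r' by auto
    have ab: "int a \<le> i" "i \<le> int b" "int a \<le> m" "m \<le> int b" using Fq(4) Fi r' by blast+
    have "\<exists>g. moves G f g \<and> (\<forall>i. a \<le> i \<and> i \<le> b \<longrightarrow> g (v i) = nat (?F (int i))) \<and>
     (\<forall>x\<in>L. a \<le> h x \<and> h x \<le> b \<longrightarrow> g x \<le> 1) \<and>
     (\<forall>i. a \<le> i \<and> i \<le> b \<longrightarrow> card {x \<in> L. h x = i \<and> g x = 0} \<le> ?q (int i)) \<and>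
     (\<forall>x. x \<notin> piece a b \<longrightarrow> g x = f x)"
    proof (rule less.hyps)
      show "(\<Sum>i\<in>{int a..int b}. nat (?F i)) < (\<Sum>i\<in>{int a..int b}. nat (F i))"
        using ab r' by (intro sum_strict_mono_ex1) auto
      show "enough ?F ?q" by (rule enough_remove[OF Fq(1) r])
      show "gentle ?F" using gentle_remove[OF Fq(2)] r' by blast
      show "1 \<le> ?F j" for j using Fq(3)[of j] r' by simp
      show "int a \<le> j \<and> j \<le> int b" if "2 \<le> ?F j" for j using Fq(4)[of j] that by (auto split: if_splits)
      show "?q (int j) \<le> c j" for j using Fq(6)[of j] by auto
    qed (use less.prems in auto)
    then obtain g where g: "moves G f g" "\<And>i. a \<le> i \<Longrightarrow> i \<le> b \<Longrightarrow> g (v i) = nat (?F (int i))"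
      "\<And>x. x \<in> L \<Longrightarrow> a \<le> h x \<Longrightarrow> h x \<le> b \<Longrightarrow> g x \<le> 1"
      "\<And>i. a \<le> i \<Longrightarrow> i \<le> b \<Longrightarrow> card {x \<in> L. h x = i \<and> g x = 0} \<le> ?q (int i)"
      "\<And>x. x \<notin> piece a b \<Longrightarrow> g x = f x" by blast
    define i0 m0 where "i0 = nat i" and "m0 = nat m"
    have im: "i = int i0" "m = int m0" and ab0: "a \<le> i0" "i0 \<le> b" "a \<le> m0" "m0 \<le> b"
      using ab by (auto simp: i0_def m0_def)
    have "card {x \<in> L. h x = i0 \<and> g x = 0} < card {x \<in> L. h x = i0}"
    proof -
      have "card {x \<in> L. h x = i0 \<and> g x = 0} \<le> q i - 1" using g(4)[OF ab0(1,2)] im by simp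
      also have "\<dots> < q i" using r' by simp
      also have "\<dots> \<le> card {x \<in> L. h x = i0}" using Fq(6)[of i0] im by (simp add: c_def)
      finally show ?thesis .
    qed
    then have "{x \<in> L. h x = i0 \<and> g x = 0} \<noteq> {x \<in> L. h x = i0}" by auto
    then obtain y where y: "y \<in> L" "h y = i0" "g y \<noteq> 0" by blast
    have gy: "g y = 1" using g(3)[OF y(1)] y ab0 by simp
    define d where "d = (if i0 \<le> m0 then m0 - i0 else i0 - m0)"
    define \<pi> where "\<pi> j = v (if i0 \<le> m0 then i0 + j else i0 - j)" for j
    define A where "A = nat (F i)"
    have idx: "(if i0 \<le> m0 then i0 + j else i0 - j) < k" if "j \<le> d" for j
      using that ab0 Fq(5) by (auto simp: d_def split: if_splits)
    have rel: "moves G g (g(y := 0, \<pi> d := A + d))"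
    proof (rule relay)
      show "(\<pi> j, \<pi> (Suc j)) \<in> parcs G" if "j < d" for j
      proof (cases "i0 \<le> m0")
        case True
        then have "Suc (i0 + j) < k" using that ab0 Fq(5) by (simp add: d_def)
        then show ?thesis using True unfolding arcs \<pi>_def by auto
      next
        case False
        then have "i0 - j = Suc (i0 - Suc j)" "i0 - j < k" using that ab0 Fq(5) by (auto simp: d_def)
        then show ?thesis using False unfolding arcs \<pi>_def by auto
      qed
      show "inj_on \<pi> {..d}"
        using idx by (intro inj_onI) (auto simp: \<pi>_def v_eq_iff d_def split: if_splits)
      show "y \<notin> \<pi> ` {..d}" using idx v_notin_L y(1) unfolding \<pi>_def by blast
      show "(y, \<pi> 0) \<in> parcs G" using y unfolding arcs \<pi>_def by auto
      show "g y = 1" by fact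
      have Fst: "F (int (if i0 \<le> m0 then i0 + j else i0 - j)) = F i + int j" if "j \<le> d" for j
        using stairD[OF st, of "int (if i0 \<le> m0 then i0 + j else i0 - j)"] that im
        by (auto simp: d_def split: if_splits)
      show "g (\<pi> j) = A + j" if "j < d" for j
      proof -
        have "int (if i0 \<le> m0 then i0 + j else i0 - j) \<noteq> m" using that im by (auto simp: d_def)
        moreover have "a \<le> (if i0 \<le> m0 then i0 + j else i0 - j)" "(if i0 \<le> m0 then i0 + j else i0 - j) \<le> b"
          using that ab0 by (auto simp: d_def)
        ultimately show ?thesis using g(2) Fst[of j] that Fi by (simp add: \<pi>_def A_def nat_add_distrib)
      qed
      have "(if i0 \<le> m0 then i0 + d else i0 - d) = m0" by (auto simp: d_def)
      then show "g (\<pi> d) + 1 = A + d" using g(2)[OF ab0(3,4)] Fst[of d] im Fi by (auto simp: \<pi>_def A_def)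
      show "2 \<le> A" using Fi by (simp add: A_def)
    qed
    have \<pi>d: "\<pi> d = v m0" by (auto simp: \<pi>_def d_def)
    have Ad: "A + d = nat (F m)"
      using stairD[OF st, of m] Fi im by (auto simp: A_def d_def)
    let ?g = "g(y := 0, v m0 := nat (F m))"
    have m0k: "m0 < k" using ab0 Fq(5) by simp
    show ?thesis
    proof (intro exI[of _ ?g] conjI allI impI ballI)
      show "moves G f ?g" using rtranclp_trans[OF g(1) rel] unfolding \<pi>d Ad .
      show "?g (v j) = nat (F (int j))" if "a \<le> j \<and> j \<le> b" for j
      proof -
        have "j < k" using that Fq(5) by simp
        then have "v j \<noteq> y" using v_notin_L y(1) by blast
        then show ?thesis using g(2)[of j] that im v_eq_iff[OF \<open>j < k\<close> m0k] by auto
      qed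
      show "?g x \<le> 1" if "x \<in> L" "a \<le> h x \<and> h x \<le> b" for x
        using g(3) that v_notin_L[OF m0k] by auto
      show "?g x = f x" if "x \<notin> piece a b" for x
      proof -
        have "x \<noteq> y" "x \<noteq> v m0" using that y ab0 by (auto simp: piece_def)
        then show ?thesis using g(5)[OF that] by simp
      qed
      show "card {x \<in> L. h x = j \<and> ?g x = 0} \<le> q (int j)" if "a \<le> j \<and> j \<le> b" for j
      proof (cases "j = i0")
        case False
        then have "{x \<in> L. h x = j \<and> ?g x = 0} = {x \<in> L. h x = j \<and> g x = 0}"
          using y v_notin_L[OF m0k] by auto
        then show ?thesis using g(4)[of j] that False im by simp
      next
        case True
        then have "{x \<in> L. h x = j \<and> ?g x = 0} \<subseteq> insert y {x \<in> L. h x = j \<and> g x = 0}"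
          using v_notin_L[OF m0k] by auto
        then have "card {x \<in> L. h x = j \<and> ?g x = 0} \<le> card (insert y {x \<in> L. h x = j \<and> g x = 0})"
          using finite_L by (intro card_mono) auto
        also have "\<dots> \<le> Suc (card {x \<in> L. h x = j \<and> g x = 0})" by (rule card_insert_le_m1) auto
        also have "\<dots> \<le> q (int j)"
        proof -
          have "0 < q (int i0)" using r' im by blast
          then show ?thesis using g(4)[of j] that True im by simp
        qed
        finally show ?thesis .
      qed
    qed
  qed
qed

lemma spine_arcs: "Suc i < k \<Longrightarrow> (v i, v (Suc i)) \<in> parcs G" "Suc i < k \<Longrightarrow> (v (Suc i), v i) \<in> parcs G"
  unfolding arcs by blast+

lemma leaf_arcs: "x \<in> L \<Longrightarrow> (x, v (h x)) \<in> parcs G" "x \<in> L \<Longrightarrow> (v (h x), x) \<in> parcs G"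
  unfolding arcs by blast+

text \<open>
  The tent over the interior \<open>{P..Q}\<close> rises up to \<open>t\<close> and falls from \<open>t + 1\<close> on. The two halves can thus be
  gathered in two adjacent vertices, for each parity of the length. If the interior is empty then the
  profile is flat and the halves have at most two vertices, which is where the weak inequalities occur.
\<close>
lemma tent_split:
  fixes a b ca cb :: nat and P Q :: int and F :: "int \<Rightarrow> int"
  assumes "a < b" and P_def: "P = int a + (if ca = 0 then 2 else 1)" and Q_def: "Q = int b - (if cb = 0 then 2 else 1)"
    and F_def: "F = (\<lambda>i. if P \<le> i \<and> i \<le> Q then min (i - P) (Q - i) + 2 else 1)"
  shows "\<exists>t. a \<le> t \<and> t < b \<and>
     (\<forall>i. int a < i \<and> i < int t \<longrightarrow> F i < F (i + 1)) \<and>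
     (a < t \<longrightarrow> F (int a) \<le> F (int a + 1) \<and> (ca \<noteq> 0 \<longrightarrow> F (int a) < F (int a + 1))) \<and>
     (\<forall>i. int t + 1 < i \<and> i < int b \<longrightarrow> F i < F (i - 1)) \<and>
     (t + 1 < b \<longrightarrow> F (int b) \<le> F (int b - 1) \<and> (cb \<noteq> 0 \<longrightarrow> F (int b) < F (int b - 1)))"
proof (cases "P \<le> Q")
  case True
  define t where "t = (P + Q) div 2"
  have t: "2 * t \<le> P + Q" "P + Q \<le> 2 * t + 1" by (auto simp: t_def)
  have "int a \<le> t" "t < int b" using t True by (auto simp: P_def Q_def split: if_splits)
  have F1: "F i < F (i + 1)" if "P - 1 \<le> i" "i < t" for i
    using that t True by (auto simp: F_def)
  have F2: "F i < F (i - 1)" if "t + 1 < i" "i \<le> Q + 1" for i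
    using that t True by (auto simp: F_def)
  show ?thesis
  proof (intro exI[of _ "nat t"] conjI allI impI)
    show "F i < F (i + 1)" if "int a < i \<and> i < int (nat t)" for i
      using that \<open>int a \<le> t\<close> by (intro F1) (auto simp: P_def)
    show "F i < F (i - 1)" if "int (nat t) + 1 < i \<and> i < int b" for i
      using that \<open>int a \<le> t\<close> by (intro F2) (auto simp: Q_def)
    show "F (int a) < F (int a + 1)" if "a < nat t" "ca \<noteq> 0"
      using that by (intro F1) (auto simp: P_def)
    show "F (int b) < F (int b - 1)" if "nat t + 1 < b" "cb \<noteq> 0"
      using that by (intro F2) (auto simp: Q_def)
    show "F (int a) \<le> F (int a + 1)" by (auto simp: F_def P_def)
    show "F (int b) \<le> F (int b - 1)" by (auto simp: F_def Q_def)
  qed (use \<open>int a \<le> t\<close> \<open>t < int b\<close> in auto)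
next
  case False
  then have F: "F = (\<lambda>_. 1)" by (auto simp: F_def)
  define t where "t = min (if ca = 0 then a + 1 else a) (b - 1)"
  have 1: "t \<le> a + 1" "a \<le> t" "t < b" "ca \<noteq> 0 \<Longrightarrow> t = a" using assms(1) by (auto simp: t_def)
  have 2: "b \<le> t + 2" "cb \<noteq> 0 \<Longrightarrow> b = t + 1" using False assms(1) by (auto simp: t_def P_def Q_def split: if_splits)
  show ?thesis unfolding F using 1 2 by (intro exI[of _ t]) auto
qed

text \<open>
  Every place below the tent has its range within the interior, so an interval may be clipped to the interior,
  where it is not bad.
\<close>
lemma good_enough:
  assumes good: "\<And>p s. first_inner c a \<le> p \<Longrightarrow> p \<le> s \<Longrightarrow> s + (if c b = 0 then 2 else 1) \<le> b \<Longrightarrow> \<not> bad c p s"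
  defines "P \<equiv> int a + (if c a = 0 then 2 else 1)" and "Q \<equiv> int b - (if c b = 0 then 2 else 1)"
  defines "F \<equiv> \<lambda>i. if P \<le> i \<and> i \<le> Q then min (i - P) (Q - i) + 2 else 1"
  shows "enough F (\<lambda>j. if 0 \<le> j then c (nat j) else 0)"
  unfolding enough_def
proof (intro allI)
  let ?q = "\<lambda>j. if 0 \<le> j then c (nat j) else 0"
  fix x y
  define x' y' where "x' = max x P" and "y' = min y Q"
  have sub: "slots F x y \<subseteq> slots F x' y'"
    by (auto simp: slots_def F_def x'_def y'_def split: if_splits)
  show "card (slots F x y) \<le> sum ?q {x..y}"
  proof (cases "x' \<le> y'")
    case False
    then have "slots F x' y' = {}" by (auto simp: slots_def)
    then have "slots F x y = {}" using sub by blast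
    then show ?thesis by simp
  next
    case True
    define p s where "p = nat x'" and "s = nat y'"
    have P0: "0 \<le> P" by (simp add: P_def)
    have x'0: "0 \<le> x'" using P0 by (simp add: x'_def)
    have ps: "x' = int p" "y' = int s" "p \<le> s" using True x'0 by (auto simp: p_def s_def)
    have "P \<le> int p" "int s \<le> Q" unfolding ps(1,2)[symmetric] by (auto simp: x'_def y'_def)
    then have "\<not> bad c p s"
      using ps(3) by (intro good) (auto simp: P_def Q_def first_inner_def split: if_splits)
    then have quota: "quota (Suc s - p) \<le> sum c {p..s}" using ps(3) by (auto simp: bad_def)
    have "card (slots F x y) \<le> card (slots F x' y')" using sub by (intro card_mono) auto
    also have "\<dots> \<le> quota (nat (y' - x' + 1))" by (rule card_slots_le)
    also have "nat (y' - x' + 1) = Suc s - p" using ps by (simp add: nat_diff_distrib')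
    also note quota
    also have "sum c {p..s} = sum ?q {x'..y'}"
      unfolding ps(1,2) image_int_atLeastAtMost[symmetric] by (subst sum.reindex) auto
    also have "\<dots> \<le> sum ?q {x..y}" by (intro sum_mono2) (auto simp: x'_def y'_def)
    finally show ?thesis .
  qed
qed

text \<open>
  Each half of the tent is gathered in its highest vertex, and of these two neighbours the lighter one is then
  moved into the heavier one.
\<close>
lemma collect_piece:
  assumes ab: "a \<le> b" "b < k"
    and good: "\<And>p s. first_inner c a \<le> p \<Longrightarrow> p \<le> s \<Longrightarrow> s + (if c b = 0 then 2 else 1) \<le> b \<Longrightarrow> \<not> bad c p s"
    and f: "\<And>x. x \<in> piece a b \<Longrightarrow> f x = 1"
  shows "\<exists>g z. moves G f g \<and> z \<in> piece a b \<and> (\<forall>x\<in>piece a b - {z}. g x = 0) \<and>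
     (\<forall>x. x \<notin> piece a b \<longrightarrow> g x = f x)"
proof (cases "a = b")
  case True
  let ?Y = "{x \<in> L. h x = a}"
  have "\<exists>g'. moves G f g' \<and> (\<forall>j<0. g' (v (a + j)) = 0) \<and> (\<forall>y\<in>?Y. g' y = 0) \<and>
     (\<forall>x. x \<notin> (\<lambda>j. v (a + j)) ` {..0} \<longrightarrow> x \<notin> ?Y \<longrightarrow> g' x = f x)"
  proof (rule gather[where e = "\<lambda>_. 0"])
    show "finite ?Y" using finite_L by simp
    show "0 \<le> (0::nat) \<and> (y, v (a + 0)) \<in> parcs G \<and> y \<notin> (\<lambda>j. v (a + j)) ` {..0}" if "y \<in> ?Y" for y
      using that leaf_arcs[of y] v_notin_L[of "h y"] ab True by auto
    show "f y \<le> 1" if "y \<in> ?Y" for y using f[of y] that True by (auto simp: piece_def)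
    show "0 < f (v (a + j))" if "j \<le> 0" for j using f[of "v (a + j)"] that True by (auto simp: piece_def)
  qed auto
  then obtain g where g: "moves G f g" "\<forall>y\<in>?Y. g y = 0" "\<forall>x. x \<noteq> v a \<longrightarrow> x \<notin> ?Y \<longrightarrow> g x = f x" by auto
  have "piece a b = insert (v a) ?Y" using True by (auto simp: piece_def)
  then show ?thesis using g by (intro exI[of _ g] exI[of _ "v a"]) auto
next
  case False
  then have lt: "a < b" using ab by simp
  define P Q where "P = int a + (if c a = 0 then 2 else 1)" and "Q = int b - (if c b = 0 then 2 else 1)"
  define F where "F = (\<lambda>i. if P \<le> i \<and> i \<le> Q then min (i - P) (Q - i) + 2 else (1::int))"
  obtain t where t: "a \<le> t" "t < b" "\<And>i. int a < i \<Longrightarrow> i < int t \<Longrightarrow> F i < F (i + 1)"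
     "a < t \<Longrightarrow> F (int a) \<le> F (int a + 1)" "a < t \<Longrightarrow> c a \<noteq> 0 \<Longrightarrow> F (int a) < F (int a + 1)"
     "\<And>i. int t + 1 < i \<Longrightarrow> i < int b \<Longrightarrow> F i < F (i - 1)"
     "t + 1 < b \<Longrightarrow> F (int b) \<le> F (int b - 1)" "t + 1 < b \<Longrightarrow> c b \<noteq> 0 \<Longrightarrow> F (int b) < F (int b - 1)"
  proof -
    from tent_split[OF lt P_def Q_def F_def] obtain t where
      "a \<le> t \<and> t < b \<and> (\<forall>i. int a < i \<and> i < int t \<longrightarrow> F i < F (i + 1)) \<and>
       (a < t \<longrightarrow> F (int a) \<le> F (int a + 1) \<and> (c a \<noteq> 0 \<longrightarrow> F (int a) < F (int a + 1))) \<and>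
       (\<forall>i. int t + 1 < i \<and> i < int b \<longrightarrow> F i < F (i - 1)) \<and>
       (t + 1 < b \<longrightarrow> F (int b) \<le> F (int b - 1) \<and> (c b \<noteq> 0 \<longrightarrow> F (int b) < F (int b - 1)))" ..
    then show ?thesis by (intro that[of t]) simp_all
  qed
  have F1: "1 \<le> F i" for i by (auto simp: F_def)
  obtain g where g: "moves G f g" "\<And>i. a \<le> i \<Longrightarrow> i \<le> b \<Longrightarrow> g (v i) = nat (F (int i))"
    "\<And>x. x \<in> L \<Longrightarrow> a \<le> h x \<Longrightarrow> h x \<le> b \<Longrightarrow> g x \<le> 1" "\<And>x. x \<notin> piece a b \<Longrightarrow> g x = f x"
  proof -
    have "enough F (\<lambda>j. if 0 \<le> j then c (nat j) else 0)"
      unfolding F_def P_def Q_def by (rule good_enough) (rule good)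
    moreover have "gentle F" unfolding gentle_def F_def by auto
    moreover have "int a \<le> i \<and> i \<le> int b" if "2 \<le> F i" for i
      using that by (auto simp: F_def P_def Q_def split: if_splits)
    moreover have "f (v i) = 1" if "a \<le> i" "i \<le> b" for i using f that by (auto simp: piece_def)
    moreover have "f x = 1" if "x \<in> L" "a \<le> h x" "h x \<le> b" for x using f that by (auto simp: piece_def)
    ultimately show ?thesis using build_tent[of F "\<lambda>j. if 0 \<le> j then c (nat j) else 0" a b f] F1 ab that by auto
  qed
  let ?Y = "{x \<in> L. a \<le> h x \<and> h x \<le> t}" and ?Z = "{x \<in> L. t + 1 \<le> h x \<and> h x \<le> b}"
  have noleaf: "c (h x) \<noteq> 0" if "x \<in> L" for x
    using that finite_L by (auto simp: c_def)
  have "\<exists>g'. moves G g g' \<and> (\<forall>j<t-a. g' (v (a + j)) = 0) \<and> (\<forall>y\<in>?Y. g' y = 0) \<and>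
     (\<forall>x. x \<notin> (\<lambda>j. v (a + j)) ` {..t-a} \<longrightarrow> x \<notin> ?Y \<longrightarrow> g' x = g x)"
  proof (rule gather[where e = "\<lambda>y. h y - a"])
    show "(v (a + j), v (a + Suc j)) \<in> parcs G" if "j < t - a" for j
      using spine_arcs(1)[of "a + j"] that t ab by simp
    show "inj_on (\<lambda>j. v (a + j)) {..t - a}" using t ab by (intro inj_onI) (auto simp: v_eq_iff)
    show "finite ?Y" using finite_L by simp
    show "h y - a \<le> t - a \<and> (y, v (a + (h y - a))) \<in> parcs G \<and> y \<notin> (\<lambda>j. v (a + j)) ` {..t - a}" if "y \<in> ?Y" for y
      using that leaf_arcs[of y] v_notin_L ab t by auto
    show "g y \<le> 1" if "y \<in> ?Y" for y using g(3)[of y] that t by auto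
    show "0 < g (v (a + j))" if "j \<le> t - a" for j using g(2)[of "a + j"] F1[of "int (a + j)"] that t by simp
    have mono: "g (v i) \<le> g (v (Suc i))" if "F (int i) \<le> F (int i + 1)" "a \<le> i" "Suc i \<le> b" for i
      using g(2)[of i] g(2)[of "Suc i"] that by (simp add: add.commute)
    have mono': "g (v i) < g (v (Suc i))" if "F (int i) < F (int i + 1)" "a \<le> i" "Suc i \<le> b" for i
      using g(2)[of i] g(2)[of "Suc i"] F1[of "int i"] that by (simp add: add.commute)
    show "g (v (a + 0)) \<le> g (v (a + 1))" if "0 < t - a" using mono[of a] t that by simp
    show "g (v (a + j)) < g (v (a + Suc j))" if "0 < j" "j < t - a" for j
      using mono'[of "a + j"] t(3)[of "int (a + j)"] t(1,2) that by simp
    show "g (v (a + 0)) < g (v (a + 1))" if "y \<in> ?Y" "h y - a = 0" "0 < t - a" for y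
      using mono'[of a] t that noleaf[of y] by simp
  qed
  then obtain g1 where g1: "moves G g g1" "\<And>j. j < t - a \<Longrightarrow> g1 (v (a + j)) = 0" "\<And>y. y \<in> ?Y \<Longrightarrow> g1 y = 0"
    "\<And>x. x \<notin> (\<lambda>j. v (a + j)) ` {..t-a} \<Longrightarrow> x \<notin> ?Y \<Longrightarrow> g1 x = g x" by blast
  have g1v: "g1 (v i) = g (v i)" if "t < i" "i \<le> b" for i
    using that ab t v_notin_L[of i] by (intro g1(4)) (auto simp: v_eq_iff)
  have "\<exists>g'. moves G g1 g' \<and> (\<forall>j<b-(t+1). g' (v (b - j)) = 0) \<and> (\<forall>y\<in>?Z. g' y = 0) \<and>
     (\<forall>x. x \<notin> (\<lambda>j. v (b - j)) ` {..b-(t+1)} \<longrightarrow> x \<notin> ?Z \<longrightarrow> g' x = g1 x)"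
  proof (rule gather[where e = "\<lambda>y. b - h y"])
    show "(v (b - j), v (b - Suc j)) \<in> parcs G" if "j < b - (t + 1)" for j
      using spine_arcs(2)[of "b - Suc j"] that t ab by (simp add: Suc_diff_Suc)
    show "inj_on (\<lambda>j. v (b - j)) {..b - (t + 1)}" using t ab by (intro inj_onI) (auto simp: v_eq_iff)
    show "finite ?Z" using finite_L by simp
    show "b - h y \<le> b - (t + 1) \<and> (y, v (b - (b - h y))) \<in> parcs G \<and> y \<notin> (\<lambda>j. v (b - j)) ` {..b - (t + 1)}"
      if "y \<in> ?Z" for y
      using that leaf_arcs[of y] v_notin_L ab t by auto
    show "g1 y \<le> 1" if "y \<in> ?Z" for y
    proof -
      have "y \<noteq> v (a + j)" if "j \<le> t - a" for j
      proof -
        have "a + j < k" using that t(1,2) ab by linarith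
        then show ?thesis using \<open>y \<in> ?Z\<close> v_notin_L[of "a + j"] by auto
      qed
      then have "g1 y = g y" using that by (intro g1(4)) auto
      then show ?thesis using g(3)[of y] that t by auto
    qed
    show "0 < g1 (v (b - j))" if "j \<le> b - (t + 1)" for j
      using g1v[of "b - j"] g(2)[of "b - j"] F1[of "int (b - j)"] that t by simp
    have mono: "g1 (v (Suc i)) \<le> g1 (v i)" if "F (int i + 1) \<le> F (int i)" "t < i" "Suc i \<le> b" for i
      using g1v[of i] g1v[of "Suc i"] g(2)[of i] g(2)[of "Suc i"] t that by (simp add: add.commute)
    have mono': "g1 (v (Suc i)) < g1 (v i)" if "F (int i + 1) < F (int i)" "t < i" "Suc i \<le> b" for i
      using g1v[of i] g1v[of "Suc i"] g(2)[of i] g(2)[of "Suc i"] F1[of "int i + 1"] t that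
      by (simp add: add.commute)
    show "g1 (v (b - 0)) \<le> g1 (v (b - 1))" if "0 < b - (t + 1)"
      using mono[of "b - 1"] t(7) that by (simp add: of_nat_diff)
    show "g1 (v (b - j)) < g1 (v (b - Suc j))" if "0 < j" "j < b - (t + 1)" for j
      using mono'[of "b - Suc j"] t(6)[of "int (b - j)"] that
      by (simp add: of_nat_diff Suc_diff_Suc algebra_simps)
    show "g1 (v (b - 0)) < g1 (v (b - 1))" if "y \<in> ?Z" "b - h y = 0" "0 < b - (t + 1)" for y
    proof -
      have "c b \<noteq> 0" using that noleaf[of y] by (metis (no_types, lifting) diff_is_0_eq le_antisym mem_Collect_eq)
      then show ?thesis using mono'[of "b - 1"] t(8) that by (simp add: of_nat_diff)
    qed
  qed
  then obtain g2 where g2: "moves G g1 g2" "\<And>j. j < b - (t+1) \<Longrightarrow> g2 (v (b - j)) = 0" "\<And>y. y \<in> ?Z \<Longrightarrow> g2 y = 0"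
    "\<And>x. x \<notin> (\<lambda>j. v (b - j)) ` {..b-(t+1)} \<Longrightarrow> x \<notin> ?Z \<Longrightarrow> g2 x = g1 x" by blast
  have zero: "g2 x = 0" if "x \<in> piece a b" "x \<noteq> v t" "x \<noteq> v (t + 1)" for x
  proof (cases "x \<in> L")
    case True
    then have "x \<notin> v ` {a..b}" using ab v_notin_L by auto
    then have "a \<le> h x \<and> h x \<le> b" using that(1) by (auto simp: piece_def)
    then consider "x \<in> ?Y" | "x \<in> ?Z" using True by fastforce
    then show ?thesis
    proof cases
      case 1
      have "x \<noteq> v (b - j)" for j using True v_notin_L[of "b - j"] ab by auto
      then show ?thesis using 1 g1(3)[OF 1] g2(4)[of x] by auto
    qed (rule g2(3))
  next
    case False
    then have "x \<in> v ` {a..b}" using that(1) by (simp add: piece_def)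
    then obtain i where i: "x = v i" "a \<le> i" "i \<le> b" by auto
    show ?thesis
    proof (cases "i < t")
      case True
      have "g1 x = 0" using g1(2)[of "i - a"] True i by simp
      moreover have "g2 x = g1 x" using i True t ab False by (intro g2(4)) (auto simp: v_eq_iff)
      ultimately show ?thesis by simp
    next
      case False
      then show ?thesis using g2(2)[of "b - i"] i that by (cases "i = t"; cases "i = t + 1") auto
    qed
  qed
  have same: "g2 x = f x" if "x \<notin> piece a b" for x
  proof -
    have out: "x \<notin> v ` {a..b}" using that by (simp add: piece_def)
    have "b - j \<in> {a..b}" if "j \<le> b - (t + 1)" for j using that t(1,2) by auto
    then have "x \<notin> (\<lambda>j. v (b - j)) ` {..b-(t+1)}" using out by blast
    moreover have "a + j \<in> {a..b}" if "j \<le> t - a" for j using that t(1,2) by auto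
    then have "x \<notin> (\<lambda>j. v (a + j)) ` {..t-a}" using out by blast
    moreover have "x \<notin> ?Y" "x \<notin> ?Z" using that t by (auto simp: piece_def)
    ultimately show ?thesis using g1(4) g2(4) g(4) that by simp
  qed
  obtain g3 z where g3: "moves G g2 g3" "z \<in> {v t, v (t + 1)}" "\<forall>x\<in>{v t, v (t + 1)} - {z}. g3 x = 0"
    "\<forall>x. x \<notin> {v t, v (t + 1)} \<longrightarrow> g3 x = g2 x"
    using merge_pair[of "v t" "v (t + 1)" G g2] spine_arcs[of t] t ab v_eq_iff[of t "t + 1"] by auto
  have in_piece: "v t \<in> piece a b" "v (t + 1) \<in> piece a b" using t by (auto simp: piece_def)
  show ?thesis
  proof (intro exI[of _ g3] exI[of _ z] conjI)
    show "moves G f g3" using g(1) g1(1) g2(1) g3(1) by simp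
    show "z \<in> piece a b" using g3(2) in_piece by blast
    show "\<forall>x\<in>piece a b - {z}. g3 x = 0" using g3 zero by (metis DiffE DiffI insertCI insertE emptyE)
    show "\<forall>x. x \<notin> piece a b \<longrightarrow> g3 x = f x" using g3(4) same in_piece by (metis insertE emptyE)
  qed
qed

text \<open>
  The segment that is cut off ends just before the next anchor, and its interior ends before \<open>s\<close>, hence it
  contains no bad interval.
\<close>
lemma greedy_upper:
  assumes "a < k" "p = first_inner c a" "p \<le> s" "0 < c (k - 1) \<or> k = 1"
    "\<And>p' s'. p \<le> p' \<Longrightarrow> p' \<le> s' \<Longrightarrow> s' < s \<Longrightarrow> \<not> bad c p' s'"
    "\<And>x. x \<in> piece a (k - 1) \<Longrightarrow> f x = 1"
  shows "\<exists>g. moves G f g \<and> card {x \<in> piece a (k - 1). 0 < g x} \<le> greedy c k p s \<and>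
     (\<forall>x. x \<notin> piece a (k - 1) \<longrightarrow> g x = f x)"
  using assms
proof (induction "k - s" arbitrary: a p s f rule: less_induct)
  case less
  have one: "card {x \<in> piece a b. 0 < g x} \<le> 1" if "\<forall>x\<in>piece a b - {z}. g x = 0" for a b z and g :: "'a \<Rightarrow> nat"
    using card_mono[of "{z}" "{x \<in> piece a b. 0 < g x}"] that by force
  have ap: "a < p" using less.prems(2) by (auto simp: first_inner_def)
  show ?case
  proof (cases "s + 1 < k")
    case False
    have "\<exists>g z. moves G f g \<and> z \<in> piece a (k - 1) \<and> (\<forall>x\<in>piece a (k - 1) - {z}. g x = 0) \<and>
     (\<forall>x. x \<notin> piece a (k - 1) \<longrightarrow> g x = f x)"
    proof (rule collect_piece)
      show "\<not> bad c p' s'" if "first_inner c a \<le> p'" "p' \<le> s'" "s' + (if c (k - 1) = 0 then 2 else 1) \<le> k - 1" for p' s'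
        using that False less.prems(2,5) by (auto split: if_splits)
    qed (use less.prems in auto)
    then obtain g z where "moves G f g" "\<forall>x\<in>piece a (k - 1) - {z}. g x = 0"
      "\<forall>x. x \<notin> piece a (k - 1) \<longrightarrow> g x = f x" by blast
    then show ?thesis using one[of a "k - 1" z g] False by (intro exI[of _ g]) (simp add: greedy.simps[of c k p s])
  next
    case True
    show ?thesis
    proof (cases "\<exists>q\<in>{p..s}. bad c q s")
      case False
      have eq: "greedy c k p s = greedy c k p (s + 1)" using False True by (simp add: greedy.simps[of c k p s])
      show ?thesis unfolding eq
      proof (rule less.hyps)
        show "\<not> bad c p' s'" if "p \<le> p'" "p' \<le> s'" "s' < s + 1" for p' s'
          using that False less.prems(5)[of p' s'] by (cases "s' = s") auto
      qed (use less.prems True in auto)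
    next
      case bad: True
      define w where "w = next_anchor c s"
      define b where "b = w - 1"
      have wk: "w < k" using next_anchor_less[of c k s, OF less.prems(4) True] by (simp add: w_def)
      have w: "w = Suc b" "s < w" by (auto simp: w_def b_def next_anchor_def)
      have b: "a \<le> b" "b < k" using ap less.prems(3) w wk by auto
      have eq: "greedy c k p s = 1 + greedy c k (first_inner c w) (first_inner c w)"
        using bad True by (simp add: greedy.simps[of c k p s] w_def)
      have un: "piece a (k - 1) = piece a b \<union> piece w (k - 1)"
      proof -
        have "{a..k - 1} = {a..b} \<union> {w..k - 1}" using w wk b by auto
        then have "v ` {a..k - 1} = v ` {a..b} \<union> v ` {w..k - 1}" by (metis image_Un)
        moreover have "{x \<in> L. a \<le> h x \<and> h x \<le> k - 1} =
            {x \<in> L. a \<le> h x \<and> h x \<le> b} \<union> {x \<in> L. w \<le> h x \<and> h x \<le> k - 1}"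
          using w wk b by auto
        ultimately show ?thesis unfolding piece_def by blast
      qed
      have dis: "x \<notin> piece w (k - 1)" if "x \<in> piece a b" for x
      proof
        assume "x \<in> piece w (k - 1)"
        then consider i where "x = v i" "w \<le> i" "i < k" | "x \<in> L" "w \<le> h x" using k_pos by (fastforce simp: piece_def)
        then show False
        proof cases
          case 1
          then have "x \<notin> L" using v_notin_L by blast
          then have "x \<in> v ` {a..b}" using that by (simp add: piece_def)
          then obtain j where "x = v j" "j \<le> b" by auto
          then show False using 1 w b v_eq_iff[of i j] by simp
        next
          case 2
          then have "h x \<le> b" using that b v_notin_L by (auto simp: piece_def)
          then show False using 2 w by simp
        qed
      qed
      have "\<exists>g z. moves G f g \<and> z \<in> piece a b \<and> (\<forall>x\<in>piece a b - {z}. g x = 0) \<and>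
       (\<forall>x. x \<notin> piece a b \<longrightarrow> g x = f x)"
      proof (rule collect_piece[OF b])
        show "\<not> bad c p' s'" if "first_inner c a \<le> p'" "p' \<le> s'" "s' + (if c b = 0 then 2 else 1) \<le> b" for p' s'
          using that less.prems(2,5) by (auto simp: b_def w_def next_anchor_def split: if_splits)
        show "f x = 1" if "x \<in> piece a b" for x
          using less.prems(6)[of x] that unfolding un by simp
      qed
      then obtain g z where g: "moves G f g" "\<forall>x\<in>piece a b - {z}. g x = 0" "\<And>x. x \<notin> piece a b \<Longrightarrow> g x = f x" by blast
      have "\<exists>g'. moves G g g' \<and> card {x \<in> piece w (k - 1). 0 < g' x} \<le> greedy c k (first_inner c w) (first_inner c w) \<and>
         (\<forall>x. x \<notin> piece w (k - 1) \<longrightarrow> g' x = g x)"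
      proof (rule less.hyps)
        show "g x = 1" if "x \<in> piece w (k - 1)" for x
        proof -
          have "x \<notin> piece a b" using dis that by blast
          moreover have "x \<in> piece a (k - 1)" unfolding un using that by blast
          ultimately show ?thesis using g(3)[of x] less.prems(6)[of x] by simp
        qed
        show "k - first_inner c w < k - s" using w True by (auto simp: first_inner_def)
      qed (use less.prems wk in auto)
      then obtain g' where g': "moves G g g'" "card {x \<in> piece w (k - 1). 0 < g' x} \<le> greedy c k (first_inner c w) (first_inner c w)"
         "\<And>x. x \<notin> piece w (k - 1) \<Longrightarrow> g' x = g x" by blast
      have g'g: "g' x = g x" if "x \<in> piece a b" for x using dis[OF that] g'(3) by blast
      have "{x \<in> piece a (k - 1). 0 < g' x} \<subseteq> {x \<in> piece a b. 0 < g x} \<union> {x \<in> piece w (k - 1). 0 < g' x}"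
        unfolding un using g'g by auto
      then have "card {x \<in> piece a (k - 1). 0 < g' x} \<le> card ({x \<in> piece a b. 0 < g x} \<union> {x \<in> piece w (k - 1). 0 < g' x})"
        using finite_piece by (intro card_mono) auto
      also have "\<dots> \<le> card {x \<in> piece a b. 0 < g x} + card {x \<in> piece w (k - 1). 0 < g' x}"
        by (rule card_Un_le)
      also have "\<dots> \<le> 1 + greedy c k (first_inner c w) (first_inner c w)" using one[OF g(2)] g'(2) by simp
      finally have card: "card {x \<in> piece a (k - 1). 0 < g' x} \<le> greedy c k p s" unfolding eq .
      have "moves G f g'" using rtranclp_trans[OF g(1) g'(1)] .
      moreover have "g' x = f x" if "x \<notin> piece a (k - 1)" for x
        using that g(3)[of x] g'(3)[of x] unfolding un by simp
      ultimately show ?thesis using card by blast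
    qed
  qed
qed

end


section \<open>Obstructions leave survivors\<close>

lemma card_hosts:
  assumes "finite L"
  shows "card {x \<in> L. p \<le> h x \<and> h x \<le> s} = (\<Sum>i\<in>{p..s::nat}. card {x \<in> L. h x = i})"
proof -
  have "{x \<in> L. p \<le> h x \<and> h x \<le> s} = (\<Union>i\<in>{p..s}. {x \<in> L. h x = i})" by auto
  then show ?thesis using assms by (simp only:) (intro card_UN_disjoint, auto)
qed

text \<open>
  A chain of anchors \<open>w 0, \<dots>, w K\<close> with a bad interval \<open>{p j..s j}\<close> between any two consecutive ones, as the
  greedy partition finds it.
\<close>
locale obstruction_chain = spine G v k h L c
  for G :: "'a pair_pre_digraph" and v :: "nat \<Rightarrow> 'a" and k and h and L :: "'a set" and c +
  fixes K :: nat and w p s :: "nat \<Rightarrow> nat"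
  assumes w0: "w 0 < k"
    and chain: "j < K \<Longrightarrow> first_inner c (w j) \<le> p j \<and> bad c (p j) (s j) \<and>
      w (Suc j) = next_anchor c (s j) \<and> w (Suc j) < k"
begin

lemma interval_ordered: "j < K \<Longrightarrow> p j \<le> s j"
  using chain by (auto simp: bad_def)

lemma anchor_before: "j < K \<Longrightarrow> w j < p j" and anchor_gap_before: "j < K \<Longrightarrow> c (w j) = 0 \<Longrightarrow> w j + 2 \<le> p j"
  using chain[of j] by (auto simp: first_inner_def split: if_splits)

lemma anchor_after: "j < K \<Longrightarrow> s j < w (Suc j)" and anchor_gap_after: "j < K \<Longrightarrow> c (w (Suc j)) = 0 \<Longrightarrow> s j + 2 \<le> w (Suc j)"
  using chain[of j] by (auto simp: next_anchor_def split: if_splits)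

lemma anchor_less: "j \<le> K \<Longrightarrow> w j < k"
  using chain[of "j - 1"] w0 by (cases j) auto

lemma w_less: "i < j \<Longrightarrow> j \<le> K \<Longrightarrow> w i < w j"
proof (induction j)
  case (Suc j)
  have "w j < w (Suc j)" using anchor_before[of j] interval_ordered[of j] anchor_after[of j] Suc.prems by simp
  then show ?case using Suc by (cases "i = j") auto
qed simp

lemma w_le: "i \<le> j \<Longrightarrow> j \<le> K \<Longrightarrow> w i \<le> w j"
  using w_less[of i j] by (cases "i = j") auto

lemma inner_unique:
  assumes "i < K" "j < K" "p i \<le> x" "x \<le> s i" "p j \<le> x" "x \<le> s j"
  shows "i = j"
proof -
  have "False" if "i < j" "i < K" "j < K" "x \<le> s i" "p j \<le> x" for i j
    using anchor_after[of i] w_le[of "Suc i" j] anchor_before[of j] that by simp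
  then show ?thesis using assms by (metis nat_neq_iff)
qed

lemma anchor_not_inner: "i \<le> K \<Longrightarrow> j < K \<Longrightarrow> w i < p j \<or> s j < w i"
  using w_le[of i j] anchor_before[of j] anchor_after[of j] w_le[of "Suc j" i] by (cases "i \<le> j") auto

definition inner :: "nat \<Rightarrow> nat \<Rightarrow> bool" where
  "inner j i \<longleftrightarrow> j < K \<and> p j \<le> i \<and> i \<le> s j"

text \<open>
  The least weight that an outside token has below it when it passes \<open>v i\<close>: the tent on a bad interval and \<open>1\<close>
  elsewhere. At an anchor without leaves it is \<open>0\<close>, so that the initial weight \<open>1\<close> of the anchor counts as
  an outside token. Neighbouring needs differ by at most one (\<open>need_gentle\<close>), so a vertex with more than it
  needs can only give to a vertex that has what it needs.
\<close>
definition need :: "nat \<Rightarrow> nat" where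
  "need i =
     (if \<exists>j. inner j i then let j = SOME j. inner j i in min (Suc i - p j) (Suc (s j) - i) + 1
      else if \<exists>j\<le>K. i = w j \<and> c i = 0 then 0 else 1)"

lemma need_inner: "inner j i \<Longrightarrow> need i = min (Suc i - p j) (Suc (s j) - i) + 1"
proof -
  assume *: "inner j i"
  have "(SOME j. inner j i) = j"
    using * inner_unique by (intro some_equality) (auto simp: inner_def)
  then show ?thesis using * by (auto simp: need_def)
qed

lemma need_outer: "(\<And>j. \<not> inner j i) \<Longrightarrow> need i \<le> 1"
  by (simp add: need_def)

lemma need_zero: "need i = 0 \<Longrightarrow> c i = 0"
  by (auto simp: need_def Let_def split: if_splits)

lemma need_anchor: "j \<le> K \<Longrightarrow> need (w j) \<le> 1" and need_anchor0: "j \<le> K \<Longrightarrow> c (w j) = 0 \<Longrightarrow> need (w j) = 0"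
proof -
  assume j: "j \<le> K"
  have out: "\<not> inner l (w j)" for l using anchor_not_inner[OF j, of l] by (auto simp: inner_def)
  then show "need (w j) \<le> 1" by (rule need_outer)
  show "need (w j) = 0" if "c (w j) = 0" using out j that by (auto simp: need_def)
qed

lemma need_around:
  assumes j: "j < K" and i: "p j \<le> Suc i" "i \<le> Suc (s j)"
  shows "need i = min (Suc i - p j) (Suc (s j) - i) + 1"
proof (cases "inner j i")
  case False
  then have i': "Suc i = p j \<or> i = Suc (s j)" using i j by (auto simp: inner_def)
  have out: "\<not> inner l i" for l
  proof
    assume l: "inner l i"
    then have "l \<noteq> j" using False by auto
    then consider "l < j" | "j < l" by linarith
    then show False
    proof cases
      case 1
      then show False using l i' anchor_after[of l] w_le[of "Suc l" j] anchor_before[of j] j interval_ordered[of j] by (auto simp: inner_def)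
    next
      case 2
      then show False using l i' anchor_after[of j] w_le[of "Suc j" l] anchor_before[of l] j interval_ordered[of j] by (auto simp: inner_def)
    qed
  qed
  have nz: "\<not> (i = w l \<and> c i = 0)" if "l \<le> K" for l
  proof
    assume l: "i = w l \<and> c i = 0"
    show False
    proof (cases "l \<le> j")
      case True
      then have "w l \<le> w j" using j by (intro w_le) auto
      then have "Suc i = p j" using i' l anchor_before[OF j] interval_ordered[OF j] by auto
      then have "l = j" using l anchor_before[OF j] w_less[of l j] True j by (cases "l = j") auto
      then show False using anchor_gap_before[OF j] l \<open>Suc i = p j\<close> by auto
    next
      case False
      then have "w (Suc j) \<le> w l" using that by (intro w_le) auto
      then have "i = Suc (s j)" using i' l anchor_after[OF j] interval_ordered[OF j] by auto
      then have "l = Suc j" using l anchor_after[OF j] w_less[of "Suc j" l] False that by (cases "l = Suc j") auto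
      then show False using anchor_gap_after[OF j] l \<open>i = Suc (s j)\<close> by auto
    qed
  qed
  have "need i = 1" using out nz by (auto simp: need_def)
  then show ?thesis using i' interval_ordered[OF j] by auto
qed (rule need_inner)

lemma need_gentle: "need i \<le> need (Suc i) + 1 \<and> need (Suc i) \<le> need i + 1"
proof (cases "\<exists>j. inner j i \<or> inner j (Suc i)")
  case True
  then obtain j where j: "j < K" "p j \<le> Suc i" "i \<le> Suc (s j)" "Suc i \<le> Suc (s j)" by (auto simp: inner_def)
  have "min (Suc i - p j) (Suc (s j) - i) \<le> Suc (min (Suc (Suc i) - p j) (Suc (s j) - Suc i))"
    "min (Suc (Suc i) - p j) (Suc (s j) - Suc i) \<le> Suc (min (Suc i - p j) (Suc (s j) - i))"
    by (simp_all only: min_def) (auto split: if_splits)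
  then show ?thesis using need_around[of j i] need_around[of j "Suc i"] j by simp
next
  case False
  then have "need i \<le> 1" "need (Suc i) \<le> 1" using need_outer by blast+
  then show ?thesis by auto
qed

text \<open>
  A marker is a vertex with more weight than it needs. Marker \<open>j\<close> starts at the anchor \<open>w j\<close>: if the anchor has
  leaves, then it starts in a leaf, which has weight \<open>1\<close> and needs nothing, and this is coded as \<open>None\<close>;
  otherwise it starts in the anchor itself. Later it is some spine vertex \<open>Some i\<close>. A marker that is still
  in its leaf lies off the spine and does not remove the anchor from the zones on either side. The \<open>zone\<close> consists of the interval \<open>j\<close> and its two neighbours, as far as these lie
  strictly between the markers \<open>j\<close> and \<open>Suc j\<close>.
\<close>
definition left_end :: "(nat \<Rightarrow> nat option) \<Rightarrow> nat \<Rightarrow> nat" where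
  "left_end X j = (case X j of None \<Rightarrow> w j | Some i \<Rightarrow> Suc i)"

definition right_end :: "(nat \<Rightarrow> nat option) \<Rightarrow> nat \<Rightarrow> nat" where
  "right_end X j = (case X j of None \<Rightarrow> Suc (w j) | Some i \<Rightarrow> i)"

definition zone :: "(nat \<Rightarrow> nat option) \<Rightarrow> nat \<Rightarrow> nat set" where
  "zone X j = {i. p j \<le> Suc i \<and> i \<le> Suc (s j) \<and> left_end X j \<le> i \<and> i < right_end X (Suc j)}"

definition deficit :: "('a \<Rightarrow> nat) \<Rightarrow> (nat \<Rightarrow> nat option) \<Rightarrow> nat \<Rightarrow> nat" where
  "deficit f X j = (\<Sum>i\<in>zone X j. need i - f (v i))"

definition live :: "('a \<Rightarrow> nat) \<Rightarrow> nat \<Rightarrow> nat" where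
  "live f j = card {x \<in> L. p j \<le> h x \<and> h x \<le> s j \<and> 0 < f x}"

definition anchor_leaf :: "nat \<Rightarrow> 'a" where
  "anchor_leaf j = (SOME x. x \<in> L \<and> h x = w j)"

lemma anchor_leaf: "c (w j) \<noteq> 0 \<Longrightarrow> anchor_leaf j \<in> L \<and> h (anchor_leaf j) = w j"
proof -
  assume "c (w j) \<noteq> 0"
  then have "{x \<in> L. h x = w j} \<noteq> {}" unfolding c_def by (metis card.empty)
  then obtain x where "x \<in> L \<and> h x = w j" by auto
  then show ?thesis unfolding anchor_leaf_def by (rule someI)
qed

definition marked :: "('a \<Rightarrow> nat) \<Rightarrow> (nat \<Rightarrow> nat option) \<Rightarrow> nat \<Rightarrow> bool" where
  "marked f X j = (case X j of None \<Rightarrow> c (w j) \<noteq> 0 \<and> 0 < f (anchor_leaf j)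
     | Some i \<Rightarrow> i < k \<and> need i < f (v i))"

text \<open>
  The invariant: in every zone the missing weight exceeds what the live leaves of the bad interval can
  supply. The first conjunct says that a leaf can gain weight only if its host dies from giving its last unit to it.
\<close>
definition blocked :: "('a \<Rightarrow> nat) \<Rightarrow> (nat \<Rightarrow> nat option) \<Rightarrow> bool" where
  "blocked f X \<longleftrightarrow> (\<forall>x\<in>L. f x \<le> 1 \<or> f (v (h x)) = 0) \<and> (\<forall>j\<le>K. marked f X j) \<and>
     (\<forall>j<K. live f j < deficit f X j)"

lemma finite_zone [simp]: "finite (zone X j)"
  by (rule finite_subset[of _ "{..Suc (s j)}"]) (auto simp: zone_def)

text \<open>
  If \<open>v i\<close> has more than it needs, then so has \<open>v i'\<close> after the move, and no deficit changes; a marker at \<open>v i\<close>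
  moves along. It cannot run into the next marker, since a zone with a deficit is not empty. If \<open>v i\<close> has
  at most what it needs, then its own deficit grows by one and makes up for the unit that \<open>v i'\<close> gains. The
  point is that \<open>v i\<close> lies in the same zone as \<open>v i'\<close> if the gain of \<open>v i'\<close> matters at all.
\<close>
lemma blocked_spine_move:
  assumes b: "blocked f X" and i: "i' = Suc i \<or> i = Suc i'" "i < k" "i' < k"
    and f: "0 < f (v i)" "f (v i) \<le> f (v i')"
    and g: "g = f(v i := f (v i) - 1, v i' := f (v i') + 1)"
  shows "\<exists>X. blocked g X"
proof -
  have ne: "v i \<noteq> v i'" using i v_eq_iff by auto
  have gL: "g x = f x" if "x \<in> L" for x using that v_notin_L i by (auto simp: g)
  have gv: "g (v l) = f (v l)" if "l < k" "l \<noteq> i" "l \<noteq> i'" for l using that v_eq_iff i by (auto simp: g)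
  have gi: "g (v i) = f (v i) - 1" "g (v i') = f (v i') + 1" using ne by (auto simp: g)
  have live: "live g j = live f j" for j using gL by (auto simp: live_def intro!: arg_cong[of _ _ card])
  have leaves: "\<forall>x\<in>L. g x \<le> 1 \<or> g (v (h x)) = 0"
  proof
    fix x assume x: "x \<in> L"
    have "g (v (h x)) = 0" if "f (v (h x)) = 0"
      using that f gi gv[OF host[OF x]] by (cases "h x = i"; cases "h x = i'") auto
    then show "g x \<le> 1 \<or> g (v (h x)) = 0" using b x gL by (auto simp: blocked_def)
  qed
  have zone_k: "l < k" if "j < K" "l \<in> zone X j" for l X j
    using that anchor_after[of j] anchor_less[of "Suc j"] by (auto simp: zone_def)
  show ?thesis
  proof (cases "need i < f (v i)")
    case True
    have "need i' \<le> need i + 1" using need_gentle[of i] need_gentle[of i'] i(1) by auto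
    then have ni': "need i' \<le> f (v i')" "need i' < g (v i')" "need i \<le> g (v i)"
      using True f gi by auto
    \<comment> \<open>Both \<open>v i\<close> and \<open>v i'\<close> have no deficit before and after the move, so it does not matter
      that the marker takes them from one zone into another.\<close>
    define X' where "X' j = (if X j = Some i then Some i' else X j)" for j
    have "marked g X' j" if "j \<le> K" for j
    proof -
      have m: "marked f X j" using b that by (simp add: blocked_def)
      show ?thesis
      proof (cases "X j")
        case None
        then show ?thesis using m anchor_leaf gL by (auto simp: marked_def X'_def)
      next
        case (Some l)
        then show ?thesis using m ni' i(2,3) gv[of l] by (cases "l = i'") (auto simp: marked_def X'_def)
      qed
    qed
    moreover have "deficit f X j = deficit g X' j" if "j < K" for j
    proof -
      have z: "l \<in> zone X j \<longleftrightarrow> l \<in> zone X' j" if "l \<noteq> i" "l \<noteq> i'" for l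
        using that i(1) unfolding zone_def left_end_def right_end_def X'_def
        by (auto split: option.splits if_splits)
      have "deficit f X j = (\<Sum>l\<in>zone X j - {i, i'}. need l - f (v l))"
        unfolding deficit_def using True ni' by (intro sum.mono_neutral_right) auto
      also have "\<dots> = (\<Sum>l\<in>zone X' j - {i, i'}. need l - g (v l))"
        using z zone_k[OF that] gv by (intro sum.cong) auto
      also have "\<dots> = deficit g X' j"
        unfolding deficit_def using ni' by (intro sum.mono_neutral_left) auto
      finally show ?thesis .
    qed
    ultimately have "blocked g X'" using b live leaves by (simp add: blocked_def)
    then show ?thesis by blast
  next
    case False
    have Xi: "X j \<noteq> Some i" if "j \<le> K" for j
    proof
      assume "X j = Some i"
      moreover have "marked f X j" using b that by (simp add: blocked_def)
      ultimately show False using False by (simp add: marked_def)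
    qed
    have "marked g X j" if "j \<le> K" for j
    proof -
      have m: "marked f X j" using b that by (simp add: blocked_def)
      show ?thesis
      proof (cases "X j")
        case None
        then show ?thesis using m anchor_leaf gL by (auto simp: marked_def)
      next
        case (Some l)
        then show ?thesis using m gi gv[of l] Xi[OF that] by (cases "l = i'") (auto simp: marked_def)
      qed
    qed
    moreover have "deficit f X j \<le> deficit g X j" if j: "j < K" for j
    proof (cases "i' \<in> zone X j \<and> f (v i') < need i'")
      case nz: False
      have "need l - f (v l) \<le> need l - g (v l)" if "l \<in> zone X j" for l
        using that zone_k[OF j that] gv[of l] gi nz by (cases "l = i"; cases "l = i'") auto
      then show ?thesis unfolding deficit_def by (rule sum_mono)
    next
      case True
      \<comment> \<open>A live vertex with a deficit needs at least \<open>2\<close>, hence it lies in the bad interval and not at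
        its border, and it is not an anchor.\<close>
      have n2: "2 \<le> need i'" using True f by simp
      moreover have "need i' = min (Suc i' - p j) (Suc (s j) - i') + 1"
        using True by (intro need_around[OF j]) (auto simp: zone_def)
      ultimately have inner': "p j \<le> i'" "i' \<le> s j" by auto
      have a1: "i' \<noteq> w l" if "l \<le> K" for l using need_anchor[OF that] n2 by auto
      have "left_end X j \<le> i"
        using True Xi[of j] j i(1) a1[of j] unfolding zone_def left_end_def
        by (auto split: option.splits)
      moreover have "i < right_end X (Suc j)"
        using True Xi[of "Suc j"] j i(1) a1[of "Suc j"] unfolding zone_def right_end_def
        by (auto split: option.splits)
      ultimately have iz: "i \<in> zone X j" using inner' i(1) by (auto simp: zone_def)
      let ?Z = "zone X j - {i} - {i'}"
      have split: "deficit e X j = (need i - e (v i)) + ((need i' - e (v i')) + (\<Sum>l\<in>?Z. need l - e (v l)))" for e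
      proof -
        have "deficit e X j = (need i - e (v i)) + (\<Sum>l\<in>zone X j - {i}. need l - e (v l))"
          unfolding deficit_def using iz by (intro sum.remove) auto
        also have "(\<Sum>l\<in>zone X j - {i}. need l - e (v l)) = (need i' - e (v i')) + (\<Sum>l\<in>?Z. need l - e (v l))"
          using True ne by (intro sum.remove) auto
        finally show ?thesis .
      qed
      have "(\<Sum>l\<in>?Z. need l - f (v l)) = (\<Sum>l\<in>?Z. need l - g (v l))"
        using zone_k[OF j] gv by (intro sum.cong) auto
      then show ?thesis using split[of f] split[of g] gi False f(1) by auto
    qed
    ultimately have "blocked g X" using b live leaves by (simp add: blocked_def) (meson less_le_trans)
    then show ?thesis by blast
  qed
qed

text \<open>
  A leaf of the bad interval closes at most one gap, but then it is no longer live. A leaf elsewhere can only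
  raise a vertex that has what it needs. A marker that sits in the leaf moves to the host, which gets weight at least \<open>2\<close>.
\<close>
lemma blocked_from_leaf:
  assumes b: "blocked f X" and x: "x \<in> L" and f: "0 < f x" "f x \<le> f (v (h x))"
    and g: "g = f(x := f x - 1, v (h x) := f (v (h x)) + 1)"
  shows "\<exists>X. blocked g X"
proof -
  let ?i = "h x"
  have ik: "?i < k" using host[OF x] .
  have fx: "f x = 1" using b x f by (auto simp: blocked_def)
  have ne: "x \<noteq> v ?i" using v_notin_L[OF ik] x by auto
  have gL: "g y = (if y = x then 0 else f y)" if "y \<in> L" for y using that v_notin_L[OF ik] fx by (auto simp: g)
  have gv: "g (v l) = (if l = ?i then f (v l) + 1 else f (v l))" if "l < k" for l
    using that v_eq_iff ik x v_notin_L by (auto simp: g)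
  have leaves: "\<forall>y\<in>L. g y \<le> 1 \<or> g (v (h y)) = 0"
    using b gL gv host f by (auto simp: blocked_def)
  have zone_k: "l < k" if "j < K" "l \<in> zone X j" for l X j
    using that anchor_after[of j] anchor_less[of "Suc j"] by (auto simp: zone_def)
  define X' where "X' j = (if X j = None \<and> anchor_leaf j = x then Some ?i else X j)" for j
  have "marked g X' j" if "j \<le> K" for j
  proof -
    have m: "marked f X j" using b that by (simp add: blocked_def)
    show ?thesis
    proof (cases "X j")
      case None
      show ?thesis
      proof (cases "anchor_leaf j = x")
        case True
        have "h x = w j" using anchor_leaf[of j] m None True by (simp add: marked_def)
        then have "need ?i \<le> 1" using need_anchor[OF that] by simp
        then show ?thesis using None True ik gv[OF ik] f fx by (simp add: marked_def X'_def)
      next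
        case False
        then show ?thesis using None m anchor_leaf gL by (simp add: marked_def X'_def)
      qed
    next
      case (Some l)
      then show ?thesis using m gv[of l] by (auto simp: marked_def X'_def)
    qed
  qed
  moreover have "live g j < deficit g X' j" if j: "j < K" for j
  proof (cases "inner j ?i")
    case True
    have out: "X' l = X l" if "l \<le> K" for l
    proof -
      have "anchor_leaf l \<noteq> x" if "X l = None"
      proof
        assume "anchor_leaf l = x"
        moreover have "marked f X l" using b \<open>l \<le> K\<close> by (simp add: blocked_def)
        ultimately have "h x = w l" using anchor_leaf[of l] that by (simp add: marked_def)
        then show False using anchor_not_inner[OF \<open>l \<le> K\<close> j] True by (auto simp: inner_def)
      qed
      then show ?thesis by (auto simp: X'_def)
    qed
    then have z: "zone X' j = zone X j" using j by (simp add: zone_def left_end_def right_end_def)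
    have "{y \<in> L. p j \<le> h y \<and> h y \<le> s j \<and> 0 < f y} = insert x {y \<in> L. p j \<le> h y \<and> h y \<le> s j \<and> 0 < g y}"
      using gL x True fx by (auto simp: inner_def split: if_splits)
    moreover have "x \<notin> {y \<in> L. p j \<le> h y \<and> h y \<le> s j \<and> 0 < g y}" using gL x by auto
    ultimately have live: "live f j = Suc (live g j)" using finite_L by (simp add: live_def)
    have "deficit f X j \<le> Suc (deficit g X j)"
    proof (cases "?i \<in> zone X j")
      case iz: True
      have split: "deficit e X j = (need ?i - e (v ?i)) + (\<Sum>l\<in>zone X j - {?i}. need l - e (v l))" for e
        unfolding deficit_def using iz by (intro sum.remove) auto
      have "(\<Sum>l\<in>zone X j - {?i}. need l - f (v l)) = (\<Sum>l\<in>zone X j - {?i}. need l - g (v l))"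
        using zone_k[OF j] gv by (intro sum.cong) auto
      then show ?thesis using split[of f] split[of g] gv[OF ik] by auto
    next
      case False
      have "deficit f X j = deficit g X j" unfolding deficit_def
        using zone_k[OF j] gv False by (intro sum.cong) auto
      then show ?thesis by simp
    qed
    moreover have "live f j < deficit f X j" using b j by (simp add: blocked_def)
    ultimately show ?thesis using live z by (simp add: deficit_def)
  next
    case False
    have live: "live g j = live f j"
      unfolding live_def using gL False j by (intro arg_cong[of _ _ card]) (auto simp: inner_def split: if_splits)
    have zero: "need ?i - f (v ?i) = 0" "need ?i - g (v ?i) = 0" if "?i \<in> zone X j \<or> ?i \<in> zone X' j"
    proof -
      have "p j \<le> Suc ?i" "?i \<le> Suc (s j)" using that by (auto simp: zone_def)
      then have "need ?i \<le> 1" using need_around[OF j, of ?i] False j by (auto simp: inner_def)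
      then show "need ?i - f (v ?i) = 0" "need ?i - g (v ?i) = 0" using f gv[OF ik] by auto
    qed
    have z: "l \<in> zone X j \<longleftrightarrow> l \<in> zone X' j" if "l \<noteq> ?i" for l
    proof -
      have a: "w l' = ?i" if "l' \<le> K" "X l' = None" "anchor_leaf l' = x" for l'
      proof -
        have "marked f X l'" using b that by (simp add: blocked_def)
        then show ?thesis using anchor_leaf[of l'] that by (simp add: marked_def)
      qed
      show ?thesis using that a[of j] a[of "Suc j"] j unfolding zone_def left_end_def right_end_def X'_def
        by (auto split: option.splits if_splits)
    qed
    have "deficit f X j = (\<Sum>l\<in>zone X j - {?i}. need l - f (v l))"
      unfolding deficit_def using zero by (intro sum.mono_neutral_right) auto
    also have "\<dots> = (\<Sum>l\<in>zone X' j - {?i}. need l - g (v l))"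
      using z zone_k[OF j] gv by (intro sum.cong) auto
    also have "\<dots> = deficit g X' j"
      unfolding deficit_def using zero by (intro sum.mono_neutral_left) auto
    finally have "deficit f X j = deficit g X' j" .
    moreover have "live f j < deficit f X j" using b j by (simp add: blocked_def)
    ultimately show ?thesis using live by simp
  qed
  ultimately have "blocked g X'" using leaves by (simp add: blocked_def)
  then show ?thesis by blast
qed

text \<open>
  Such a move kills its spine vertex, so deficits can only grow, and no marker sits there: a vertex that has a
  leaf needs at least \<open>1\<close>.
\<close>
lemma blocked_to_leaf:
  assumes b: "blocked f X" and x: "x \<in> L" and f: "0 < f (v (h x))" "f (v (h x)) \<le> f x"
    and g: "g = f(v (h x) := f (v (h x)) - 1, x := f x + 1)"
  shows "\<exists>X. blocked g X"
proof -
  let ?i = "h x"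
  have ik: "?i < k" using host[OF x] .
  have f1: "f x = 1" "f (v ?i) = 1" using b x f by (auto simp: blocked_def)
  have gL: "g y = (if y = x then 2 else f y)" if "y \<in> L" for y using that v_notin_L[OF ik] f1 by (auto simp: g)
  have gv: "g (v l) = (if l = ?i then 0 else f (v l))" if "l < k" for l
    using that v_eq_iff ik x v_notin_L f1 by (auto simp: g)
  have leaves: "\<forall>y\<in>L. g y \<le> 1 \<or> g (v (h y)) = 0"
    using b gL gv host by (auto simp: blocked_def)
  have zone_k: "l < k" if "j < K" "l \<in> zone X j" for l j
    using that anchor_after[of j] anchor_less[of "Suc j"] by (auto simp: zone_def)
  have "c ?i \<noteq> 0" using x finite_L by (auto simp: c_def)
  then have nz: "need ?i \<noteq> 0" using need_zero[of ?i] by auto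
  have "marked g X j" if "j \<le> K" for j
  proof -
    have m: "marked f X j" using b that by (simp add: blocked_def)
    show ?thesis
    proof (cases "X j")
      case None
      then show ?thesis using m anchor_leaf gL by (simp add: marked_def)
    next
      case (Some l)
      then have "l \<noteq> ?i" using m nz f1 by (auto simp: marked_def)
      then show ?thesis using Some m gv[of l] by (simp add: marked_def)
    qed
  qed
  moreover have "live g j = live f j" for j
    unfolding live_def using gL f1 by (intro arg_cong[of _ _ card]) (auto split: if_splits)
  moreover have "deficit f X j \<le> deficit g X j" if "j < K" for j
    unfolding deficit_def using zone_k[OF that] gv by (intro sum_mono) auto
  ultimately have "blocked g X" using b leaves by (simp add: blocked_def) (meson less_le_trans)
  then show ?thesis by blast
qed

lemma blocked_move:
  assumes "blocked f X" "unit_move G f g"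
  shows "\<exists>X. blocked g X"
proof -
  obtain a b where ab: "(a, b) \<in> parcs G" "0 < f a" "f a \<le> f b" "g = f(a := f a - 1, b := f b + 1)"
    using assms(2) by (auto simp: unit_move_def)
  from ab(1) consider i where "a = v i" "b = v (Suc i)" "Suc i < k" | i where "a = v (Suc i)" "b = v i" "Suc i < k"
    | "a \<in> L" "b = v (h a)" | "b \<in> L" "a = v (h b)"
    unfolding arcs by blast
  then show ?thesis
  proof cases
    case 1 then show ?thesis using blocked_spine_move[OF assms(1), of "Suc i" i g] ab by simp
  next
    case 2 then show ?thesis using blocked_spine_move[OF assms(1), of i "Suc i" g] ab by simp
  next
    case 3 then show ?thesis using blocked_from_leaf[OF assms(1), of a g] ab by simp
  next
    case 4 then show ?thesis using blocked_to_leaf[OF assms(1), of b g] ab by simp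
  qed
qed

lemma blocked_moves: "moves G f g \<Longrightarrow> blocked f X \<Longrightarrow> \<exists>X. blocked g X"
  by (induction arbitrary: X rule: rtranclp_induct) (use blocked_move in blast)+

text \<open>
  Initially no marker has moved, so the zones are the whole intervals with their neighbours, and the missing weight
  on each is the quota of the interval.
\<close>
lemma blocked_start: "blocked (\<lambda>_. 1) (\<lambda>j. if c (w j) = 0 then Some (w j) else None)" (is "blocked _ ?X")
proof -
  have "marked (\<lambda>_. 1) ?X j" if "j \<le> K" for j
    using need_anchor0[OF that] anchor_less[OF that] by (auto simp: marked_def)
  moreover have "live (\<lambda>_. 1) j < deficit (\<lambda>_. 1) ?X j" if j: "j < K" for j
  proof -
    have z: "zone ?X j = {p j - 1..Suc (s j)}"
      using anchor_before[OF j] anchor_gap_before[OF j] anchor_after[OF j] anchor_gap_after[OF j] interval_ordered[OF j]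
      unfolding zone_def left_end_def right_end_def by (auto split: if_splits)
    have "live (\<lambda>_. 1) j = sum c {p j..s j}"
      using card_hosts[OF finite_L, of "p j" h "s j"] by (simp add: live_def c_def)
    also have "\<dots> < quota (Suc (s j) - p j)" using chain[OF j] by (simp add: bad_def)
    also have "\<dots> = (\<Sum>l<Suc (s j) - p j. min (Suc l) (Suc (s j) - p j - l))"
      by (rule tent_sum[symmetric])
    also have "\<dots> = (\<Sum>i\<in>{p j..s j}. min (Suc i - p j) (Suc (s j) - i))"
      using interval_ordered[OF j] by (intro sum.reindex_bij_witness[where i = "\<lambda>i. i - p j" and j = "\<lambda>l. l + p j"]) auto
    also have "\<dots> = (\<Sum>i\<in>{p j..s j}. need i - 1)"
      using need_inner j by (intro sum.cong) (auto simp: inner_def)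
    also have "\<dots> \<le> deficit (\<lambda>_. 1) ?X j"
      unfolding deficit_def z by (intro sum_mono2) auto
    finally show ?thesis .
  qed
  ultimately show ?thesis by (simp add: blocked_def)
qed

text \<open>
  Every marker is a vertex of positive weight, and since no zone is empty the markers keep their order along the
  spine and stay distinct.
\<close>
lemma blocked_survivors:
  assumes b: "blocked f X"
  shows "K + 1 \<le> card {x \<in> pverts G. 0 < f x}"
proof -
  define pos where "pos j = (case X j of None \<Rightarrow> w j | Some i \<Rightarrow> i)" for j
  define y where "y j = (case X j of None \<Rightarrow> anchor_leaf j | Some i \<Rightarrow> v i)" for j
  have m: "marked f X j" if "j \<le> K" for j using b that by (simp add: blocked_def)
  have step: "pos j < pos (Suc j)" if j: "j < K" for j
  proof -
    have "deficit f X j \<noteq> 0" using b j by (auto simp: blocked_def)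
    then have "zone X j \<noteq> {}" by (auto simp: deficit_def)
    then have "left_end X j < right_end X (Suc j)" by (auto simp: zone_def)
    then show ?thesis using w_less[of j "Suc j"] j
      by (auto simp: left_end_def right_end_def pos_def split: option.splits)
  qed
  have less: "i < j \<Longrightarrow> j \<le> K \<Longrightarrow> pos i < pos j" for i j
  proof (induction j)
    case (Suc j)
    then show ?case using step[of j] by (cases "i = j") auto
  qed simp
  have pos_y: "if y j \<in> L then h (y j) = pos j else pos j < k \<and> y j = v (pos j)"
     and live: "y j \<in> pverts G" "0 < f (y j)" if "j \<le> K" for j
    using m[OF that] anchor_leaf[of j] v_notin_L v_verts
    by (auto simp: marked_def y_def pos_def L_def split: option.splits)
  have "inj_on y {..K}"
  proof (rule inj_onI)
    fix i j assume ij: "i \<in> {..K}" "j \<in> {..K}" "y i = y j"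
    then have "pos i = pos j" using pos_y[of i] pos_y[of j] v_eq_iff by (auto split: if_splits)
    then show "i = j" using less[of i j] less[of j i] ij by (metis atMost_iff less_irrefl nat_neq_iff)
  qed
  then have "K + 1 = card (y ` {..K})" by (simp add: card_image)
  also have "\<dots> \<le> card {x \<in> pverts G. 0 < f x}"
    using live finite_verts by (intro card_mono) auto
  finally show ?thesis .
qed

end

lemma (in spine) greedy_chain:
  assumes "a < k" "q = first_inner c a" "q \<le> r" "0 < c (k - 1) \<or> k = 1"
  shows "\<exists>K w p s. obstruction_chain G v k h K w p s \<and> w 0 = a \<and> greedy c k q r = K + 1"
  using assms(1-3)
proof (induction "k - r" arbitrary: a q r rule: less_induct)
  case less
  have aq: "a < q" using less.prems(2) by (auto simp: first_inner_def)
  show ?case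
  proof (cases "r + 1 < k")
    case False
    have "obstruction_chain G v k h 0 (\<lambda>_. a) (\<lambda>_. 0) (\<lambda>_. 0)"
      using less.prems(1) by unfold_locales auto
    then show ?thesis using False by (auto simp: greedy.simps[of c k q r])
  next
    case True
    show ?thesis
    proof (cases "\<exists>x\<in>{q..r}. bad c x r")
      case False
      then have "greedy c k q r = greedy c k q (r + 1)" using True by (simp add: greedy.simps[of c k q r])
      then show ?thesis using less.hyps[of "r + 1" a q] less.prems True by simp
    next
      case bad: True
      then obtain x where x: "q \<le> x" "bad c x r" by auto
      let ?w = "next_anchor c r"
      have wk: "?w < k" using next_anchor_less[of c k r, OF assms(4) True] .
      have "k - first_inner c ?w < k - r" using True by (auto simp: first_inner_def next_anchor_def)
      then obtain K w p s where IH: "obstruction_chain G v k h K w p s" "w 0 = ?w"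
        "greedy c k (first_inner c ?w) (first_inner c ?w) = K + 1"
        using less.hyps[of "first_inner c ?w" ?w "first_inner c ?w"] wk by auto
      interpret O: obstruction_chain G v k h L c K w p s
        using IH(1) unfolding L_def c_def .
      let ?cons = "\<lambda>(y::nat) (f::nat \<Rightarrow> nat) j. case j of 0 \<Rightarrow> y | Suc j \<Rightarrow> f j"
      have "obstruction_chain G v k h (Suc K) (?cons a w) (?cons x p) (?cons r s)"
      proof unfold_locales
        show "?cons a w 0 < k" using less.prems(1) by simp
        show "first_inner (\<lambda>i. card {x \<in> pverts G - v ` {..<k}. h x = i}) (?cons a w j) \<le> ?cons x p j \<and>
           bad (\<lambda>i. card {x \<in> pverts G - v ` {..<k}. h x = i}) (?cons x p j) (?cons r s j) \<and>
           ?cons a w (Suc j) = next_anchor (\<lambda>i. card {x \<in> pverts G - v ` {..<k}. h x = i}) (?cons r s j) \<and>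
           ?cons a w (Suc j) < k" if "j < Suc K" for j
          unfolding L_def[symmetric] c_def[symmetric]
          using that O.chain[of "j - 1"] x less.prems(2) IH(2) wk by (cases j) auto
      qed
      moreover have "greedy c k q r = Suc K + 1"
        using bad True IH(3) by (simp add: greedy.simps[of c k q r])
      ultimately show ?thesis by (intro exI[of _ "Suc K"] exI[of _ "?cons a w"] exI[of _ "?cons x p"] exI[of _ "?cons r s"]) auto
    qed
  qed
qed

text \<open>
  The assumption says that the last spine vertex has a leaf, so that the last anchor of the greedy partition is
  a spine vertex.
\<close>
theorem (in spine) unit_acquisition_number_eq_greedy:
  assumes "0 < c (k - 1) \<or> k = 1"
  shows "unit_acquisition_number G = greedy c k (first_inner c 0) (first_inner c 0)"
proof -
  let ?p = "first_inner c 0"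
  let ?S = "\<lambda>f. {x \<in> pverts G. 0 < f x}"
  have all: "pverts G = piece 0 (k - 1)"
  proof -
    have "{0..k - 1} = {..<k}" using k_pos by auto
    then have "piece 0 (k - 1) = v ` {..<k} \<union> L" using host by (fastforce simp: piece_def)
    then show ?thesis using v_verts by (auto simp: L_def)
  qed
  obtain K w p s where ch: "obstruction_chain G v k h K w p s" "greedy c k ?p ?p = K + 1"
    using greedy_chain[of 0 ?p ?p] k_pos assms by auto
  interpret O: obstruction_chain G v k h L c K w p s
    using ch(1) unfolding L_def c_def .
  have lower: "greedy c k ?p ?p \<le> card (?S f)" if "moves G (\<lambda>_. 1) f" for f
    using O.blocked_moves[OF that O.blocked_start] O.blocked_survivors ch(2) by metis
  obtain g where g: "moves G (\<lambda>_. 1) g" "card (?S g) \<le> greedy c k ?p ?p"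
    using greedy_upper[of 0 ?p ?p "\<lambda>_. 1"] k_pos assms unfolding all[symmetric] by auto
  show ?thesis unfolding unit_acquisition_number_def
  proof (rule Least_equality)
    show "\<exists>f. moves G (\<lambda>_. 1) f \<and> greedy c k ?p ?p = card (?S f)"
      using g lower[OF g(1)] by (intro exI[of _ g]) simp
  qed (use lower in auto)
qed


section \<open>Caterpillars have spines\<close>

lemma out_degree_eq: "out_degree (with_proj G) u = card {x. (u, x) \<in> parcs G}"
proof -
  have "out_arcs (with_proj G) u = Pair u ` {x. (u, x) \<in> parcs G}"
    by (auto simp: out_arcs_def)
  then show ?thesis unfolding out_degree_def by (simp add: card_image inj_on_def)
qed

lemma vwalk_iff:
  "vwalk p (with_proj G) \<longleftrightarrow>
     p \<noteq> [] \<and> set p \<subseteq> pverts G \<and> (\<forall>i. Suc i < length p \<longrightarrow> (p ! i, p ! Suc i) \<in> parcs G)"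
proof -
  have "set (vwalk_arcs p) \<subseteq> parcs G \<longleftrightarrow> (\<forall>i. Suc i < length p \<longrightarrow> (p ! i, p ! Suc i) \<in> parcs G)"
  proof (induction p rule: vwalk_arcs.induct)
    case (3 x y xs)
    have "(\<forall>i. Suc i < length (x # y # xs) \<longrightarrow> ((x # y # xs) ! i, (x # y # xs) ! Suc i) \<in> parcs G) \<longleftrightarrow>
       (x, y) \<in> parcs G \<and> (\<forall>i. Suc i < length (y # xs) \<longrightarrow> ((y # xs) ! i, (y # xs) ! Suc i) \<in> parcs G)"
      (is "(\<forall>i. ?P i) \<longleftrightarrow> ?Q")
    proof -
      have "(\<forall>i. ?P i) \<longleftrightarrow> ?P 0 \<and> (\<forall>i. ?P (Suc i))" by (metis not0_implies_Suc)
      then show ?thesis by simp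
    qed
    then show ?case using 3 by simp
  qed auto
  then show ?thesis unfolding vwalk_def by auto
qed

text \<open>
  In this form connectedness provides a host for every leaf: a leaf whose only neighbour is again a leaf would
  make up the whole graph together with this neighbour.
\<close>
lemma connected_closed_eq:
  assumes G: "pair_graph G" and conn: "Digraph_Component.connected (with_proj G)"
    and S: "S \<subseteq> pverts G" "S \<noteq> {}" and closed: "\<And>u x. u \<in> S \<Longrightarrow> (u, x) \<in> parcs G \<Longrightarrow> x \<in> S"
  shows "S = pverts G"
proof -
  interpret pair_graph G by fact
  have sym: "(x, u) \<in> parcs G" if "(u, x) \<in> parcs G" for u x
    using that pair_sym_arcs by (auto simp: symmetric_def dest: symD)
  have "mk_symmetric (with_proj G) = G"
    unfolding mk_symmetric_def using sym by (cases G) (auto simp: with_proj_def)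
  then have reach: "u \<rightarrow>\<^sup>*\<^bsub>with_proj G\<^esub> x" if "u \<in> pverts G" "x \<in> pverts G" for u x
    using conn that by (simp add: connected_def strongly_connected_def)
  obtain u where u: "u \<in> S" using S by blast
  have "x \<in> S" if "x \<in> pverts G" for x
  proof -
    have "u \<rightarrow>\<^sup>*\<^bsub>with_proj G\<^esub> x" using reach u S that by blast
    then show ?thesis by (induction rule: reachable_induct) (use u closed in auto)
  qed
  then show ?thesis using S by blast
qed

text \<open>
  The spine is a shortest path that contains all non-leaves. Its inner vertices have two neighbours on the path,
  and if it has more than one vertex then its ends are not leaves of the graph, for otherwise it could be shortened;
  so an end has a neighbour off the path, and this neighbour is a leaf. A chord of the path would close a cycle.
\<close>
lemma caterpillar_spine:
  assumes cat: "caterpillar G"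
  obtains v k h where "spine G v k h"
    "k = 1 \<or> {x \<in> pverts G - v ` {..<k}. h x = 0} \<noteq> {} \<and> {x \<in> pverts G - v ` {..<k}. h x = k - 1} \<noteq> {}"
proof -
  have G: "pair_graph G" and conn: "Digraph_Component.connected (with_proj G)"
    and acyclic: "\<And>p. \<not> undirected_cycle G p"
    using cat by (auto simp: caterpillar_def undirected_tree_def)
  interpret pair_graph G by (rule G)
  have sym: "(x, u) \<in> parcs G" if "(u, x) \<in> parcs G" for u x
    using that pair_sym_arcs by (auto simp: symmetric_def dest: symD)
  have wf: "u \<in> pverts G" "x \<in> pverts G" if "(u, x) \<in> parcs G" for u x
    using that in_arcsD1 in_arcsD2 by auto
  have irr: "(u, u) \<notin> parcs G" for u using pair_no_loops[of "(u, u)"] by auto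
  define good where "good p \<longleftrightarrow> vpath p (with_proj G) \<and> (\<forall>u\<in>pverts G. \<not> leaf G u \<longrightarrow> u \<in> set p)" for p
  obtain p where p: "good p" and min: "\<And>q. good q \<Longrightarrow> length p \<le> length q"
    using cat ex_has_least_nat[of good _ length] unfolding caterpillar_def good_def by metis
  define k where "k = length p"
  have vp: "p \<noteq> []" "set p \<subseteq> pverts G" "distinct p" "\<And>i. Suc i < k \<Longrightarrow> (p ! i, p ! Suc i) \<in> parcs G"
    and nonleaf: "\<And>u. u \<in> pverts G \<Longrightarrow> u \<notin> set p \<Longrightarrow> leaf G u"
    using p unfolding good_def vpath_def vwalk_iff k_def by auto
  have k: "0 < k" using vp(1) by (simp add: k_def)
  have set_p: "set p = (!) p ` {..<k}" unfolding k_def by (auto simp: set_conv_nth)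
  have inj: "inj_on ((!) p) {..<k}" unfolding k_def using vp(3) by (auto simp: inj_on_def nth_eq_iff_index_eq)
  have chord: "j \<le> Suc i" if "i < j" "j < k" "(p ! i, p ! j) \<in> parcs G" for i j
  proof (rule ccontr)
    assume "\<not> j \<le> Suc i"
    define q where "q = take (j - i + 1) (drop i p)"
    have len: "length q = j - i + 1" using that by (simp add: q_def k_def)
    have nth: "q ! l = p ! (i + l)" if "l \<le> j - i" for l
      using that \<open>j < k\<close> \<open>i < j\<close> by (simp add: q_def k_def)
    have "vpath q (with_proj G)" unfolding vpath_def vwalk_iff
    proof (intro conjI allI impI)
      show "q \<noteq> []" using len by auto
      show "set q \<subseteq> pverts G" using vp(2) unfolding q_def by (meson order_trans set_drop_subset set_take_subset)
      show "(q ! l, q ! Suc l) \<in> parcs G" if "Suc l < length q" for l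
        using that len nth[of l] nth[of "Suc l"] vp(4)[of "i + l"] \<open>j < k\<close> by simp
      show "distinct q" using vp(3) by (simp add: q_def)
    qed
    moreover have "last q = p ! j" "hd q = p ! i"
      using len nth[of "j - i"] nth[of 0] that by (auto simp: last_conv_nth hd_conv_nth simp flip: length_greater_0_conv)
    ultimately have "undirected_cycle G q"
      using len that \<open>\<not> j \<le> Suc i\<close> sym by (auto simp: undirected_cycle_def)
    then show False using acyclic by blast
  qed
  let ?L = "pverts G - (!) p ` {..<k}"
  have single: "\<exists>y. {z. (x, z) \<in> parcs G} = {y}" if "leaf G x" for x
    using that by (simp add: leaf_def out_degree_eq card_1_singleton_iff)
  have ex: "\<exists>i<k. {z. (x, z) \<in> parcs G} = {p ! i}" if x: "x \<in> ?L" for x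
  proof -
    have xl: "leaf G x" using nonleaf x set_p by auto
    obtain y where y: "{z. (x, z) \<in> parcs G} = {y}" using single[OF xl] by blast
    then have xy: "(x, y) \<in> parcs G" by auto
    have "y \<in> set p"
    proof (rule ccontr)
      assume "y \<notin> set p"
      then obtain z where z: "{z. (y, z) \<in> parcs G} = {z}" using single nonleaf wf(2)[OF xy] by blast
      then have "z = x" using sym[OF xy] by auto
      then have "{x, y} = pverts G"
        using y z xy wf[OF xy] by (intro connected_closed_eq[OF G conn]) auto
      then have "p ! 0 \<in> {x, y}" using vp(2) k nth_mem unfolding k_def by blast
      then show False using \<open>y \<notin> set p\<close> x k set_p by auto
    qed
    then show ?thesis using y set_p by auto
  qed
  define h where "h x = (SOME i. i < k \<and> {z. (x, z) \<in> parcs G} = {p ! i})" for x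
  have h: "h x < k" "{z. (x, z) \<in> parcs G} = {p ! h x}" if "x \<in> ?L" for x
    using someI_ex[OF ex[OF that]] by (auto simp: h_def)
  have sp: "spine G ((!) p) k h"
  proof
    show "finite (pverts G)" by simp
    show "(!) p ` {..<k} \<subseteq> pverts G" using vp(2) set_p by simp
    show "parcs G = {(p ! i, p ! Suc i) |i. Suc i < k} \<union> {(p ! Suc i, p ! i) |i. Suc i < k} \<union>
        {(x, p ! h x) |x. x \<in> ?L} \<union> {(p ! h x, x) |x. x \<in> ?L}" (is "_ = ?R")
    proof (rule set_eqI, clarify)
      fix a b
      show "(a, b) \<in> parcs G \<longleftrightarrow> (a, b) \<in> ?R"
      proof
        assume ab: "(a, b) \<in> parcs G"
        consider "a \<in> ?L" | "b \<in> ?L" | i j where "a = p ! i" "b = p ! j" "i < k" "j < k" using wf[OF ab] by auto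
        then show "(a, b) \<in> ?R"
        proof cases
          case 1 then have "b = p ! h a" using h(2) ab by blast
          then show ?thesis using 1 by blast
        next
          case 2 then have "a = p ! h b" using h(2) sym[OF ab] by blast
          then show ?thesis using 2 by blast
        next
          case 3
          then consider "i < j" | "j < i" using ab irr by (metis nat_neq_iff)
          then show ?thesis
          proof cases
            case 1 then have "j = Suc i" using chord[of i j] 3 ab by simp
            then show ?thesis using 3 by blast
          next
            case 2 then have "i = Suc j" using chord[of j i] 3 sym[OF ab] by simp
            then show ?thesis using 3 by blast
          qed
        qed
      next
        assume "(a, b) \<in> ?R"
        then show "(a, b) \<in> parcs G" using vp(4) sym h(2) by blast
      qed
    qed
  qed (use inj k h in auto)
  have end_nonleaf: "\<not> leaf G (p ! 0)" "\<not> leaf G (p ! (k - 1))" if "1 < k"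
  proof -
    have sub: "good q \<Longrightarrow> \<not> length q < k" for q using min[of q] by (simp add: k_def)
    have nt: "(tl p) ! i = p ! Suc i" if "Suc i < k" for i using that by (simp add: nth_tl k_def)
    have nb: "(butlast p) ! i = p ! i" if "Suc i < k" for i using that by (simp add: nth_butlast k_def)
    show "\<not> leaf G (p ! 0)"
    proof
      assume l: "leaf G (p ! 0)"
      have "good (tl p)" unfolding good_def vpath_def vwalk_iff
      proof (intro conjI allI impI ballI)
        show "tl p \<noteq> []" using that by (cases p) (auto simp: k_def)
        show "set (tl p) \<subseteq> pverts G" using vp(1,2) by (auto dest: list.set_sel)
        show "distinct (tl p)" using vp(3) by (rule distinct_tl)
        show "(tl p ! i, tl p ! Suc i) \<in> parcs G" if "Suc i < length (tl p)" for i
          using that nt[of i] nt[of "Suc i"] vp(4)[of "Suc i"] by (simp add: k_def)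
        show "u \<in> set (tl p)" if "u \<in> pverts G" "\<not> leaf G u" for u
          using nonleaf that l vp(1) by (cases p) auto
      qed
      then show False using sub[of "tl p"] that k by (simp add: k_def)
    qed
    show "\<not> leaf G (p ! (k - 1))"
    proof
      assume l: "leaf G (p ! (k - 1))"
      have "good (butlast p)" unfolding good_def vpath_def vwalk_iff
      proof (intro conjI allI impI ballI)
        show "butlast p \<noteq> []" using that by (cases p rule: rev_cases) (auto simp: k_def)
        show "set (butlast p) \<subseteq> pverts G" using vp(2) by (auto dest: in_set_butlastD)
        show "distinct (butlast p)" using vp(3) by (rule distinct_butlast)
        show "(butlast p ! i, butlast p ! Suc i) \<in> parcs G" if "Suc i < length (butlast p)" for i
          using that nb[of i] nb[of "Suc i"] vp(4)[of i] by (simp add: k_def)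
        show "u \<in> set (butlast p)" if "u \<in> pverts G" "\<not> leaf G u" for u
          using nonleaf[of u] that l vp(1) by (cases p rule: rev_cases) (auto simp: k_def nth_append)
      qed
      then show False using sub[of "butlast p"] that k by (simp add: k_def)
    qed
  qed
  have has: "{x \<in> ?L. h x = i} \<noteq> {}"
    if "i < k" "\<not> leaf G (p ! i)" "(p ! i, p ! j) \<in> parcs G" "\<And>l. l < k \<Longrightarrow> (p ! i, p ! l) \<in> parcs G \<Longrightarrow> l = j" for i j
  proof -
    note hyps = that
    have "p ! i \<in> pverts G" using vp(2) hyps(1) nth_mem unfolding k_def by blast
    then have "{z. (p ! i, z) \<in> parcs G} \<noteq> {p ! j}"
      using hyps(2) by (auto simp: leaf_def out_degree_eq)
    then obtain x where x: "(p ! i, x) \<in> parcs G" "x \<noteq> p ! j" using hyps(3) by blast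
    have "x \<notin> (!) p ` {..<k}" using x hyps(4) by blast
    then have xL: "x \<in> ?L" using wf(2)[OF x(1)] by simp
    have "p ! i = p ! h x" using h(2)[OF xL] sym[OF x(1)] by blast
    then have "i = h x" using inj hyps(1) h(1)[OF xL] by (auto dest: inj_onD)
    then show ?thesis using xL by blast
  qed
  have "{x \<in> ?L. h x = 0} \<noteq> {} \<and> {x \<in> ?L. h x = k - 1} \<noteq> {}" if k1: "1 < k"
  proof
    show "{x \<in> ?L. h x = 0} \<noteq> {}"
    proof (rule has[OF _ end_nonleaf(1)[OF k1], of 1])
      show "(p ! 0, p ! 1) \<in> parcs G" using vp(4)[of 0] k1 by simp
      show "l = 1" if "l < k" "(p ! 0, p ! l) \<in> parcs G" for l
        using chord[of 0 l] that irr by (cases l) auto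
    qed (use k1 in auto)
    show "{x \<in> ?L. h x = k - 1} \<noteq> {}"
    proof (rule has[OF _ end_nonleaf(2)[OF k1], of "k - 2"])
      show "(p ! (k - 1), p ! (k - 2)) \<in> parcs G"
        using sym[OF vp(4)[of "k - 2"]] k1 by (simp add: numeral_2_eq_2 Suc_diff_Suc)
      show "l = k - 2" if "l < k" "(p ! (k - 1), p ! l) \<in> parcs G" for l
      proof -
        have "l \<noteq> k - 1" using that(2) irr by auto
        then have "k - 1 \<le> Suc l" using chord[of l "k - 1"] that(1) sym[OF that(2)] by simp
        then show ?thesis using \<open>l \<noteq> k - 1\<close> that(1) by linarith
      qed
    qed (use k1 in auto)
  qed
  moreover have "k = 1 \<or> 1 < k" using k by linarith
  ultimately show ?thesis using that[OF sp] by blast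
qed

lemma image_reverse: "(\<lambda>i. v (k - 1 - i)) ` {..<k} = v ` {..<k::nat}"
proof -
  have "(\<lambda>i. k - 1 - i) ` {..<k} = {..<k}"
  proof (intro equalityI subsetI)
    fix x assume "x \<in> {..<k}"
    then show "x \<in> (\<lambda>i. k - 1 - i) ` {..<k}" by (intro image_eqI[of _ _ "k - 1 - x"]) auto
  qed auto
  then show ?thesis by (metis image_image)
qed

text \<open>
  The program may find either end of the spine first.
\<close>
lemma spine_reverse:
  assumes "spine G v k h"
  shows "spine G (\<lambda>i. v (k - 1 - i)) k (\<lambda>x. k - 1 - h x)"
proof -
  interpret spine G v k h "pverts G - v ` {..<k}" "\<lambda>i. card {x \<in> pverts G - v ` {..<k}. h x = i}"
    using assms .
  note img = image_reverse[of v k]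
  show ?thesis
  proof
    show "finite (pverts G)" by (rule finite_verts)
    show "inj_on (\<lambda>i. v (k - 1 - i)) {..<k}" by (intro inj_onI) (auto simp: v_eq_iff)
    show "(\<lambda>i. v (k - 1 - i)) ` {..<k} \<subseteq> pverts G" using v_verts img by simp
    show "0 < k" by (rule k_pos)
    show "k - 1 - h x < k" for x using k_pos by simp
    have A: "{(v i, v (Suc i)) |i. Suc i < k} = {(v (k - 1 - Suc i), v (k - 1 - i)) |i. Suc i < k}"
     and B: "{(v (Suc i), v i) |i. Suc i < k} = {(v (k - 1 - i), v (k - 1 - Suc i)) |i. Suc i < k}"
    proof -
      have *: "\<exists>j. Suc j < k \<and> i = k - 1 - Suc j \<and> Suc i = k - 1 - j" if "Suc i < k" for i
        using that by (intro exI[of _ "k - 2 - i"]) auto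
      have **: "k - 1 - i = Suc (k - 1 - Suc i) \<and> Suc (k - 1 - Suc i) < k" if "Suc i < k" for i using that by auto
      have swap: "{e i (Suc i) |i. Suc i < k} = {e (k - 1 - Suc i) (k - 1 - i) |i. Suc i < k}" for e :: "nat \<Rightarrow> nat \<Rightarrow> 'a \<times> 'a"
      proof (rule set_eqI, rule iffI)
        fix y assume "y \<in> {e i (Suc i) |i. Suc i < k}"
        then obtain i where i: "y = e i (Suc i)" "Suc i < k" by blast
        obtain j where j: "Suc j < k" "i = k - 1 - Suc j" "Suc i = k - 1 - j" using *[OF i(2)] by blast
        have "y = e (k - 1 - Suc j) (k - 1 - j)" unfolding i(1) j(3) unfolding j(2) ..
        then show "y \<in> {e (k - 1 - Suc i) (k - 1 - i) |i. Suc i < k}" using j(1) by blast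
      next
        fix y assume "y \<in> {e (k - 1 - Suc i) (k - 1 - i) |i. Suc i < k}"
        then obtain i where i: "y = e (k - 1 - Suc i) (k - 1 - i)" "Suc i < k" by blast
        have "y = e (k - 1 - Suc i) (Suc (k - 1 - Suc i))" using i(1) **[OF i(2)] by simp
        then show "y \<in> {e i (Suc i) |i. Suc i < k}" using **[OF i(2)] by blast
      qed
      show "{(v i, v (Suc i)) |i. Suc i < k} = {(v (k - 1 - Suc i), v (k - 1 - i)) |i. Suc i < k}"
        by (rule swap)
      show "{(v (Suc i), v i) |i. Suc i < k} = {(v (k - 1 - i), v (k - 1 - Suc i)) |i. Suc i < k}"
        by (rule swap[of "\<lambda>i j. (v j, v i)"])
    qed
    have hh: "k - 1 - (k - 1 - h x) = h x" if "x \<in> pverts G - v ` {..<k}" for x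
      using host[OF that] by simp
    have C: "{(x, v (k - 1 - (k - 1 - h x))) |x. x \<in> pverts G - v ` {..<k}} = {(x, v (h x)) |x. x \<in> pverts G - v ` {..<k}}"
      "{(v (k - 1 - (k - 1 - h x)), x) |x. x \<in> pverts G - v ` {..<k}} = {(v (h x), x) |x. x \<in> pverts G - v ` {..<k}}"
      using hh by (metis (no_types, lifting))+
    show "parcs G = {(v (k - 1 - i), v (k - 1 - Suc i)) |i. Suc i < k} \<union> {(v (k - 1 - Suc i), v (k - 1 - i)) |i. Suc i < k} \<union>
        {(x, v (k - 1 - (k - 1 - h x))) |x. x \<in> pverts G - (\<lambda>i. v (k - 1 - i)) ` {..<k}} \<union>
        {(v (k - 1 - (k - 1 - h x)), x) |x. x \<in> pverts G - (\<lambda>i. v (k - 1 - i)) ` {..<k}}"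
      unfolding img C A[symmetric] B[symmetric] using arcs by blast
  qed
qed


section \<open>Reasoning about programs\<close>

text \<open>
  \<open>T\<close> is the time that is still available, and the postcondition receives what is left of it; time bounds are
  thus ordinary parts of the assertions. A state that fits into the words is presupposed and handed on, so that
  only instructions that can create large numbers have to be checked.
\<close>
definition wp :: "nat \<Rightarrow> program \<Rightarrow> (state \<Rightarrow> nat \<Rightarrow> bool) \<Rightarrow> state \<Rightarrow> nat \<Rightarrow> bool" where
  "wp w P Q s T \<longleftrightarrow>
     (fits w s \<longrightarrow> (\<exists>t s'. exec w P s t s' \<and> fits w s' \<and> t \<le> T \<and> Q s' (T - t)))"

text \<open>
  Subtraction is truncated and the other instructions copy words, so none of these can overflow.
\<close>
fun safe :: "nat \<Rightarrow> instr \<Rightarrow> state \<Rightarrow> bool" where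
  "safe w (Const r x) s \<longleftrightarrow> x < 2 ^ w"
| "safe w (Add r a b) s \<longleftrightarrow> fst s a + fst s b < 2 ^ w"
| "safe w _ s \<longleftrightarrow> True"

lemma fits_step: "fits w s \<Longrightarrow> safe w i s \<Longrightarrow> fits w (step i s)"
proof -
  assume f: "fits w s" and s: "safe w i s"
  obtain R M where [simp]: "s = (R, M)" by (cases s)
  have "R r < 2 ^ w" "M a < 2 ^ w" for r a using f by (auto simp: fits_def)
  moreover then have "R a - R b < 2 ^ w" for a b by (meson diff_le_self le_less_trans)
  ultimately show ?thesis using s by (cases i) (auto simp: fits_def)
qed

text \<open>
  Verification conditions for straight-line code and branches; a loop is left to \<open>wp_Loop\<close>.
\<close>
primrec vc :: "nat \<Rightarrow> program \<Rightarrow> (state \<Rightarrow> nat \<Rightarrow> bool) \<Rightarrow> state \<Rightarrow> nat \<Rightarrow> bool" where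
  "vc w (Instr i) = (\<lambda>Q s T. 1 \<le> T \<and> safe w i s \<and> Q (step i s) (T - 1))"
| "vc w (Seq P P') = (\<lambda>Q. vc w P (vc w P' Q))"
| "vc w (Cond b P P') = (\<lambda>Q s T. 1 \<le> T \<and> (if holds b s then vc w P Q s (T - 1) else vc w P' Q s (T - 1)))"
| "vc w (Loop b P) = wp w (Loop b P)"

lemma wp_mono: "wp w P Q s T \<Longrightarrow> (\<And>s T. fits w s \<Longrightarrow> Q s T \<Longrightarrow> Q' s T) \<Longrightarrow> wp w P Q' s T"
  unfolding wp_def by blast

lemma wp_Seq: "wp w P (wp w P' Q) s T \<Longrightarrow> wp w (Seq P P') Q s T"
  unfolding wp_def
proof
  assume 1: "fits w s \<longrightarrow> (\<exists>t s'. exec w P s t s' \<and> fits w s' \<and> t \<le> T \<and> (fits w s' \<longrightarrow>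
    (\<exists>t' s''. exec w P' s' t' s'' \<and> fits w s'' \<and> t' \<le> T - t \<and> Q s'' (T - t - t'))))" and "fits w s"
  then obtain t s' t' s'' where *: "exec w P s t s'" "t \<le> T" "exec w P' s' t' s''" "fits w s''" "t' \<le> T - t" "Q s'' (T - t - t')"
    by blast
  then have "exec w (Seq P P') s (t + t') s''" by (intro exec.Seq)
  then show "\<exists>t s'. exec w (Seq P P') s t s' \<and> fits w s' \<and> t \<le> T \<and> Q s' (T - t)"
    using * by (intro exI[of _ "t + t'"] exI[of _ s'']) auto
qed

lemma vc_sound: "vc w P Q s T \<Longrightarrow> wp w P Q s T"
proof (induction P arbitrary: Q s T)
  case (Instr i)
  then show ?case unfolding wp_def using exec.Instr[OF fits_step] fits_step
    by (intro impI exI[of _ 1] exI[of _ "step i s"]) auto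
next
  case (Seq P P')
  have "wp w P (vc w P' Q) s T" using Seq by simp
  then show ?case by (intro wp_Seq) (rule wp_mono, assumption, rule Seq.IH(2))
next
  case (Cond b P P')
  show ?case
  proof (cases "holds b s")
    case True
    then have "wp w P Q s (T - 1)" "1 \<le> T" using Cond by auto
    then show ?thesis unfolding wp_def using exec.CondTrue[OF True]
      by (metis (no_types, lifting) Nat.diff_diff_right add.commute diff_diff_left le_diff_conv2)
  next
    case False
    then have "wp w P' Q s (T - 1)" "1 \<le> T" using Cond by auto
    then show ?thesis unfolding wp_def using exec.CondFalse[OF False]
      by (metis (no_types, lifting) Nat.diff_diff_right add.commute diff_diff_left le_diff_conv2)
  qed
qed auto

text \<open>
  The available time decreases in every round, so it serves as the variant of the loop.
\<close>
lemma wp_Loop: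
  assumes "I s T"
    and body: "\<And>s T. I s T \<Longrightarrow> fits w s \<Longrightarrow> holds b s \<Longrightarrow> 1 \<le> T \<and> vc w P I s (T - 1)"
    and exit: "\<And>s T. I s T \<Longrightarrow> fits w s \<Longrightarrow> \<not> holds b s \<Longrightarrow> 1 \<le> T \<and> Q s (T - 1)"
  shows "wp w (Loop b P) Q s T"
  unfolding wp_def
proof
  assume "fits w s"
  then show "\<exists>t s'. exec w (Loop b P) s t s' \<and> fits w s' \<and> t \<le> T \<and> Q s' (T - t)"
    using assms(1)
  proof (induction T arbitrary: s rule: less_induct)
    case (less T)
    show ?case
    proof (cases "holds b s")
      case False
      then show ?thesis using exit[OF less.prems(2,1) False] exec.LoopFalse[OF False] less.prems(1) by blast
    next
      case True
      have T: "1 \<le> T" and "vc w P I s (T - 1)" using body[OF less.prems(2,1) True] by auto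
      then obtain t s' where 1: "exec w P s t s'" "fits w s'" "t \<le> T - 1" "I s' (T - 1 - t)"
        using vc_sound less.prems(1) unfolding wp_def by blast
      have "T - 1 - t < T" using T by simp
      from less.IH[OF this 1(2,4)] obtain t' s'' where
        2: "exec w (Loop b P) s' t' s''" "fits w s''" "t' \<le> T - 1 - t" "Q s'' (T - 1 - t - t')" by blast
      have "exec w (Loop b P) s (1 + t + t') s''" using exec.LoopTrue[OF True 1(1) 2(1)] .
      moreover have "T - (1 + t + t') = T - 1 - t - t'" "1 + t + t' \<le> T" using 1 2 T by auto
      ultimately show ?thesis using 2 by metis
    qed
  qed
qed

fun block :: "instr list \<Rightarrow> program" where
  "block [] = Instr (Move 0 0)"
| "block [i] = Instr i"
| "block (i # j # is) = Seq (Instr i) (block (j # is))"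

fun safe_run :: "nat \<Rightarrow> instr list \<Rightarrow> state \<Rightarrow> bool" where
  "safe_run w [] s \<longleftrightarrow> True"
| "safe_run w (i # is) s \<longleftrightarrow> safe w i s \<and> safe_run w is (step i s)"

lemma vc_block [simp]:
  "vc w (block is) Q s T \<longleftrightarrow>
     max 1 (length is) \<le> T \<and> safe_run w is s \<and> Q (fold step is s) (T - max 1 (length is))"
proof (induction "is" arbitrary: s T rule: block.induct)
  case 1
  obtain R M where "s = (R, M)" by (cases s)
  then show ?case by simp
next
  case (3 i j "is")
  show ?case by (cases T) (auto simp: 3)
qed simp

abbreviation skip :: program where "skip \<equiv> block []"

lemma quota_add_2: "quota (Suc (Suc N)) = quota N + N + 2"
proof -
  have "(N + 2) div 2 + (Suc N + 2) div 2 = N + 2" by presburger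
  then show ?thesis by simp
qed

lemma quota_bounds: "N * (N + 2) \<le> 4 * quota N \<and> quota N \<le> N * N"
proof (induction N rule: induct_nat_012)
  case (ge2 N)
  then show ?case unfolding quota_add_2 by (auto simp: algebra_simps)
qed auto

section \<open>The program\<close>

text \<open>
  The registers \<open>r_deg\<close>, \<open>r_lvs\<close>, \<open>r_sum\<close> and \<open>r_row\<close> hold the base addresses of four arrays behind the edge
  list: the degrees, the numbers of leaf neighbours and the sums of the names of all other neighbours, each
  indexed by vertices, and finally the leaf numbers along the spine.
\<close>
abbreviation (input) r_n :: nat where "r_n \<equiv> 0"
abbreviation (input) r_m :: nat where "r_m \<equiv> 1"
abbreviation (input) r_one :: nat where "r_one \<equiv> 2"
abbreviation (input) r_zero :: nat where "r_zero \<equiv> 3"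
abbreviation (input) r_deg :: nat where "r_deg \<equiv> 4"
abbreviation (input) r_lvs :: nat where "r_lvs \<equiv> 5"
abbreviation (input) r_sum :: nat where "r_sum \<equiv> 6"
abbreviation (input) r_row :: nat where "r_row \<equiv> 7"
abbreviation (input) r_i :: nat where "r_i \<equiv> 8"
abbreviation (input) r_u :: nat where "r_u \<equiv> 9"
abbreviation (input) r_x :: nat where "r_x \<equiv> 10"
abbreviation (input) r_a :: nat where "r_a \<equiv> 11"
abbreviation (input) r_t :: nat where "r_t \<equiv> 12"
abbreviation (input) r_l :: nat where "r_l \<equiv> 13"
abbreviation (input) r_k :: nat where "r_k \<equiv> 14"
abbreviation (input) r_cur :: nat where "r_cur \<equiv> 15"
abbreviation (input) r_prev :: nat where "r_prev \<equiv> 16"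
abbreviation (input) r_p :: nat where "r_p \<equiv> 17"
abbreviation (input) r_s :: nat where "r_s \<equiv> 18"
abbreviation (input) r_j :: nat where "r_j \<equiv> 19"
abbreviation (input) r_acc :: nat where "r_acc \<equiv> 20"
abbreviation (input) r_q :: nat where "r_q \<equiv> 21"
abbreviation (input) r_d :: nat where "r_d \<equiv> 22"
abbreviation (input) r_e :: nat where "r_e \<equiv> 23"
abbreviation (input) r_bad :: nat where "r_bad \<equiv> 24"
abbreviation (input) r_next :: nat where "r_next \<equiv> 25"

definition lay_out :: program where
  "lay_out = block [Const r_one 1, Const r_zero 0, Add r_deg r_m r_m, Add r_lvs r_deg r_n,
     Add r_sum r_lvs r_n, Add r_row r_sum r_n, Move r_i r_zero]"

definition bump :: "nat \<Rightarrow> nat \<Rightarrow> nat \<Rightarrow> program" where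
  "bump base r d = block [Add r_a base r, Load r_t r_a, Add r_t r_t d, Store r_a r_t]"

definition fetch_edge :: program where
  "fetch_edge = block [Load r_u r_i, Add r_a r_i r_one, Load r_x r_a]"

text \<open>
  The bound of this loop and the next one is \<open>r_deg\<close>, since the degrees start where the edge list ends.
\<close>
definition count_degrees :: program where
  "count_degrees = Loop (Less r_i r_deg)
     (Seq fetch_edge (Seq (bump r_deg r_u r_one) (Seq (bump r_deg r_x r_one)
       (block [Add r_i r_i r_one, Add r_i r_i r_one]))))"

definition note_neighbour :: "nat \<Rightarrow> nat \<Rightarrow> program" where
  "note_neighbour u x = Seq (block [Add r_a r_deg x, Load r_t r_a])
     (Cond (Equal r_t r_one) (bump r_lvs u r_one) (bump r_sum u x))"

definition scan_neighbours :: program where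
  "scan_neighbours = Loop (Less r_i r_deg)
     (Seq fetch_edge (Seq (note_neighbour r_u r_x) (Seq (note_neighbour r_x r_u)
       (block [Add r_i r_i r_one, Add r_i r_i r_one]))))"

text \<open>
  Counts the vertices of degree at least \<open>2\<close>, and remembers one with at most one such neighbour.
\<close>
definition find_end :: program where
  "find_end = Loop (Less r_i r_n)
     (Seq (block [Add r_a r_deg r_i, Load r_t r_a])
       (Seq (Cond (Less r_one r_t)
          (Seq (block [Add r_k r_k r_one, Add r_a r_lvs r_i, Load r_l r_a, Sub r_t r_t r_l])
             (Cond (Leq r_t r_one) (block [Move r_cur r_i]) skip))
          skip)
        (block [Add r_i r_i r_one])))"

text \<open>
  A spine vertex has at most two spine neighbours, so the sum of their names minus the name of the predecessor is
  the name of the successor. At the first vertex \<open>0\<close> is subtracted.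
\<close>
definition walk_spine :: program where
  "walk_spine = Loop (Less r_i r_k)
     (block [Add r_a r_lvs r_cur, Load r_t r_a, Add r_a r_row r_i, Store r_a r_t,
        Add r_a r_sum r_cur, Load r_t r_a, Sub r_t r_t r_prev, Move r_prev r_cur, Move r_cur r_t,
        Add r_i r_i r_one])"

text \<open>
  The left end \<open>r_j\<close> runs from \<open>s\<close> down to \<open>p\<close>, while \<open>r_acc\<close> and \<open>r_q\<close> hold the number of leaves in the
  interval and its quota. The pair \<open>r_d\<close>, \<open>r_e\<close> holds the next two increments of the quota.
\<close>
definition test_intervals :: program where
  "test_intervals = Loop (Less r_p r_j)
     (Seq (block [Sub r_j r_j r_one, Add r_a r_row r_j, Load r_t r_a, Add r_acc r_acc r_t,
        Add r_q r_q r_d, Add r_t r_d r_one, Move r_d r_e, Move r_e r_t])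
       (Cond (Less r_acc r_q) (block [Move r_bad r_one]) skip))"

text \<open>
  The greedy partition, with the number of segments in \<open>r_n\<close> and \<open>s + 1\<close> in \<open>r_next\<close>. Behind the leaf numbers of
  the spine the memory is still \<open>0\<close>, so the look-up at the next anchor is harmless.
\<close>
definition cut :: program where
  "cut = Loop (Less r_next r_k)
     (Seq (block [Move r_j r_next, Move r_acc r_zero, Move r_q r_zero, Move r_d r_one, Move r_e r_one,
         Move r_bad r_zero])
      (Seq test_intervals
        (Cond (Equal r_bad r_one)
          (Seq (block [Add r_n r_n r_one, Add r_a r_row r_next, Load r_t r_a, Move r_s r_next])
          (Seq (Cond (Equal r_t r_zero) (block [Add r_s r_s r_one]) skip)
          (Seq (block [Add r_a r_row r_s, Load r_t r_a, Add r_s r_s r_one])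
          (Seq (Cond (Equal r_t r_zero) (block [Add r_s r_s r_one]) skip)
            (block [Move r_p r_s, Add r_next r_s r_one])))))
          (block [Move r_s r_next, Add r_next r_next r_one]))))"

definition acquisition_program :: program where
  "acquisition_program =
     Seq lay_out
    (Seq count_degrees
    (Seq (block [Move r_i r_zero])
    (Seq scan_neighbours
    (Seq (block [Move r_i r_zero, Move r_k r_zero, Move r_cur r_zero])
    (Seq find_end
    (Seq (block [Move r_i r_zero, Move r_prev r_zero])
    (Seq walk_spine
    (Seq (block [Move r_n r_one, Move r_p r_one, Move r_s r_one, Add r_next r_one r_one])
      cut))))))))"

section \<open>Correctness and running time of the program\<close>

text \<open>
  The largest numbers that occur are sums of names of neighbours and quotas, which are quadratic in \<open>n\<close>.
\<close>
locale run =
  fixes n :: nat and es :: "(nat \<times> nat) list" and w :: nat and inp :: "nat \<Rightarrow> nat" and m :: nat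
  defines "inp \<equiv> snd (input_state n es)" and "m \<equiv> length es"
  assumes word: "16 * (n + 1) ^ 2 < 2 ^ w" and m_le: "m \<le> n"
    and ends: "(u, x) \<in> set es \<Longrightarrow> u < n \<and> x < n \<and> u \<noteq> x"
begin

definition mem :: "(nat \<Rightarrow> nat) \<Rightarrow> (nat \<Rightarrow> nat) \<Rightarrow> (nat \<Rightarrow> nat) \<Rightarrow> (nat \<Rightarrow> nat) \<Rightarrow> nat \<Rightarrow> nat" where
  "mem D L S C a =
     (if a < 2 * m then inp a
      else if a < 2 * m + n then D (a - 2 * m)
      else if a < 2 * m + 2 * n then L (a - (2 * m + n))
      else if a < 2 * m + 3 * n then S (a - (2 * m + 2 * n))
      else C (a - (2 * m + 3 * n)))"

definition fixed :: "(nat \<Rightarrow> nat) \<Rightarrow> bool" where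
  "fixed R \<longleftrightarrow> R r_one = 1 \<and> R r_zero = 0 \<and> R r_deg = 2 * m \<and> R r_lvs = 2 * m + n \<and>
     R r_sum = 2 * m + 2 * n \<and> R r_row = 2 * m + 3 * n"

definition U :: "nat \<Rightarrow> nat" where "U e = fst (es ! e)"
definition X :: "nat \<Rightarrow> nat" where "X e = snd (es ! e)"

text \<open>
  The sum of \<open>g\<close> over the neighbours of \<open>u\<close> along the first \<open>i\<close> edges. All three vertex arrays have this form.
\<close>
definition acc :: "(nat \<Rightarrow> nat) \<Rightarrow> nat \<Rightarrow> nat \<Rightarrow> nat" where
  "acc g i u = (\<Sum>e<i. (if U e = u then g (X e) else 0) + (if X e = u then g (U e) else 0))"

lemma edge_cells: "e < m \<Longrightarrow> mem D L S C (2 * e) = U e" "e < m \<Longrightarrow> mem D L S C (Suc (2 * e)) = X e"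
  by (auto simp: mem_def inp_def input_state_def m_def U_def X_def)

lemma mem_cells [simp]:
  "u < n \<Longrightarrow> mem D L S C (2 * m + u) = D u"
  "u < n \<Longrightarrow> mem D L S C (2 * m + n + u) = L u"
  "u < n \<Longrightarrow> mem D L S C (2 * m + 2 * n + u) = S u"
  "mem D L S C (2 * m + 3 * n + i) = C i"
  by (auto simp: mem_def)

lemma mem_Suc: "mem D L S C (Suc (2 * m + 3 * n + i)) = C (Suc i)"
  "mem D L S C (Suc (Suc (2 * m + 3 * n + i))) = C (Suc (Suc i))"
  using mem_cells(4)[of D L S C "Suc i"] mem_cells(4)[of D L S C "Suc (Suc i)"] by simp_all

lemma mem_update [simp]:
  "u < n \<Longrightarrow> (mem D L S C)(2 * m + u := y) = mem (D(u := y)) L S C"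
  "u < n \<Longrightarrow> (mem D L S C)(2 * m + n + u := y) = mem D (L(u := y)) S C"
  "u < n \<Longrightarrow> (mem D L S C)(2 * m + 2 * n + u := y) = mem D L (S(u := y)) C"
  "(mem D L S C)(2 * m + 3 * n + i := y) = mem D L S (C(i := y))"
  by (auto simp: mem_def fun_eq_iff)

lemma ends_less: "e < m \<Longrightarrow> U e < n" "e < m \<Longrightarrow> X e < n"
  using ends[of "U e" "X e"] by (auto simp: U_def X_def m_def)

lemma ends_neq: "e < m \<Longrightarrow> U e \<noteq> X e"
  using ends[of "U e" "X e"] by (auto simp: U_def X_def m_def)

lemma acc_Suc:
  "e < m \<Longrightarrow> acc g (Suc e) = (acc g e)(U e := acc g e (U e) + g (X e), X e := acc g e (X e) + g (U e))"
  using ends_neq[of e] by (auto simp: acc_def fun_eq_iff)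

lemma acc_0 [simp]: "acc g 0 = (\<lambda>_. 0)"
  by (simp add: acc_def fun_eq_iff)

lemma acc_le:
  assumes "\<And>x. x < n \<Longrightarrow> g x \<le> b" "i \<le> m"
  shows "acc g i u \<le> 2 * i * b"
proof -
  have "acc g i u \<le> (\<Sum>e<i. 2 * b)" unfolding acc_def
  proof (intro sum_mono)
    fix e assume "e \<in> {..<i}"
    then show "(if U e = u then g (X e) else 0) + (if X e = u then g (U e) else 0) \<le> 2 * b"
      using assms(1)[of "X e"] assms(1)[of "U e"] ends_less[of e] assms(2) by auto
  qed
  then show ?thesis by simp
qed

lemma below_word: "x \<le> 16 * n + 16 \<Longrightarrow> x < 2 ^ w"
  using word by (simp add: power2_eq_square algebra_simps)

lemma count_degrees:
  assumes R: "fixed R" "R r_n = n" "R r_i = 0" and T: "20 * m + 1 + T1 \<le> T"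
    and Q: "\<And>R T. fixed R \<Longrightarrow> R r_n = n \<Longrightarrow> T1 \<le> T \<Longrightarrow> Q (R, mem (acc (\<lambda>_. 1) m) L S C) T"
  shows "wp w count_degrees Q (R, mem (\<lambda>_. 0) L S C) T"
  unfolding count_degrees_def
proof (rule wp_Loop)
  let ?I = "\<lambda>s T. \<exists>e. snd s = mem (acc (\<lambda>_. 1) e) L S C \<and> fixed (fst s) \<and> fst s r_n = n \<and>
     fst s r_i = 2 * e \<and> e \<le> m \<and> 20 * (m - e) + 1 + T1 \<le> T"
  \<comment> \<open>A round takes less than 20 steps; here and below the constants are rounded up generously.\<close>
  show "?I (R, mem (\<lambda>_. 0) L S C) T" using R T by (intro exI[of _ 0]) auto
  fix s T assume I: "?I s T"
  then obtain e R where s: "s = (R, mem (acc (\<lambda>_. 1) e) L S C)" and R: "fixed R" "R r_n = n" "R r_i = 2 * e" and e: "e \<le> m"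
    and T: "20 * (m - e) + 1 + T1 \<le> T" by (metis prod.collapse)
  {
    assume "\<not> holds (Less r_i r_deg) s"
    then have "e = m" using s R e by (auto simp: fixed_def)
    then show "1 \<le> T \<and> Q s (T - 1)" using s T Q[OF R(1,2)] by auto
  next
    assume "holds (Less r_i r_deg) s"
    then have em: "e < m" using s R e by (auto simp: fixed_def)
    obtain T' where T': "T = 21 + T'" "20 * (m - Suc e) + T1 \<le> T'"
    proof
      show "T = 21 + (T - 21)" "20 * (m - Suc e) + T1 \<le> T - 21" using T em by (simp_all add: Suc_diff_Suc[symmetric])
    qed
    have a: "acc (\<lambda>_. 1) e u \<le> 2 * n" for u
      using acc_le[of "\<lambda>_. 1" 1 e u] em m_le by simp
    have "Suc (2 * e) < 2 ^ w" "2 * m + U e < 2 ^ w" "2 * m + X e < 2 ^ w" "Suc (Suc (2 * e)) < 2 ^ w"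
      "Suc (acc (\<lambda>_. 1) e u) < 2 ^ w" for u
      using em m_le ends_less[OF em] a[of u] by (auto intro!: below_word)
    moreover have "\<exists>e'. mem (acc (\<lambda>_. 1) (Suc e)) L S C = mem (acc (\<lambda>_. 1) e') L S C \<and> Suc (Suc (2 * e)) = 2 * e' \<and>
      e' \<le> m \<and> Suc (20 * (m - e') + T1) \<le> T' + 7"
      using em T' by (intro exI[of _ "Suc e"]) auto
    ultimately show "1 \<le> T \<and> vc w (Seq fetch_edge (Seq (bump r_deg r_u r_one) (Seq (bump r_deg r_x r_one)
       (block [Add r_i r_i r_one, Add r_i r_i r_one])))) ?I s (T - 1)"
      using R em T'(1) ends_less[OF em] ends_neq[OF em]
      by (simp add: s fetch_edge_def bump_def fixed_def edge_cells acc_Suc)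
  }
qed

definition deg :: "nat \<Rightarrow> nat" where "deg = acc (\<lambda>_. 1) m"
definition lvs :: "nat \<Rightarrow> nat \<Rightarrow> nat" where "lvs = acc (\<lambda>x. if deg x = 1 then 1 else 0)"
definition nbs :: "nat \<Rightarrow> nat \<Rightarrow> nat" where "nbs = acc (\<lambda>x. if deg x = 1 then 0 else x)"

lemma lvs_Suc: "e < m \<Longrightarrow> lvs (Suc e) =
   (let A = (if deg (X e) = 1 then (lvs e)(U e := lvs e (U e) + 1) else lvs e)
    in if deg (U e) = 1 then A(X e := lvs e (X e) + 1) else A)"
  using ends_neq[of e] by (auto simp: lvs_def acc_Suc fun_eq_iff Let_def)

lemma nbs_Suc: "e < m \<Longrightarrow> nbs (Suc e) =
   (let A = (if deg (X e) = 1 then nbs e else (nbs e)(U e := nbs e (U e) + X e))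
    in if deg (U e) = 1 then A else A(X e := nbs e (X e) + U e))"
  using ends_neq[of e] by (auto simp: nbs_def acc_Suc fun_eq_iff Let_def)

lemma scan_neighbours:
  assumes R: "fixed R" "R r_n = n" "R r_i = 0" and T: "30 * m + 1 + T1 \<le> T"
    and Q: "\<And>R T. fixed R \<Longrightarrow> R r_n = n \<Longrightarrow> T1 \<le> T \<Longrightarrow> Q (R, mem deg (lvs m) (nbs m) C) T"
  shows "wp w scan_neighbours Q (R, mem deg (\<lambda>_. 0) (\<lambda>_. 0) C) T"
  unfolding scan_neighbours_def
proof (rule wp_Loop)
  let ?I = "\<lambda>s T. \<exists>e. snd s = mem deg (lvs e) (nbs e) C \<and> fixed (fst s) \<and> fst s r_n = n \<and>
     fst s r_i = 2 * e \<and> e \<le> m \<and> 30 * (m - e) + 1 + T1 \<le> T"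
  show "?I (R, mem deg (\<lambda>_. 0) (\<lambda>_. 0) C) T"
    using R T by (intro exI[of _ 0]) (auto simp: lvs_def nbs_def)
  fix s T assume I: "?I s T"
  then obtain e R where s: "s = (R, mem deg (lvs e) (nbs e) C)" and R: "fixed R" "R r_n = n" "R r_i = 2 * e" and e: "e \<le> m"
    and T: "30 * (m - e) + 1 + T1 \<le> T" by (metis prod.collapse)
  {
    assume "\<not> holds (Less r_i r_deg) s"
    then have "e = m" using s R e by (auto simp: fixed_def)
    then show "1 \<le> T \<and> Q s (T - 1)" using s T Q[OF R(1,2)] by auto
  next
    assume "holds (Less r_i r_deg) s"
    then have em: "e < m" using s R e by (auto simp: fixed_def)
    obtain T' where T': "T = 31 + T'" "30 * (m - Suc e) + T1 \<le> T'"
    proof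
      show "T = 31 + (T - 31)" "30 * (m - Suc e) + T1 \<le> T - 31" using T em by (simp_all add: Suc_diff_Suc[symmetric])
    qed
    have a: "lvs e u \<le> 2 * n" for u
    proof -
      have "lvs e u \<le> 2 * e * 1" unfolding lvs_def using em by (intro acc_le) auto
      then show ?thesis using em m_le by simp
    qed
    have b: "nbs e u + x < 2 ^ w" if "x < n" for u x
    proof -
      have "nbs e u \<le> 2 * e * n"
        using acc_le[of "\<lambda>x. if deg x = 1 then 0 else x" n e u] em unfolding nbs_def by simp
      also have "\<dots> \<le> 2 * n * n" using em m_le by simp
      finally have "nbs e u + x \<le> 16 * (n + 1) ^ 2" using that by (simp add: power2_eq_square algebra_simps)
      then show ?thesis using word by simp
    qed
    have "Suc (2 * e) < 2 ^ w" "2 * m + U e < 2 ^ w" "2 * m + X e < 2 ^ w" "2 * m + n + U e < 2 ^ w" "2 * m + n + X e < 2 ^ w"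
      "2 * m + 2 * n + U e < 2 ^ w" "2 * m + 2 * n + X e < 2 ^ w" "Suc (Suc (2 * e)) < 2 ^ w"
      "Suc (lvs e u) < 2 ^ w" for u
      using em m_le ends_less[OF em] a[of u] by (auto intro!: below_word)
    note bounds = this b[OF ends_less(1)[OF em]] b[OF ends_less(2)[OF em]]
    have fin: "\<exists>e'. mem deg (lvs (Suc e)) (nbs (Suc e)) C = mem deg (lvs e') (nbs e') C \<and> Suc (Suc (2 * e)) = 2 * e' \<and>
      e' \<le> m \<and> 30 * (m - e') + T1 \<le> 10 + T'"
      using em T' by (intro exI[of _ "Suc e"]) auto
    show "1 \<le> T \<and> vc w (Seq fetch_edge (Seq (note_neighbour r_u r_x) (Seq (note_neighbour r_x r_u)
       (block [Add r_i r_i r_one, Add r_i r_i r_one])))) ?I s (T - 1)"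
    proof (cases "deg (X e) = 1"; cases "deg (U e) = 1")
    qed (use R em T'(1) ends_less[OF em] ends_neq[OF em] bounds fin in
        \<open>simp_all add: s fetch_edge_def note_neighbour_def bump_def fixed_def edge_cells lvs_Suc nbs_Suc Let_def\<close>)
  }
qed

lemma find_end:
  assumes R: "fixed R" "R r_n = n" "R r_i = 0" "R r_k = 0" and T: "20 * n + 1 + T1 \<le> T"
    and Q: "\<And>R T. fixed R \<Longrightarrow> R r_n = n \<Longrightarrow> R r_k = card {u. u < n \<and> 1 < D u} \<Longrightarrow>
       (\<And>u. u < n \<Longrightarrow> 1 < D u \<Longrightarrow> D u - L u \<le> 1 \<Longrightarrow> R r_cur < n \<and> 1 < D (R r_cur) \<and> D (R r_cur) - L (R r_cur) \<le> 1) \<Longrightarrow>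
       T1 \<le> T \<Longrightarrow> Q (R, mem D L S C) T"
  shows "wp w find_end Q (R, mem D L S C) T"
  unfolding find_end_def
proof (rule wp_Loop)
  let ?E = "\<lambda>u. u < n \<and> 1 < D u \<and> D u - L u \<le> 1"
  let ?I = "\<lambda>s T. snd s = mem D L S C \<and> fixed (fst s) \<and> fst s r_n = n \<and> fst s r_i \<le> n \<and>
     fst s r_k = card {u. u < fst s r_i \<and> 1 < D u} \<and> (\<forall>u<fst s r_i. ?E u \<longrightarrow> ?E (fst s r_cur)) \<and>
     20 * (n - fst s r_i) + 1 + T1 \<le> T"
  show "?I (R, mem D L S C) T" using R T by auto
  fix s T assume I: "?I s T"
  then obtain R where s: "s = (R, mem D L S C)" and R: "fixed R" "R r_n = n" "R r_i \<le> n"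
    "R r_k = card {u. u < R r_i \<and> 1 < D u}" "\<And>u. u < R r_i \<Longrightarrow> ?E u \<Longrightarrow> ?E (R r_cur)"
    and T: "20 * (n - R r_i) + 1 + T1 \<le> T" by (cases s) auto
  {
    assume "\<not> holds (Less r_i r_n) s"
    then have i: "R r_i = n" using s R by auto
    have "Q (R, mem D L S C) (T - 1)"
      using R(1,2) R(4,5)[unfolded i] T by (intro Q) (simp, simp, simp, blast, simp)
    then show "1 \<le> T \<and> Q s (T - 1)" using s T by simp
  next
    assume "holds (Less r_i r_n) s"
    then have i: "R r_i < n" using s R by auto
    obtain T' where T': "T = 21 + T'" "20 * (n - Suc (R r_i)) + T1 \<le> T'"
    proof
      show "T = 21 + (T - 21)" "20 * (n - Suc (R r_i)) + T1 \<le> T - 21" using T i by (simp_all add: Suc_diff_Suc[symmetric])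
    qed
    have card: "card {u. u < Suc (R r_i) \<and> 1 < D u} = (if 1 < D (R r_i) then Suc (R r_k) else R r_k)"
    proof (cases "1 < D (R r_i)")
      case True
      then have "{u. u < Suc (R r_i) \<and> 1 < D u} = insert (R r_i) {u. u < R r_i \<and> 1 < D u}" by auto
      then show ?thesis using True R(4) by simp
    next
      case False
      then have "{u. u < Suc (R r_i) \<and> 1 < D u} = {u. u < R r_i \<and> 1 < D u}" by (auto simp: less_Suc_eq)
      then show ?thesis using False R(4) by simp
    qed
    have "R r_k \<le> n"
    proof -
      have "card {u. u < R r_i \<and> 1 < D u} \<le> card {..<n}" using R(3) by (intro card_mono) auto
      then show ?thesis using R(4) by simp
    qed
    then have bounds: "2 * m + R r_i < 2 ^ w" "2 * m + n + R r_i < 2 ^ w" "Suc (R r_k) < 2 ^ w" "Suc (R r_i) < 2 ^ w"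
      using i m_le by (auto intro!: below_word)
    show "1 \<le> T \<and> vc w (Seq (block [Add r_a r_deg r_i, Load r_t r_a])
       (Seq (Cond (Less r_one r_t)
          (Seq (block [Add r_k r_k r_one, Add r_a r_lvs r_i, Load r_l r_a, Sub r_t r_t r_l])
             (Cond (Leq r_t r_one) (block [Move r_cur r_i]) skip))
          skip)
        (block [Add r_i r_i r_one]))) ?I s (T - 1)"
      using R i T' bounds card
      by (cases "1 < D (R r_i)"; cases "D (R r_i) - L (R r_i) \<le> 1") (auto simp: s fixed_def less_Suc_eq)
  }
qed

lemma walk_spine:
  assumes R: "fixed R" "R r_n = n" "R r_i = 0" "R r_prev = 0" "R r_k = K" "0 < K \<Longrightarrow> R r_cur = v 0"
    and v: "\<And>i. i < K \<Longrightarrow> v i < n" "\<And>i. i < K \<Longrightarrow> L (v i) = c i"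
      "\<And>i. Suc i < K \<Longrightarrow> S (v i) - (if i = 0 then 0 else v (i - 1)) = v (Suc i)"
    and K: "K \<le> n" and T: "20 * K + 1 + T1 \<le> T"
    and Q: "\<And>R T. fixed R \<Longrightarrow> R r_n = n \<Longrightarrow> R r_k = K \<Longrightarrow> T1 \<le> T \<Longrightarrow>
       Q (R, mem D L S (\<lambda>i. if i < K then c i else 0)) T"
  shows "wp w walk_spine Q (R, mem D L S (\<lambda>_. 0)) T"
  unfolding walk_spine_def
proof (rule wp_Loop)
  let ?I = "\<lambda>s T. snd s = mem D L S (\<lambda>i. if i < fst s r_i then c i else 0) \<and> fixed (fst s) \<and> fst s r_n = n \<and>
     fst s r_i \<le> K \<and> fst s r_k = K \<and> (fst s r_i < K \<longrightarrow> fst s r_cur = v (fst s r_i)) \<and>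
     fst s r_prev = (if fst s r_i = 0 then 0 else v (fst s r_i - 1)) \<and> 20 * (K - fst s r_i) + 1 + T1 \<le> T"
  show "?I (R, mem D L S (\<lambda>_. 0)) T" using R T by auto
  fix s T assume I: "?I s T"
  then obtain R where s: "s = (R, mem D L S (\<lambda>i. if i < R r_i then c i else 0))" and R: "fixed R" "R r_n = n" "R r_i \<le> K"
    "R r_k = K" "R r_i < K \<Longrightarrow> R r_cur = v (R r_i)" "R r_prev = (if R r_i = 0 then 0 else v (R r_i - 1))"
    and T: "20 * (K - R r_i) + 1 + T1 \<le> T" by (cases s) auto
  {
    assume "\<not> holds (Less r_i r_k) s"
    then have i: "R r_i = K" using s R by auto
    have "Q (R, mem D L S (\<lambda>i. if i < K then c i else 0)) (T - 1)"
      using R(1,2,4) T by (intro Q) simp_all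
    then show "1 \<le> T \<and> Q s (T - 1)" using s T i by simp
  next
    assume "holds (Less r_i r_k) s"
    then have i: "R r_i < K" using s R by auto
    obtain T' where T': "T = 21 + T'" "20 * (K - Suc (R r_i)) + T1 \<le> T'"
    proof
      show "T = 21 + (T - 21)" "20 * (K - Suc (R r_i)) + T1 \<le> T - 21" using T i by (simp_all add: Suc_diff_Suc[symmetric])
    qed
    have bounds: "2 * m + n + v (R r_i) < 2 ^ w" "2 * m + 3 * n + R r_i < 2 ^ w" "2 * m + 2 * n + v (R r_i) < 2 ^ w" "Suc (R r_i) < 2 ^ w"
      using i m_le v(1)[OF i] K by (auto intro!: below_word)
    have upd: "(\<lambda>j. if j < R r_i then c j else 0)(R r_i := c (R r_i)) = (\<lambda>j. if j < Suc (R r_i) then c j else 0)"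
      by (auto simp: fun_eq_iff less_Suc_eq)
    show "1 \<le> T \<and> vc w (block [Add r_a r_lvs r_cur, Load r_t r_a, Add r_a r_row r_i, Store r_a r_t,
        Add r_a r_sum r_cur, Load r_t r_a, Sub r_t r_t r_prev, Move r_prev r_cur, Move r_cur r_t,
        Add r_i r_i r_one]) ?I s (T - 1)"
      using R i T' bounds v(1,2)[OF i] v(3)[of "R r_i"] upd by (auto simp: s fixed_def)
  }
qed

lemma test_intervals:
  assumes R: "fixed R" "R r_p = p" "R r_j = Suc s" "R r_acc = 0" "R r_q = 0" "R r_d = 1" "R r_e = 1" "R r_bad = 0"
    and s: "s < K" "p \<le> s" and c: "(\<Sum>i<K. c i) + K \<le> n"
    and T: "20 * (Suc s - p) + 1 + T1 \<le> T"
    and Q: "\<And>R' T. fixed R' \<Longrightarrow> R' r_n = R r_n \<Longrightarrow> R' r_k = R r_k \<Longrightarrow> R' r_s = R r_s \<Longrightarrow> R' r_p = p \<Longrightarrow>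
       R' r_next = R r_next \<Longrightarrow> R' r_bad = (if \<exists>x\<in>{p..s}. bad c x s then 1 else 0) \<Longrightarrow> T1 \<le> T \<Longrightarrow>
       Q (R', mem D L S c) T"
  shows "wp w test_intervals Q (R, mem D L S c) T"
  unfolding test_intervals_def
proof (rule wp_Loop)
  let ?I = "\<lambda>\<sigma> T. \<exists>j. fst \<sigma> r_j = j \<and> snd \<sigma> = mem D L S c \<and> fixed (fst \<sigma>) \<and> fst \<sigma> r_n = R r_n \<and> fst \<sigma> r_k = R r_k \<and>
     fst \<sigma> r_s = R r_s \<and> fst \<sigma> r_p = p \<and> fst \<sigma> r_next = R r_next \<and> p \<le> j \<and> j \<le> Suc s \<and>
     fst \<sigma> r_acc = sum c {j..s} \<and> fst \<sigma> r_q = quota (Suc s - j) \<and> fst \<sigma> r_d = (Suc s - j + 2) div 2 \<and>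
     fst \<sigma> r_e = (Suc s - j + 3) div 2 \<and> fst \<sigma> r_bad = (if \<exists>x\<in>{j..s}. bad c x s then 1 else 0) \<and>
     20 * (j - p) + 1 + T1 \<le> T"
  show "?I (R, mem D L S c) T" using R s T by (intro exI[of _ "Suc s"]) auto
  fix \<sigma> T assume I: "?I \<sigma> T"
  obtain R' M where \<sigma>: "\<sigma> = (R', M)" by (cases \<sigma>)
  obtain j where M: "M = mem D L S c" and R': "R' r_j = j" "fixed R'" "R' r_n = R r_n" "R' r_k = R r_k"
    "R' r_s = R r_s" "R' r_p = p" "R' r_next = R r_next" and j: "p \<le> j" "j \<le> Suc s"
    and A: "R' r_acc = sum c {j..s}" "R' r_q = quota (Suc s - j)" "R' r_d = (Suc s - j + 2) div 2"
     "R' r_e = (Suc s - j + 3) div 2" "R' r_bad = (if \<exists>x\<in>{j..s}. bad c x s then 1 else 0)"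
    and T: "20 * (j - p) + 1 + T1 \<le> T"
    using I unfolding \<sigma> by auto
  {
    assume "\<not> holds (Less r_p r_j) \<sigma>"
    then have "j = p" using \<sigma> R' j by auto
    then show "1 \<le> T \<and> Q \<sigma> (T - 1)" using R' A T unfolding \<sigma> M by (intro conjI Q) auto
  next
    assume "holds (Less r_p r_j) \<sigma>"
    then have pj: "p < j" using \<sigma> R' by auto
    then obtain i where i: "j = Suc i" "p \<le> i" "i \<le> s" using j by (cases j) auto
    obtain T' where T': "T = 21 + T'" "20 * (i - p) + T1 \<le> T'"
    proof
      show "T = 21 + (T - 21)" "20 * (i - p) + T1 \<le> T - 21" using T i by (simp_all add: Suc_diff_le)
    qed
    define N where "N = s - i"
    have N: "Suc s - j = N" "Suc s - i = Suc N" "N < K" using i s by (auto simp: N_def)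
    have K: "K \<le> n" "sum c {i..s} \<le> n"
    proof -
      have "sum c {i..s} \<le> (\<Sum>i<K. c i)" using s by (intro sum_mono2) auto
      then show "K \<le> n" "sum c {i..s} \<le> n" using c by auto
    qed
    have "{i..s} = insert i {Suc i..s}" using i by auto
    then have acc: "sum c {i..s} = sum c {j..s} + c i" using i by simp
    have "quota (Suc N) \<le> Suc N * Suc N" using quota_bounds by blast
    also have "\<dots> \<le> n * n" using N K by (intro mult_mono) auto
    also have "\<dots> < 2 ^ w" using word by (simp add: power2_eq_square algebra_simps)
    finally have q: "quota N + (N + 2) div 2 < 2 ^ w" by simp
    have bounds: "2 * m + 3 * n + i < 2 ^ w" "sum c {j..s} + c i < 2 ^ w" "Suc ((N + 2) div 2) < 2 ^ w"
      using N K m_le i s acc by (auto intro!: below_word)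
    have bad: "(\<exists>x\<in>{i..s}. bad c x s) \<longleftrightarrow> sum c {j..s} + c i < quota N + (N + 2) div 2 \<or> (\<exists>x\<in>{j..s}. bad c x s)"
    proof -
      have "bad c i s \<longleftrightarrow> sum c {j..s} + c i < quota N + (N + 2) div 2"
        using i N acc by (simp add: bad_def)
      then show ?thesis unfolding \<open>{i..s} = insert i {Suc i..s}\<close> i(1) by auto
    qed
    let ?b = "if sum c {j..s} + c i < quota N + (N + 2) div 2 \<or> (\<exists>x\<in>{j..s}. bad c x s) then 1 else (0::nat)"
    have fin: "p \<le> i \<and> i \<le> Suc s \<and> sum c {j..s} + c i = sum c {i..s} \<and>
       quota N + (N + 2) div 2 = quota (Suc s - i) \<and> (N + 3) div 2 = (Suc s - i + 2) div 2 \<and>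
       Suc ((N + 2) div 2) = (Suc s - i + 3) div 2 \<and> 20 * (i - p) + T1 \<le> 9 + T'"
      using i N acc T'(2) by auto
    let ?R = "R'(r_j := i, r_a := 2 * m + 3 * n + i, r_acc := R' r_acc + c i, r_q := R' r_q + R' r_d,
        r_d := R' r_e, r_e := R' r_d + 1, r_t := R' r_d + 1,
        r_bad := if R' r_acc + c i < R' r_q + R' r_d then 1 else R' r_bad)"
    have step: "vc w (Seq (block [Sub r_j r_j r_one, Add r_a r_row r_j, Load r_t r_a, Add r_acc r_acc r_t,
        Add r_q r_q r_d, Add r_t r_d r_one, Move r_d r_e, Move r_e r_t])
       (Cond (Less r_acc r_q) (block [Move r_bad r_one]) skip)) P \<sigma> (20 + T')" if "P (?R, M) (10 + T')" for P
    proof -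
      have "R' r_acc + c i < 2 ^ w" "R' r_q + R' r_d < 2 ^ w" "R' r_d + 1 < 2 ^ w"
        using bounds q A N by simp_all
      moreover have "R' r_one = 1" "R' r_row = 2 * m + 3 * n" using R'(2) by (simp_all add: fixed_def)
      moreover
      let ?S = "R'(r_j := i, r_a := 2 * m + 3 * n + i, r_acc := R' r_acc + c i, r_q := R' r_q + R' r_d,
        r_d := R' r_e, r_e := Suc (R' r_d), r_t := Suc (R' r_d))"
      have "P (if R' r_acc + c i < R' r_q + R' r_d then ?S(r_bad := 1) else ?S, M) (10 + T')"
      proof -
        have "?R = (if R' r_acc + c i < R' r_q + R' r_d then ?S(r_bad := 1) else ?S)"
          by (auto simp: fun_eq_iff)
        then show ?thesis using that by simp
      qed
      ultimately show ?thesis using R'(1) bounds(1)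
        by (cases "R' r_acc + c i < R' r_q + R' r_d") (simp_all add: \<sigma> M i(1) fun_upd_twist)
    qed
    have lt: "R' r_acc + c i < R' r_q + R' r_d \<longleftrightarrow> sum c {j..s} + c i < quota N + (N + 2) div 2"
      unfolding A(1-3) N(1) ..
    have flag: "(if R' r_acc + c i < R' r_q + R' r_d then 1 else R' r_bad) = (if \<exists>x\<in>{i..s}. bad c x s then 1 else (0::nat))"
      unfolding lt bad A(5) by simp
    have regs: "R' r_acc + c i = sum c {i..s}" "R' r_q + R' r_d = quota (Suc s - i)"
      "R' r_e = (Suc s - i + 2) div 2" "R' r_d + 1 = (Suc s - i + 3) div 2"
      unfolding A(1-4) N(1) using fin by auto
    have "?I (?R, M) (10 + T')"
    proof (intro exI[of _ i] conjI)
      show "fixed (fst (?R, M))" using R'(2) by (simp add: fixed_def)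
      show "fst (?R, M) r_bad = (if \<exists>x\<in>{i..s}. bad c x s then 1 else 0)"
        unfolding flag[symmetric] by simp
      show "fst (?R, M) r_q = quota (Suc s - i)" unfolding regs(2)[symmetric] by simp
      show "20 * (i - p) + 1 + T1 \<le> 10 + T'" using fin by linarith
    qed (use R'(3-7) i(2,3) regs(1,3,4) M in simp_all)
    moreover have "T - 1 = 20 + T'" "1 \<le> T" using T'(1) by simp_all
    ultimately show "1 \<le> T \<and> vc w (Seq (block [Sub r_j r_j r_one, Add r_a r_row r_j, Load r_t r_a, Add r_acc r_acc r_t,
        Add r_q r_q r_d, Add r_t r_d r_one, Move r_d r_e, Move r_e r_t])
       (Cond (Less r_acc r_q) (block [Move r_bad r_one]) skip)) ?I \<sigma> (T - 1)"
      using step[of ?I] by (simp only:)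
  }
qed

lemma vc_test_intervals: "vc w test_intervals = wp w test_intervals"
  by (simp add: test_intervals_def)

text \<open>
  Let \<open>l = s - p\<close>. A round that examines the intervals ending at \<open>s\<close> takes at most \<open>20 * l + 60\<close> steps, so
  reaching \<open>s\<close> has cost at most \<open>10 * l * l + 50 * l\<close> within the current segment. The invariant says that this
  expense and the remaining time together still amount to \<open>80\<close> steps for every vertex from \<open>p\<close> on. As
  the interval from \<open>p\<close> to \<open>s - 1\<close> is not bad, it has at least \<open>quota l \<ge> l * (l + 2) / 4\<close> leaves, and these pay for the
  whole segment when it is cut off.
\<close>
lemma cut:
  assumes R: "fixed R" "R r_n = 1" "R r_k = K" "R r_p = 1" "R r_s = 1" "R r_next = 2"
    and c: "(\<Sum>i<K. c i) + K \<le> n" and T: "80 * n + 1 \<le> T"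
    and Q: "\<And>R M T. R r_n = greedy c K 1 1 \<Longrightarrow> Q (R, M) T"
  shows "wp w cut Q (R, mem D L S c) T"
  unfolding cut_def
proof (rule wp_Loop)
  define W where "W p = (\<Sum>i\<in>{p..<K}. c i + 1)" for p
  let ?G = "greedy c K 1 1"
  let ?I = "\<lambda>\<sigma> T. \<exists>p s. snd \<sigma> = mem D L S c \<and> fixed (fst \<sigma>) \<and> fst \<sigma> r_k = K \<and> fst \<sigma> r_p = p \<and> fst \<sigma> r_s = s \<and>
     fst \<sigma> r_next = Suc s \<and> fst \<sigma> r_n + greedy c K p s = 1 + ?G \<and> fst \<sigma> r_n \<le> s \<and> p \<le> s \<and> (p = s \<or> s \<le> K) \<and>
     (p < s \<longrightarrow> \<not> bad c p (s - 1)) \<and> 80 * W p + 1 \<le> T + 10 * (s - p) * (s - p) + 50 * (s - p)"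
  have W1: "W 1 \<le> n"
  proof -
    have "W 1 \<le> (\<Sum>i<K. c i + 1)" unfolding W_def by (intro sum_mono2) auto
    also have "\<dots> = (\<Sum>i<K. c i) + K" by (simp only: sum.distrib) simp
    finally show ?thesis using c by simp
  qed
  show "?I (R, mem D L S c) T" using R T W1 by (intro exI[of _ 1]) auto
  fix \<sigma> T assume I: "?I \<sigma> T"
  obtain R M where \<sigma>: "\<sigma> = (R, M)" by (cases \<sigma>)
  obtain p s where M: "M = mem D L S c" and R: "fixed R" "R r_k = K" "R r_p = p" "R r_s = s" "R r_next = Suc s"
    and G: "R r_n + greedy c K p s = 1 + ?G" and n: "R r_n \<le> s" and ps: "p \<le> s" "p = s \<or> s \<le> K"
    and good: "p < s \<Longrightarrow> \<not> bad c p (s - 1)"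
    and T: "80 * W p + 1 \<le> T + 10 * (s - p) * (s - p) + 50 * (s - p)"
    using I unfolding \<sigma> by auto
  define l where "l = s - p"
  define l2 where "l2 = l * l"
  have quota: "4 * quota l \<ge> l2 + 2 * l" using quota_bounds[of l] by (simp add: l2_def algebra_simps)
  have quota20: "20 * l2 + 40 * l \<le> 80 * quota l" using quota by simp
  have T: "80 * W p + 1 \<le> T + 10 * l2 + 50 * l"
    using T unfolding l_def[symmetric] l2_def by (simp add: mult.assoc)
  have inner: "quota l + l \<le> (\<Sum>i\<in>{p..<s}. c i + 1)"
  proof -
    have "quota l \<le> (\<Sum>i\<in>{p..<s}. c i)"
    proof (cases "p < s")
      case True
      then have "{p..s - 1} = {p..<s}" "Suc (s - 1) - p = l" "p \<le> s - 1" by (auto simp: l_def)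
      then show ?thesis using good[OF True] unfolding bad_def by auto
    qed (use ps in \<open>simp add: l_def\<close>)
    moreover have "(\<Sum>i\<in>{p..<s}. c i + 1) = (\<Sum>i\<in>{p..<s}. c i) + l"
      by (simp only: sum.distrib) (simp add: l_def)
    ultimately show ?thesis by simp
  qed
  {
    assume h: "\<not> holds (Less r_next r_k) \<sigma>"
    then have "greedy c K p s = 1" using \<sigma> R by (simp add: greedy.simps[of c K p s])
    then have "R r_n = ?G" using G by simp
    have "(\<Sum>i\<in>{p..<s}. c i + 1) \<le> W p"
      unfolding W_def using ps(2) by (intro sum_mono2) auto
    with inner have "quota l + l \<le> W p" by (rule order_trans)
    then have "20 * l2 + 120 * l \<le> 80 * W p" using quota20 by simp
    then have "1 \<le> T" using T by linarith
    moreover have "R r_n = ?G" by fact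
    ultimately show "1 \<le> T \<and> Q \<sigma> (T - 1)" using Q unfolding \<sigma> by blast
  next
    assume "holds (Less r_next r_k) \<sigma>"
    then have sK: "Suc s < K" using \<sigma> R by simp
    have weight: "quota l + l + 2 + W p' \<le> W p" if "s + 2 \<le> p'" for p'
    proof -
      have "(\<Sum>i\<in>{p..<s} \<union> ({s, Suc s} \<union> {p'..<K}). c i + 1) = (\<Sum>i\<in>{p..<s}. c i + 1) + ((\<Sum>i\<in>{s, Suc s}. c i + 1) + W p')"
        unfolding W_def using that
        by (subst sum.union_disjoint, simp, simp, force, subst sum.union_disjoint) auto
      moreover have "(\<Sum>i\<in>{p..<s} \<union> ({s, Suc s} \<union> {p'..<K}). c i + 1) \<le> W p"
        unfolding W_def using that ps sK by (intro sum_mono2) auto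
      ultimately show ?thesis using inner by simp
    qed
    have lower: "10 * l2 + 70 * l + 161 \<le> T"
    proof -
      have "quota l + l + 2 \<le> W p" using weight[of "s + 2"] by simp
      then have "20 * l2 + 120 * l + 160 \<le> 80 * W p" using quota20 by simp
      then show ?thesis using T by linarith
    qed
    obtain T' where T': "T = 20 * l + 60 + T'"
    proof
      show "T = 20 * l + 60 + (T - (20 * l + 60))" using lower by simp
    qed
    have budget: "80 * W p + 1 \<le> T' + 10 * l2 + 70 * l + 60"
      using T T' by linarith
    have budget': "80 * W p' + 1 \<le> T'" if "s + 2 \<le> p'" for p'
    proof -
      have "quota l + l + 2 + W p' \<le> W p" using weight[OF that] .
      then show ?thesis using quota20 budget by simp
    qed
    have Kn: "K \<le> n" using c by simp
    define x where "x = next_anchor c s"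
    let ?R = "R(r_j := R r_next, r_acc := 0, r_q := 0, r_d := 1, r_e := 1, r_bad := 0)"
    let ?C = "Cond (Equal r_bad r_one)
          (Seq (block [Add r_n r_n r_one, Add r_a r_row r_next, Load r_t r_a, Move r_s r_next])
          (Seq (Cond (Equal r_t r_zero) (block [Add r_s r_s r_one]) skip)
          (Seq (block [Add r_a r_row r_s, Load r_t r_a, Add r_s r_s r_one])
          (Seq (Cond (Equal r_t r_zero) (block [Add r_s r_s r_one]) skip)
            (block [Move r_p r_s, Add r_next r_s r_one])))))
          (block [Move r_s r_next, Add r_next r_next r_one])"
    have body: "vc w ?C ?I (R', mem D L S c) T2"
      if R': "fixed R'" "R' r_n = ?R r_n" "R' r_k = ?R r_k" "R' r_s = ?R r_s" "R' r_p = p"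
       "R' r_next = ?R r_next" "R' r_bad = (if \<exists>x\<in>{p..s}. bad c x s then 1 else 0)" and T2: "T' + 30 \<le> T2" for R' T2
    proof -
      obtain T3 where T3: "T2 = T3 + 30" "T' \<le> T3"
      proof
        show "T2 = (T2 - 30) + 30" "T' \<le> T2 - 30" using T2 by simp_all
      qed
      show "vc w ?C ?I (R', mem D L S c) T2"
      proof (cases "\<exists>x\<in>{p..s}. bad c x s")
        case False
        have g: "greedy c K p s = greedy c K p (Suc s)" using False sK by (simp add: greedy.simps[of c K p s])
        have nb: "\<not> bad c p s" using False ps by auto
        have t: "80 * W p + 1 \<le> T3 + z + 10 * (Suc s - p) * (Suc s - p) + 50 * (Suc s - p)" for z
        proof -
          have "10 * (Suc s - p) * (Suc s - p) + 50 * (Suc s - p) = 10 * l2 + 70 * l + 60"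
          proof -
            have "Suc s - p = Suc l" using ps(1) by (simp add: l_def Suc_diff_le)
            then show ?thesis by (simp add: l2_def algebra_simps)
          qed
          then show ?thesis using budget T3(2) by linarith
        qed
        have b: "Suc (Suc s) < 2 ^ w" using sK Kn by (intro below_word) simp
        show ?thesis using R' R T3(1) False g G n nb t[of 27] b ps sK
          by (simp add: fixed_def)
      next
        case True
        have g: "greedy c K p s = Suc (greedy c K (first_inner c x) (first_inner c x))"
          using True sK by (simp add: greedy.simps[of c K p s] x_def)
        have x: "x = (if c (Suc s) = 0 then Suc (Suc s) else Suc s)" by (simp add: x_def next_anchor_def)
        have y: "first_inner c x = (if c x = 0 then Suc (Suc x) else Suc x)" by (simp add: first_inner_def)
        have b: "Suc (R r_n) < 2 ^ w" "Suc (Suc s) < 2 ^ w" "Suc (Suc (Suc s)) < 2 ^ w" "Suc (Suc (Suc (Suc s))) < 2 ^ w"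
          "Suc (Suc (Suc (Suc (Suc s)))) < 2 ^ w" "2 * m + 3 * n + Suc s < 2 ^ w" "2 * m + 3 * n + Suc (Suc s) < 2 ^ w"
          using sK Kn n m_le by (auto intro!: below_word)
        have beyond: "s + 2 \<le> first_inner c x" unfolding y using x by (simp split: if_splits)
        have t: "80 * W (first_inner c x) + 1 \<le> T3 + z" for z
          using budget'[OF beyond] T3(2) by linarith
        have step: "vc w ?C P (R', mem D L S c) T2"
          if P: "\<And>R2 z. fixed R2 \<Longrightarrow> R2 r_n = Suc (R r_n) \<Longrightarrow> R2 r_k = K \<Longrightarrow> R2 r_p = first_inner c x \<Longrightarrow>
             R2 r_s = first_inner c x \<Longrightarrow> R2 r_next = Suc (first_inner c x) \<Longrightarrow> P (R2, mem D L S c) (z + T3)" for P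
        proof -
          have flag: "R' r_bad = 1" using R'(7) True by simp
          have regs: "R' r_n = R r_n" "R' r_k = K" "R' r_next = Suc s" using R'(2,3,6) R(2,5) by simp_all
          show ?thesis
            unfolding T3(1) using R'(1) flag regs b
            by (cases "c (Suc s) = 0"; cases "c x = 0") (simp_all add: fixed_def x first_inner_def mem_Suc, (rule P; simp add: fixed_def x first_inner_def)+)
        qed
        show ?thesis
        proof (rule step)
          fix R2 z assume "fixed R2" "R2 r_n = Suc (R r_n)" "R2 r_k = K" "R2 r_p = first_inner c x"
            "R2 r_s = first_inner c x" "R2 r_next = Suc (first_inner c x)"
          moreover have "R r_n < first_inner c x" using n beyond by linarith
          moreover have "Suc (R r_n) + greedy c K (first_inner c x) (first_inner c x) = 1 + ?G" using g G by simp
          ultimately show "?I (R2, mem D L S c) (z + T3)"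
            using t[of z] by (intro exI[of _ "first_inner c x"]) (simp add: add.commute)
        qed
      qed
    qed
    have "wp w test_intervals (vc w ?C ?I) (?R, mem D L S c) (20 * l + 53 + T')"
    proof (rule test_intervals[where ?T1.0 = "T' + 30" and K = K and p = p and s = s])
      show "fixed ?R" using R(1) by (simp add: fixed_def)
      show "20 * (Suc s - p) + 1 + (T' + 30) \<le> 20 * l + 53 + T'"
        using ps by (simp add: l_def Suc_diff_le)
      fix R' T2 assume "fixed R'" "R' r_n = ?R r_n" "R' r_k = ?R r_k" "R' r_s = ?R r_s" "R' r_p = p"
       "R' r_next = ?R r_next" "R' r_bad = (if \<exists>x\<in>{p..s}. bad c x s then 1 else 0)" "T' + 30 \<le> T2"
      then show "vc w ?C ?I (R', mem D L S c) T2" by (rule body)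
    qed (use R ps sK c in simp_all)
    moreover have "vc w (Seq (block [Move r_j r_next, Move r_acc r_zero, Move r_q r_zero, Move r_d r_one, Move r_e r_one,
         Move r_bad r_zero]) (Seq test_intervals C)) P \<sigma> (T - 1)"
      if "wp w test_intervals (vc w C P) (?R, mem D L S c) (20 * l + 53 + T')" for C P
    proof -
      have "20 * l + 53 + T' = 53 + (20 * l + T')" by simp
      then show ?thesis using that R T' by (simp only:) (simp add: \<sigma> M fixed_def vc_test_intervals)
    qed
    moreover have "1 \<le> T" using T' by simp
    ultimately show "1 \<le> T \<and> vc w (Seq (block [Move r_j r_next, Move r_acc r_zero, Move r_q r_zero, Move r_d r_one, Move r_e r_one,
         Move r_bad r_zero]) (Seq test_intervals ?C)) ?I \<sigma> (T - 1)" by blast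
  }
qed

lemma vc_loops:
  "vc w count_degrees = wp w count_degrees" "vc w scan_neighbours = wp w scan_neighbours"
  "vc w find_end = wp w find_end" "vc w walk_spine = wp w walk_spine" "vc w cut = wp w cut"
  by (simp_all add: count_degrees_def scan_neighbours_def find_end_def walk_spine_def cut_def)

definition spine_end :: "nat \<Rightarrow> bool" where
  "spine_end u \<longleftrightarrow> u < n \<and> 1 < deg u \<and> deg u - lvs m u \<le> 1"

text \<open>
  The graph enters only through \<open>deg\<close>, \<open>lvs\<close> and \<open>nbs\<close>: whichever end of the spine the program has found, its
  walk from there must visit some sequence of vertices whose leaf numbers lead the greedy partition to the
  answer. With fewer than three vertices no vertex has degree \<open>2\<close>, and then \<open>K = 0\<close>.
\<close>
lemma acquisition_program_correct:
  assumes K: "K = card {u. u < n \<and> 1 < deg u}" and ex: "0 < K \<Longrightarrow> \<exists>u. spine_end u"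
    and walk: "\<And>u. (0 < K \<Longrightarrow> spine_end u) \<Longrightarrow> \<exists>v c. (0 < K \<longrightarrow> v 0 = u) \<and>
      (\<forall>i<K. v i < n \<and> lvs m (v i) = c i) \<and>
      (\<forall>i. Suc i < K \<longrightarrow> nbs m (v i) - (if i = 0 then 0 else v (i - 1)) = v (Suc i)) \<and>
      (\<Sum>i<K. c i) + K \<le> n \<and> greedy (\<lambda>i. if i < K then c i else 0) K 1 1 = answer"
  shows "wp w acquisition_program (\<lambda>s T. fst s 0 = answer) (input_state n es) (200 * n + 100)"
proof (rule vc_sound)
  let ?Q = "\<lambda>s (T :: nat). fst s 0 = answer"
  let ?cut = "Seq (block [Move r_n r_one, Move r_p r_one, Move r_s r_one, Add r_next r_one r_one]) cut"
  let ?walk = "Seq (block [Move r_i r_zero, Move r_prev r_zero]) (Seq walk_spine ?cut)"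
  let ?find = "Seq (block [Move r_i r_zero, Move r_k r_zero, Move r_cur r_zero]) (Seq find_end ?walk)"
  let ?scan = "Seq (block [Move r_i r_zero]) (Seq scan_neighbours ?find)"
  have two: "Suc (Suc 0) < 2 ^ w" by (rule below_word) simp
  have cut': "vc w ?cut ?Q (R, mem deg (lvs m) (nbs m) c) T"
    if "fixed R" "R r_k = K" "80 * n + 5 \<le> T" "(\<Sum>i<K. c i) + K \<le> n" "greedy c K 1 1 = answer" for R c T
  proof -
    have "wp w cut ?Q (R(r_n := 1, r_p := 1, r_s := 1, r_next := 1 + 1), mem deg (lvs m) (nbs m) c) (T - Suc (Suc (Suc (Suc 0))))"
      by (rule cut) (use that in \<open>auto simp: fixed_def\<close>)
    then show ?thesis using that(1,3) two by (simp only: vc.simps(2) vc_block vc_loops) (simp add: fixed_def)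
  qed
  have walk': "vc w ?walk ?Q (R, mem deg (lvs m) (nbs m) (\<lambda>_. 0)) T"
    if R: "fixed R" "R r_n = n" "R r_k = K" "0 < K \<Longrightarrow> spine_end (R r_cur)" and T: "100 * n + 10 \<le> T" for R T
  proof -
    obtain v c where v: "0 < K \<longrightarrow> v 0 = R r_cur" "\<forall>i<K. v i < n \<and> lvs m (v i) = c i"
      "\<forall>i. Suc i < K \<longrightarrow> nbs m (v i) - (if i = 0 then 0 else v (i - 1)) = v (Suc i)"
      "(\<Sum>i<K. c i) + K \<le> n" "greedy (\<lambda>i. if i < K then c i else 0) K 1 1 = answer"
      using walk[OF R(4)] by blast
    have "wp w walk_spine (vc w ?cut ?Q) (R(r_i := 0, r_prev := 0), mem deg (lvs m) (nbs m) (\<lambda>_. 0)) (T - Suc (Suc 0))"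
    proof (rule walk_spine[where v = v and c = c and K = K and ?T1.0 = "80 * n + 5"])
      show "20 * K + 1 + (80 * n + 5) \<le> T - Suc (Suc 0)" using T v(4) by simp
      fix R T assume "fixed R" "R r_k = K" "80 * n + 5 \<le> T"
      then show "vc w ?cut ?Q (R, mem deg (lvs m) (nbs m) (\<lambda>i. if i < K then c i else 0)) T"
        using v(4,5) by (intro cut') auto
    qed (use R v in \<open>auto simp: fixed_def\<close>)
    then show ?thesis using R(1) T by (simp only: vc.simps(2) vc_block vc_loops) (simp add: fixed_def)
  qed
  have find': "vc w ?find ?Q (R, mem deg (lvs m) (nbs m) (\<lambda>_. 0)) T"
    if R: "fixed R" "R r_n = n" and T: "120 * n + 20 \<le> T" for R T
  proof -
    have "wp w find_end (vc w ?walk ?Q) (R(r_i := 0, r_k := 0, r_cur := 0), mem deg (lvs m) (nbs m) (\<lambda>_. 0)) (T - Suc (Suc (Suc 0)))"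
    proof (rule find_end[where ?T1.0 = "100 * n + 10"])
      fix R T assume R: "fixed R" "R r_n = n" "R r_k = card {u. u < n \<and> 1 < deg u}" "100 * n + 10 \<le> T"
        and e: "\<And>u. u < n \<Longrightarrow> 1 < deg u \<Longrightarrow> deg u - lvs m u \<le> 1 \<Longrightarrow> R r_cur < n \<and> 1 < deg (R r_cur) \<and> deg (R r_cur) - lvs m (R r_cur) \<le> 1"
      show "vc w ?walk ?Q (R, mem deg (lvs m) (nbs m) (\<lambda>_. 0)) T"
        using R e ex K by (intro walk') (auto simp: spine_end_def)
    qed (use R T in \<open>auto simp: fixed_def\<close>)
    then show ?thesis using R(1) T by (simp only: vc.simps(2) vc_block vc_loops) (simp add: fixed_def)
  qed
  have scan': "vc w ?scan ?Q (R, mem deg (\<lambda>_. 0) (\<lambda>_. 0) (\<lambda>_. 0)) T"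
    if R: "fixed R" "R r_n = n" and T: "150 * n + 30 \<le> T" for R T
  proof -
    have "wp w scan_neighbours (vc w ?find ?Q) (R(r_i := 0), mem deg (\<lambda>_. 0) (\<lambda>_. 0) (\<lambda>_. 0)) (T - 1)"
    proof (rule scan_neighbours[where ?T1.0 = "120 * n + 20"])
      show "30 * m + 1 + (120 * n + 20) \<le> T - 1" using T m_le by simp
      fix R T assume "fixed R" "R r_n = n" "120 * n + 20 \<le> T"
      then show "vc w ?find ?Q (R, mem deg (lvs m) (nbs m) (\<lambda>_. 0)) T" by (rule find')
    qed (use R in \<open>simp_all add: fixed_def\<close>)
    then show ?thesis using R(1) T by (simp only: vc.simps(2) vc_block vc_loops) (simp add: fixed_def)
  qed
  let ?init = "(\<lambda>_. 0)(0 := n, 1 := m) :: nat \<Rightarrow> nat"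
  let ?R = "?init(r_one := 1, r_zero := 0, r_deg := m + m, r_lvs := m + m + n, r_sum := m + m + n + n,
     r_row := m + m + n + n + n, r_i := 0)"
  have input: "input_state n es = (?init, mem (\<lambda>_. 0) (\<lambda>_. 0) (\<lambda>_. 0) (\<lambda>_. 0))"
  proof (rule prod_eqI)
    show "fst (input_state n es) = fst (?init, mem (\<lambda>_. 0) (\<lambda>_. 0) (\<lambda>_. 0) (\<lambda>_. 0))"
      unfolding input_state_def m_def by simp
    have "snd (input_state n es) a = 0" if "2 * m \<le> a" for a
      using that unfolding input_state_def m_def by simp
    then have "snd (input_state n es) a = mem (\<lambda>_. 0) (\<lambda>_. 0) (\<lambda>_. 0) (\<lambda>_. 0) a" for a
      unfolding mem_def inp_def by (cases "a < 2 * m") auto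
    then show "snd (input_state n es) = snd (?init, mem (\<lambda>_. 0) (\<lambda>_. 0) (\<lambda>_. 0) (\<lambda>_. 0))"
      by auto
  qed
  have "wp w count_degrees (vc w ?scan ?Q) (?R, mem (\<lambda>_. 0) (\<lambda>_. 0) (\<lambda>_. 0) (\<lambda>_. 0)) (200 * n + 93)"
  proof (rule count_degrees[where ?T1.0 = "150 * n + 30"])
    show "20 * m + 1 + (150 * n + 30) \<le> 200 * n + 93" using m_le by simp
    fix R T assume "fixed R" "R r_n = n" "150 * n + 30 \<le> T"
    from scan'[OF this] show "vc w ?scan ?Q (R, mem (acc (\<lambda>_. 1) m) (\<lambda>_. 0) (\<lambda>_. 0) (\<lambda>_. 0)) T"
      unfolding deg_def .
  qed (simp_all add: fixed_def)
  moreover have "Suc 0 < 2 ^ w" "0 < (2::nat) ^ w" "m + m < 2 ^ w" "m + m + n < 2 ^ w" "m + m + n + n < 2 ^ w" "m + m + n + n + n < 2 ^ w"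
    using m_le by (auto intro!: below_word)
  moreover have "vc w (Seq lay_out (Seq count_degrees C)) P (?init, M) (200 * n + 100)"
    if "Suc 0 < 2 ^ w" "0 < (2::nat) ^ w" "m + m < 2 ^ w" "m + m + n < 2 ^ w" "m + m + n + n < 2 ^ w" "m + m + n + n + n < 2 ^ w"
      "wp w count_degrees (vc w C P) (?R, M) (200 * n + 93)" for C P M
  proof -
    have "200 * n + 93 = 93 + 200 * n" by simp
    then show ?thesis unfolding lay_out_def using that
      by (simp only: vc.simps(2) vc_block vc_loops) simp
  qed
  ultimately show "vc w acquisition_program ?Q (input_state n es) (200 * n + 100)"
    unfolding acquisition_program_def input by blast
qed

end


section \<open>Running the program on a caterpillar\<close>

context spine
begin

definition nbrs :: "'a \<Rightarrow> 'a set" where "nbrs u = {x. (u, x) \<in> parcs G}"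

lemma nbrs_leaf: "x \<in> L \<Longrightarrow> nbrs x = {v (h x)}"
  using v_notin_L host unfolding nbrs_def arcs by auto

lemma nbrs_spine:
  assumes i: "i < k"
  shows "nbrs (v i) = (if i = 0 then {} else {v (i - 1)}) \<union> (if Suc i < k then {v (Suc i)} else {}) \<union> {x \<in> L. h x = i}"
proof (rule set_eqI)
  fix x
  have "(v i, x) \<in> parcs G \<longleftrightarrow> (Suc i < k \<and> x = v (Suc i)) \<or> (0 < i \<and> x = v (i - 1)) \<or> (x \<in> L \<and> h x = i)"
  proof
    assume "(v i, x) \<in> parcs G"
    then consider j where "v i = v j" "x = v (Suc j)" "Suc j < k" | j where "v i = v (Suc j)" "x = v j" "Suc j < k"
      | "v i \<in> L" | "x \<in> L" "v i = v (h x)"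
      unfolding arcs by blast
    then show "(Suc i < k \<and> x = v (Suc i)) \<or> (0 < i \<and> x = v (i - 1)) \<or> (x \<in> L \<and> h x = i)"
      using i v_eq_iff host v_notin_L by cases auto
  next
    assume "(Suc i < k \<and> x = v (Suc i)) \<or> (0 < i \<and> x = v (i - 1)) \<or> (x \<in> L \<and> h x = i)"
    then show "(v i, x) \<in> parcs G" using spine_arcs(1)[of i] spine_arcs(2)[of "i - 1"] leaf_arcs(2)[of x] i by auto
  qed
  then show "x \<in> nbrs (v i) \<longleftrightarrow> x \<in> (if i = 0 then {} else {v (i - 1)}) \<union> (if Suc i < k then {v (Suc i)} else {}) \<union> {x \<in> L. h x = i}"
    by (auto simp: nbrs_def)
qed

lemma sum_nbrs_spine:
  assumes i: "i < k"
  shows "(\<Sum>x\<in>nbrs (v i). g x) =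
    (if i = 0 then 0 else g (v (i - 1))) + (if Suc i < k then g (v (Suc i)) else 0) + (\<Sum>x\<in>{x \<in> L. h x = i}. g x :: nat)"
proof -
  let ?A = "if i = 0 then {} else {v (i - 1)}" and ?B = "if Suc i < k then {v (Suc i)} else {}"
  have "v (i - 1) \<noteq> v (Suc i)" if "Suc i < k" using that i v_eq_iff[of "i - 1" "Suc i"] by simp
  then have 1: "?A \<inter> ?B = {}" by auto
  have 2: "(?A \<union> ?B) \<inter> {x \<in> L. h x = i} = {}" using v_notin_L i by auto
  have "(\<Sum>x\<in>nbrs (v i). g x) = (\<Sum>x\<in>?A \<union> ?B. g x) + (\<Sum>x\<in>{x \<in> L. h x = i}. g x)"
    unfolding nbrs_spine[OF i] using 2 finite_L by (intro sum.union_disjoint) auto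
  also have "(\<Sum>x\<in>?A \<union> ?B. g x) = (\<Sum>x\<in>?A. g x) + (\<Sum>x\<in>?B. g x)"
    using 1 by (intro sum.union_disjoint) auto
  finally show ?thesis by simp
qed

lemma card_verts: "card (pverts G) = (\<Sum>i<k. c i) + k"
proof -
  have "card (pverts G) = card (v ` {..<k}) + card L"
    using v_verts finite_verts card_Diff_subset[of "v ` {..<k}" "pverts G"] card_mono[OF finite_verts v_verts]
    by (simp add: L_def)
  moreover have "card (v ` {..<k}) = k" using inj_v by (simp add: card_image)
  moreover have "card L = (\<Sum>i<k. c i)"
  proof -
    have "L = (\<Union>i\<in>{..<k}. {x \<in> L. h x = i})" using host by auto
    then have "card L = card (\<Union>i\<in>{..<k}. {x \<in> L. h x = i})" by simp
    also have "\<dots> = (\<Sum>i<k. c i)" unfolding c_def using finite_L by (intro card_UN_disjoint) auto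
    finally show ?thesis .
  qed
  ultimately show ?thesis by simp
qed

text \<open>
  Both orientations of every edge are counted on the left; the number of edges is thus at most that of the vertices.
\<close>
lemma card_arcs_le: "card (parcs G) \<le> 2 * card (pverts G)"
proof -
  have "parcs G = (\<lambda>i. (v i, v (Suc i))) ` {i. Suc i < k} \<union> (\<lambda>i. (v (Suc i), v i)) ` {i. Suc i < k}
     \<union> (\<lambda>x. (x, v (h x))) ` L \<union> (\<lambda>x. (v (h x), x)) ` L"
    unfolding arcs by auto
  moreover have "card (A \<union> B \<union> C \<union> D) \<le> card A + card B + card C + card D" for A B C D :: "('a \<times> 'a) set"
    using card_Un_le[of "A \<union> B \<union> C" D] card_Un_le[of "A \<union> B" C] card_Un_le[of A B] by linarith
  ultimately have "card (parcs G) \<le> card ((\<lambda>i. (v i, v (Suc i))) ` {i. Suc i < k}) + card ((\<lambda>i. (v (Suc i), v i)) ` {i. Suc i < k})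
     + card ((\<lambda>x. (x, v (h x))) ` L) + card ((\<lambda>x. (v (h x), x)) ` L)"
    by (simp only:)
  also have "\<dots> \<le> card {..<k} + card {..<k} + card L + card L"
  proof (intro add_mono)
    have "card ((f :: nat \<Rightarrow> 'a \<times> 'a) ` {i. Suc i < k}) \<le> card {..<k}" for f
    proof -
      have sub: "{i. Suc i < k} \<subseteq> {..<k}" by auto
      have "card (f ` {i. Suc i < k}) \<le> card {i. Suc i < k}"
        by (rule card_image_le) (rule finite_subset[OF sub], simp)
      also have "\<dots> \<le> card {..<k}" using sub by (intro card_mono) auto
      finally show ?thesis .
    qed
    then show "card ((\<lambda>i. (v i, v (Suc i))) ` {i. Suc i < k}) \<le> card {..<k}"
      "card ((\<lambda>i. (v (Suc i), v i)) ` {i. Suc i < k}) \<le> card {..<k}" by blast+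
  qed (use finite_L card_image_le in blast)+
  also have "\<dots> = 2 * card (pverts G)"
  proof -
    have "card (pverts G) = card (v ` {..<k}) + card L"
      using v_verts finite_verts card_Diff_subset[of "v ` {..<k}" "pverts G"] card_mono[OF finite_verts v_verts]
      by (simp add: L_def)
    then show ?thesis using inj_v by (simp add: card_image)
  qed
  finally show ?thesis .
qed

end

text \<open>
  Each neighbour of \<open>u\<close> belongs to exactly one listed edge, whichever its orientation.
\<close>
lemma (in run) acc_eq:
  assumes es: "distinct es" "\<And>a b. (a, b) \<in> set es \<Longrightarrow> (b, a) \<notin> set es"
  shows "acc g m u = (\<Sum>x\<in>{x. (u, x) \<in> set es \<union> (set es)\<inverse>}. g x)"
proof -
  let ?f = "\<lambda>(a, b). (if a = u then g b else 0) + (if b = u then g a else 0)"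
  have "acc g m u = (\<Sum>e<m. ?f (es ! e))"
    unfolding acc_def U_def X_def by (intro sum.cong) (auto simp: case_prod_beta)
  also have "\<dots> = (\<Sum>p\<in>set es. ?f p)"
    using es(1) bij_betw_nth[of es "{..<m}" "set es"] by (intro sum.reindex_bij_betw) (auto simp: m_def)
  also have "\<dots> = (\<Sum>(a, b)\<in>set es. if a = u then g b else 0) + (\<Sum>(a, b)\<in>set es. if b = u then g a else 0)"
    by (simp add: sum.distrib case_prod_beta)
  also have "(\<Sum>(a, b)\<in>set es. if a = u then g b else 0) = (\<Sum>x\<in>{x. (u, x) \<in> set es}. g x)"
  proof -
    have "(\<Sum>(a, b)\<in>set es. if a = u then g b else 0) = (\<Sum>p\<in>Pair u ` {x. (u, x) \<in> set es}. g (snd p))"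
      by (intro sum.mono_neutral_cong_right) (auto split: if_splits)
    then show ?thesis by (simp add: sum.reindex inj_on_def)
  qed
  also have "(\<Sum>(a, b)\<in>set es. if b = u then g a else 0) = (\<Sum>x\<in>{x. (x, u) \<in> set es}. g x)"
  proof -
    have "(\<Sum>(a, b)\<in>set es. if b = u then g a else 0) = (\<Sum>p\<in>(\<lambda>x. (x, u)) ` {x. (x, u) \<in> set es}. g (fst p))"
      by (intro sum.mono_neutral_cong_right) (auto split: if_splits)
    then show ?thesis by (simp add: sum.reindex inj_on_def)
  qed
  also have "(\<Sum>x\<in>{x. (u, x) \<in> set es}. g x) + (\<Sum>x\<in>{x. (x, u) \<in> set es}. g x) =
      (\<Sum>x\<in>{x. (u, x) \<in> set es} \<union> {x. (x, u) \<in> set es}. g x)"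
  proof (rule sum.union_disjoint[symmetric])
    show "finite {x. (u, x) \<in> set es}" by (rule finite_subset[of _ "snd ` set es"]) force+
    show "finite {x. (x, u) \<in> set es}" by (rule finite_subset[of _ "fst ` set es"]) force+
  qed (use es(2) in auto)
  also have "{x. (u, x) \<in> set es} \<union> {x. (x, u) \<in> set es} = {x. (u, x) \<in> set es \<union> (set es)\<inverse>}" by auto
  finally show ?thesis .
qed

locale spine_run = spine G v k h L c + run n es w inp m
  for G :: "nat pair_pre_digraph" and v :: "nat \<Rightarrow> nat" and k and h and L and c
    and n es w and inp :: "nat \<Rightarrow> nat" and m +
  assumes G: "represents n es G"
begin

lemma acc_nbrs: "acc g m u = (\<Sum>x\<in>nbrs u. g x)"
proof -
  have "distinct es" "\<And>a b. (a, b) \<in> set es \<Longrightarrow> (b, a) \<notin> set es" "parcs G = set es \<union> (set es)\<inverse>"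
    using G by (auto simp: represents_def)
  then show ?thesis using acc_eq[of g u] by (simp add: nbrs_def)
qed

lemma deg_eq: "deg u = card (nbrs u)"
  by (simp add: deg_def acc_nbrs)

lemma deg_leaf: "x \<in> L \<Longrightarrow> deg x = 1"
  by (simp add: deg_eq nbrs_leaf)

lemma deg_spine: "i < k \<Longrightarrow> deg (v i) = (if i = 0 then 0 else 1) + (if Suc i < k then 1 else 0) + c i"
  using sum_nbrs_spine[of i "\<lambda>_. 1"] by (simp add: deg_def acc_nbrs c_def)

text \<open>
  If all spine vertices have degree at least \<open>2\<close>, then degrees tell apart spine and leaves, and the ends of the
  spine are the spine vertices with at most one neighbour on the spine.
\<close>
lemma walk_from_start:
  assumes big: "\<And>i. i < k \<Longrightarrow> 1 < deg (v i)" and ends: "k = 1 \<or> 0 < c 0 \<and> 0 < c (k - 1)"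
  shows "card {u. u < n \<and> 1 < deg u} = k" "spine_end u \<Longrightarrow> u = v 0 \<or> u = v (k - 1)" "spine_end (v 0)"
    "\<forall>i<k. v i < n \<and> lvs m (v i) = c i"
    "\<forall>i. Suc i < k \<longrightarrow> nbs m (v i) - (if i = 0 then 0 else v (i - 1)) = v (Suc i)"
    "(\<Sum>i<k. c i) + k \<le> n" "greedy (\<lambda>i. if i < k then c i else 0) k 1 1 = unit_acquisition_number G"
proof -
  have verts: "pverts G = {..<n}" using G by (simp add: represents_def)
  have vn: "v i < n" if "i < k" for i using v_verts that unfolding verts by auto
  have set: "{u. u < n \<and> 1 < deg u} = v ` {..<k}"
  proof -
    have "u \<in> v ` {..<k}" if "u < n" "1 < deg u" for u
    proof (rule ccontr)
      assume "u \<notin> v ` {..<k}"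
      then have "u \<in> L" using that verts by (simp add: L_def)
      then show False using deg_leaf that by simp
    qed
    then show ?thesis using big vn by blast
  qed
  then show "card {u. u < n \<and> 1 < deg u} = k" using inj_v by (simp add: card_image)
  have deg_v: "deg (v i) \<noteq> 1" if "i < k" for i using big[OF that] by simp
  have lv: "lvs m (v i) = c i" if i: "i < k" for i
    unfolding lvs_def acc_nbrs sum_nbrs_spine[OF i]
    using i deg_v[of "i - 1"] deg_v[of "Suc i"] deg_leaf by (simp add: c_def)
  have nb: "nbs m (v i) = (if i = 0 then 0 else v (i - 1)) + (if Suc i < k then v (Suc i) else 0)" if i: "i < k" for i
    unfolding nbs_def acc_nbrs sum_nbrs_spine[OF i]
    using i deg_v[of "i - 1"] deg_v[of "Suc i"] deg_leaf by simp
  show "\<forall>i<k. v i < n \<and> lvs m (v i) = c i" using vn lv by simp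
  show "\<forall>i. Suc i < k \<longrightarrow> nbs m (v i) - (if i = 0 then 0 else v (i - 1)) = v (Suc i)" using nb by simp
  show "spine_end (v 0)" using vn k_pos big[of 0] lv[of 0] deg_spine[of 0] by (simp add: spine_end_def)
  show "u = v 0 \<or> u = v (k - 1)" if u: "spine_end u"
  proof -
    have "u \<in> v ` {..<k}" using u set by (auto simp: spine_end_def)
    then obtain i where i: "u = v i" "i < k" by auto
    then have "i = 0 \<or> \<not> Suc i < k" using u lv[of i] deg_spine[of i] by (auto simp: spine_end_def split: if_splits)
    then have "i = 0 \<or> i = k - 1" using i by auto
    then show ?thesis using i by auto
  qed
  show "(\<Sum>i<k. c i) + k \<le> n" using card_verts verts by simp
  have c_out: "(\<lambda>i. if i < k then c i else 0) = c"
  proof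
    fix i
    have "c i = 0" if "\<not> i < k"
    proof -
      have "{x \<in> L. h x = i} = {}" using host that by auto
      then show ?thesis by (simp only: c_def card.empty)
    qed
    then show "(if i < k then c i else 0) = c i" by simp
  qed
  have "0 < c 0" using ends big[of 0] deg_spine[of 0] by auto
  then show "greedy (\<lambda>i. if i < k then c i else 0) k 1 1 = unit_acquisition_number G"
    unfolding c_out using unit_acquisition_number_eq_greedy ends by (auto simp: first_inner_def)
qed

end

text \<open>
  If some spine vertex has degree less than \<open>2\<close>, then the graph is a single vertex or a single edge, for
  which the program finds no spine at all and answers \<open>1\<close>.
\<close>
lemma program_computes_acquisition_number:
  assumes cat: "caterpillar G" and rep: "represents n es G" and word: "16 * (n + 1) ^ 2 < 2 ^ w"
  shows "outputs_within w acquisition_program (input_state n es) (200 * n + 100) (unit_acquisition_number G)"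
proof -
  obtain v k h where sp: "spine G v k h" and
    ends: "k = 1 \<or> {x \<in> pverts G - v ` {..<k}. h x = 0} \<noteq> {} \<and> {x \<in> pverts G - v ` {..<k}. h x = k - 1} \<noteq> {}"
    using caterpillar_spine[OF cat] by blast
  interpret pair_graph G using cat by (simp add: caterpillar_def undirected_tree_def)
  have verts: "pverts G = {..<n}" and parcs: "parcs G = set es \<union> (set es)\<inverse>" and es: "distinct es"
    and asym: "\<And>a b. (a, b) \<in> set es \<Longrightarrow> (b, a) \<notin> set es" using rep by (auto simp: represents_def)
  have edge: "a < n \<and> b < n \<and> a \<noteq> b" if "(a, b) \<in> set es" for a b
  proof -
    have "(a, b) \<in> parcs G" using that parcs by simp
    then show ?thesis using in_arcsD1[of a b] in_arcsD2[of a b] no_loops'[of a b] verts by auto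
  qed
  have "2 * length es = card (parcs G)"
  proof -
    have "card (parcs G) = card (set es) + card ((set es)\<inverse>)"
      unfolding parcs using asym by (intro card_Un_disjoint) auto
    then show ?thesis using es by (simp add: distinct_card)
  qed
  then have m_le: "length es \<le> n"
    using spine.card_arcs_le[OF sp] verts by simp
  have runs: "run n es w" using word m_le edge by unfold_locales auto
  have small: "x < 2 ^ w" if "x \<le> n" for x
  proof -
    have "x \<le> 16 * (n + 1) ^ 2" using that by (simp add: power2_eq_square)
    then show ?thesis using word by simp
  qed
  have fits: "fits w (input_state n es)"
  proof -
    have "fst (es ! (a div 2)) < n \<and> snd (es ! (a div 2)) < n" if "a < 2 * length es" for a
      using edge[of "fst (es ! (a div 2))" "snd (es ! (a div 2))"] that by simp
    then show ?thesis using small m_le by (auto simp: fits_def input_state_def intro: less_imp_le)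
  qed
  interpret S: spine_run G v k h "pverts G - v ` {..<k}" "\<lambda>i. card {x \<in> pverts G - v ` {..<k}. h x = i}" n es w
    "snd (input_state n es)" "length es"
    using sp runs rep by (intro spine_run.intro spine_run_axioms.intro)
  let ?c = "\<lambda>i. card {x \<in> pverts G - v ` {..<k}. h x = i}"
  have ends': "k = 1 \<or> 0 < ?c 0 \<and> 0 < ?c (k - 1)" using ends S.finite_L by (auto simp: card_gt_0_iff)
  have "wp w acquisition_program (\<lambda>s T. fst s 0 = unit_acquisition_number G) (input_state n es) (200 * n + 100)"
  proof (cases "\<forall>i<k. 1 < S.deg (v i)")
    case True
    then have big: "\<And>i. i < k \<Longrightarrow> 1 < S.deg (v i)" by blast
    note fwd = S.walk_from_start[OF big ends']
    let ?v = "\<lambda>i. v (k - 1 - i)" and ?h = "\<lambda>x. k - 1 - h x"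
    interpret B: spine_run G ?v k ?h "pverts G - ?v ` {..<k}" "\<lambda>i. card {x \<in> pverts G - ?v ` {..<k}. ?h x = i}" n es w
      "snd (input_state n es)" "length es"
      using spine_reverse[OF sp] runs rep by (intro spine_run.intro spine_run_axioms.intro)
    let ?d = "\<lambda>i. card {x \<in> pverts G - ?v ` {..<k}. ?h x = i}"
    have bigB: "1 < S.deg (?v i)" if "i < k" for i using big that by simp
    have endsB: "k = 1 \<or> 0 < ?d 0 \<and> 0 < ?d (k - 1)"
    proof (cases "k = 1")
      case False
      have "{x \<in> pverts G - v ` {..<k}. h x = k - 1} \<subseteq> {x \<in> pverts G - ?v ` {..<k}. ?h x = 0}"
        "{x \<in> pverts G - v ` {..<k}. h x = 0} \<subseteq> {x \<in> pverts G - ?v ` {..<k}. ?h x = k - 1}"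
        unfolding image_reverse by auto
      then have "?c (k - 1) \<le> ?d 0" "?c 0 \<le> ?d (k - 1)" using verts by (auto intro!: card_mono)
      then show ?thesis using ends' False by linarith
    qed simp
    note bwd = B.walk_from_start[OF bigB endsB]
    show ?thesis
    proof (rule S.acquisition_program_correct[where K = k])
      show "k = card {u. u < n \<and> 1 < S.deg u}" using fwd(1) by simp
      show "\<exists>u. S.spine_end u" using fwd(3) by blast
      fix u assume "0 < k \<Longrightarrow> S.spine_end u"
      then have "u = v 0 \<or> u = v (k - 1)" using fwd(2) S.k_pos by blast
      then show "\<exists>v c. (0 < k \<longrightarrow> v 0 = u) \<and> (\<forall>i<k. v i < n \<and> S.lvs (length es) (v i) = c i) \<and>
        (\<forall>i. Suc i < k \<longrightarrow> S.nbs (length es) (v i) - (if i = 0 then 0 else v (i - 1)) = v (Suc i)) \<and>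
        (\<Sum>i<k. c i) + k \<le> n \<and> greedy (\<lambda>i. if i < k then c i else 0) k 1 1 = unit_acquisition_number G"
      proof
        assume "u = v 0"
        then show ?thesis by (intro exI[of _ v] exI[of _ ?c] conjI fwd(4-7)) simp
      next
        assume "u = v (k - 1)"
        then show ?thesis by (intro exI[of _ ?v] exI[of _ ?d] conjI bwd(4-7)) simp
      qed
    qed
  next
    case False
    then obtain i where i: "i < k" "\<not> 1 < S.deg (v i)" by blast
    have k1: "k = 1"
    proof (rule ccontr)
      assume "k \<noteq> 1"
      then have c: "0 < ?c 0" "0 < ?c (k - 1)" using ends' by blast+
      have k: "1 < k" using S.k_pos \<open>k \<noteq> 1\<close> by linarith
      consider "i = 0" | "i = k - 1" "i \<noteq> 0" | "i \<noteq> 0" "Suc i < k" using i(1) by linarith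
      then show False
      proof cases
        case 1
        have "S.deg (v 0) = 1 + ?c 0" using S.deg_spine[of 0] k by (simp only: if_True) simp
        then show ?thesis using c(1) i(2) 1 by simp
      next
        case 2
        have "S.deg (v i) = 1 + ?c i" using S.deg_spine[OF i(1)] 2 by simp
        then show ?thesis using c(2) i(2) 2(1) by simp
      next
        case 3
        then show ?thesis using S.deg_spine[OF i(1)] i(2) by simp
      qed
    qed
    have none: "{u. u < n \<and> 1 < S.deg u} = {}"
    proof -
      have "\<not> 1 < S.deg u" if "u < n" for u
      proof (cases "u = v 0")
        case True
        then show ?thesis using i k1 by simp
      next
        case False
        then have "u \<in> pverts G - v ` {..<k}" using that k1 verts by auto
        then show ?thesis using S.deg_leaf by fastforce
      qed
      then show ?thesis by blast
    qed
    have "unit_acquisition_number G = 1"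
    proof -
      have "greedy ?c k (first_inner ?c 0) (first_inner ?c 0) = 1"
        by (subst greedy.simps) (simp add: k1 first_inner_def)
      then show ?thesis using S.unit_acquisition_number_eq_greedy k1 by simp
    qed
    then show ?thesis using none
      by (intro S.acquisition_program_correct[where K = 0]) (auto simp: greedy.simps[of _ 0] intro!: exI[of _ "\<lambda>_. 0"])
  qed
  then obtain t s' where "exec w acquisition_program (input_state n es) t s'" "t \<le> 200 * n + 100" "fst s' 0 = unit_acquisition_number G"
    using fits unfolding wp_def by blast
  then show ?thesis using fits unfolding outputs_within_def by blast
qed

text \<open>
  Twice the number of binary digits of \<open>n\<close>, for quadratic numbers, and a constant for the factor \<open>16\<close>.
\<close>
definition word_length :: "nat \<Rightarrow> nat" where
  "word_length n = 2 * nat \<lceil>log 2 (real n + 1)\<rceil> + 5"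

lemma word_length_sufficient: "16 * (n + 1) ^ 2 < 2 ^ word_length n"
proof -
  define e where "e = nat \<lceil>log 2 (real n + 1)\<rceil>"
  have "log 2 (real n + 1) \<le> real e" unfolding e_def by linarith
  then have "real n + 1 \<le> 2 powr real e" by (simp add: log_le_iff)
  then have "real (n + 1) \<le> real (2 ^ e)" by (simp add: powr_realpow)
  then have le: "n + 1 \<le> 2 ^ e" by (simp only: of_nat_le_iff)
  have "16 * (n + 1) ^ 2 < 32 * (n + 1) ^ 2" by simp
  also have "\<dots> \<le> 32 * (2 ^ e) ^ 2" using le by (intro mult_le_mono power_mono) auto
  also have "\<dots> = 2 ^ word_length n"
    by (simp add: word_length_def e_def[symmetric] power_add power_mult[symmetric] mult.commute)
  finally show ?thesis .
qed

lemma word_length_logarithmic: "(\<lambda>n. real (word_length n)) \<in> O(\<lambda>n. log 2 (real n))"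
proof (rule bigoI)
  show "\<forall>\<^sub>F n in at_top. norm (real (word_length n)) \<le> 11 * norm (log 2 (real n))"
    using eventually_ge_at_top[of 2]
  proof eventually_elim
    case (elim n)
    have 1: "1 \<le> log 2 (real n)" using elim by (simp add: le_log_iff)
    have "log 2 (real n + 1) \<le> log 2 (real n ^ 2)"
    proof -
      have "2 * n \<le> n * n" using elim by (rule mult_le_mono1)
      then have "n + 1 \<le> n * n" using elim by linarith
      then have "real (n + 1) \<le> real (n * n)" by (simp only: of_nat_le_iff)
      then show ?thesis using elim by (simp add: power2_eq_square)
    qed
    also have "\<dots> = 2 * log 2 (real n)" using elim by (simp add: log_nat_power)
    finally have log: "log 2 (real n + 1) \<le> 2 * log 2 (real n)" .
    define e where "e = nat \<lceil>log 2 (real n + 1)\<rceil>"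
    have "real e \<le> 2 * log 2 (real n) + 1" using log 1 unfolding e_def by linarith
    then show ?case using 1 unfolding word_length_def e_def[symmetric] by simp
  qed
qed

theorem corollary4p6:
  shows "\<exists>(P :: program) (w :: nat \<Rightarrow> nat) (T :: nat \<Rightarrow> nat).
    (\<lambda>n. real (w n)) \<in> O(\<lambda>n. log 2 (real n)) \<and>
    (\<lambda>n. real (T n)) \<in> O(\<lambda>n. real n) \<and>
    (\<forall>(G :: nat pair_pre_digraph) n es.
       caterpillar G \<and> represents n es G \<longrightarrow>
       outputs_within (w n) P (input_state n es) (T n) (unit_acquisition_number G))"
proof (intro exI conjI allI impI)
  show "(\<lambda>n. real (word_length n)) \<in> O(\<lambda>n. log 2 (real n))" by (rule word_length_logarithmic)
  show "(\<lambda>n. real (200 * n + 100)) \<in> O(\<lambda>n. real n)"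
  proof (rule bigoI)
    show "\<forall>\<^sub>F n in at_top. norm (real (200 * n + 100)) \<le> 300 * norm (real n)"
      using eventually_ge_at_top[of 1] by eventually_elim simp
  qed
  show "outputs_within (word_length n) acquisition_program (input_state n es) (200 * n + 100) (unit_acquisition_number G)"
    if "caterpillar G \<and> represents n es G" for G n es
    using that program_computes_acquisition_number word_length_sufficient by blast
qed

end
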